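(* Let $\mu,\nu\in\mathcal{P}_2(\mathbb{R}^n)$ be two Borel probability measures with finite second moments and the same barycentre. Then $\mu\prec_{c-c}\nu$ if and only if there exists a bimartingale coupling $\pi$ between $\mu$ and $\nu$. More precisely, if $V_1,V_2$ are orthogonal, mutually complementing subspaces of $\mathbb{R}^n$, then there exists $\pi\in\Gamma_{bm}(\mu,\nu,V_1,V_2)$ if and only if $\mu\prec_{c-c}\nu$ with respect to $V_1,V_2$. If $\sigma\in\Sigma(\mu,\nu)$ is optimal for $\mathcal{J}(\mu,\nu)$ and $\mu\prec_{c-c}\nu$ with respect to $V_1,V_2$, then $\mathrm{P}_{12}\sigma\in\Gamma_{bm}(\mu,\nu,V_1,V_2)$ and $\sigma=R_{\#}\mathrm{P}_{12}\sigma$, where $$R(x,y)=(x,y,P_{V_2}x+P_{V_1}y)\quad\text{for }x,y\in\mathbb{R}^n.$$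
   Context: $\|\cdot\|$ is the Euclidean norm, $P_W$ the orthogonal projection onto the subspace $W$, $T_{\#}$ the pushforward by $T$. $\mathcal{P}_p(\mathbb{R}^n)$ is the set of Borel probability measures on $\mathbb{R}^n$ with finite $p$-th moment; the barycentre of $\mu$ is $\int x\,d\mu(x)$. $\mathrm{P}_i\sigma$, $\mathrm{P}_{ij}\sigma$ are the marginals of $\sigma$ on the indicated copies of $\mathbb{R}^n$; $\Gamma(\mu,\nu)$ is the set of Borel probability measures on $\mathbb{R}^n\times\mathbb{R}^n$ with marginals $\mu,\nu$. Subspaces $V_1,V_2$ are mutually complementing if $V_1\oplus V_2=\mathbb{R}^n$. Convex-concave order: for orthogonal mutually complementing $V_1,V_2$, a function $f\colon\mathbb{R}^n\to\mathbb{R}$ is convex-concave with respect to $V_1,V_2$ if $v_1\mapsto f(v_1+v_2)$ is convex on $V_1$ for each $v_2\in V_2$ and $v_2\mapsto f(v_1+v_2)$ is concave on $V_2$ for each $v_1\in V_1$. It has at most quadratic growth if $|f(v)|\le C(1+\|v\|^2)$ for some $C\ge0$ and all $v$. One says $\mu\prec_{c-c}\nu$ with respect to $V_1,V_2$ if $\int f\,d\mu\le\int f\,d\nu$ for every $f$ that is convex-concave with respect to $V_1,V_2$ and of at most quadratic growth; and $\mu\prec_{c-c}\nu$ if this holds for some orthogonal mutually complementing $V_1,V_2$. Bimartingale couplings: $\Gamma_{bm}(\mu,\nu,V_1,V_2)$ is the set of $\pi\in\Gamma(\mu,\nu)$ such that for all bounded Borel $g,h\colon\mathbb{R}^n\to\mathbb{R}$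 $$\int P_{V_1}(y)g(x)\,d\pi(x,y)=\int P_{V_1}(x)g(x)\,d\pi(x,y),\qquad\int P_{V_2}(x)h(y)\,d\pi(x,y)=\int P_{V_2}(y)h(y)\,d\pi(x,y).$$ A bimartingale coupling between $\mu$ and $\nu$ is an element of $\Gamma_{bm}(\mu,\nu,V_1,V_2)$ for some orthogonal mutually complementing $V_1,V_2$. $\Sigma(\mu,\nu)$ is the set of Borel probability measures $\sigma$ on $(\mathbb{R}^n)^3$ with $\mathrm{P}_1\sigma=\mu$, $\mathrm{P}_2\sigma=\nu$, $\mathrm{P}_3\sigma\in\mathcal{P}_1(\mathbb{R}^n)$ and $\int(z-x)g(x)\,d\sigma(x,y,z)=\int(z-y)h(y)\,d\sigma(x,y,z)=0$ for all bounded Borel $g,h\colon\mathbb{R}^n\to\mathbb{R}$. $\mathcal{J}(\mu,\nu)=\inf\{\int\frac12(\|x-z\|^2+\|y-z\|^2)\,d\sigma(x,y,z)\mid\sigma\in\Sigma(\mu,\nu)\}$; $\sigma$ is optimal if it attains the infimum. *)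

theory Defs
  imports "HOL-Probability.Probability"
begin

section \<open>Orthogonal decompositions\<close>

definition mutually_complementing :: "'a::euclidean_space set \<Rightarrow> 'a set \<Rightarrow> bool" where
  "mutually_complementing V\<^sub>1 V\<^sub>2 \<longleftrightarrow>
     subspace V\<^sub>1 \<and> subspace V\<^sub>2 \<and> V\<^sub>1 \<inter> V\<^sub>2 = {0} \<and> {v\<^sub>1 + v\<^sub>2 | v\<^sub>1 v\<^sub>2. v\<^sub>1 \<in> V\<^sub>1 \<and> v\<^sub>2 \<in> V\<^sub>2} = UNIV"

definition orthogonal_complementing :: "'a::euclidean_space set \<Rightarrow> 'a set \<Rightarrow> bool" where
  "orthogonal_complementing V\<^sub>1 V\<^sub>2 \<longleftrightarrow>
     mutually_complementing V\<^sub>1 V\<^sub>2 \<and> (\<forall>v\<^sub>1\<in>V\<^sub>1. \<forall>v\<^sub>2\<in>V\<^sub>2. orthogonal v\<^sub>1 v\<^sub>2)"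

definition orth_proj :: "'a::euclidean_space set \<Rightarrow> 'a \<Rightarrow> 'a" where
  "orth_proj W x = (THE p. p \<in> W \<and> x - p \<in> W\<^sup>\<bottom>)"

lemma orth_proj_unique:
  assumes "subspace W" "p \<in> W" "x - p \<in> W\<^sup>\<bottom>"
  shows "orth_proj W x = p"
  unfolding orth_proj_def
proof (rule the_equality)
  fix q assume q: "q \<in> W \<and> x - q \<in> W\<^sup>\<bottom>"
  have "p - q \<in> W" using assms q by (simp add: subspace_diff)
  moreover have "(x - q) - (x - p) \<in> W\<^sup>\<bottom>"
    using assms q by (blast intro: subspace_diff subspace_orthogonal_comp)
  ultimately have "orthogonal (p - q) (p - q)" by (simp add: orthogonal_comp_def)
  then show "q = p" by (simp add: orthogonal_self)
qed (use assms in simp)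

lemma
  assumes "subspace W"
  shows orth_proj_in: "orth_proj W x \<in> W"
    and orth_proj_diff: "x - orth_proj W x \<in> W\<^sup>\<bottom>"
proof -
  obtain p q where "p \<in> W" "q \<in> W\<^sup>\<bottom>" "x = p + q"
    using subspace_sum_orthogonal_comp[OF assms] by (metis UNIV_I set_plus_elim)
  moreover from this have "orth_proj W x = p" using assms by (intro orth_proj_unique) auto
  ultimately show "orth_proj W x \<in> W" "x - orth_proj W x \<in> W\<^sup>\<bottom>" by auto
qed

section \<open>Borel probability measures with finite moments\<close>

definition borel_prob :: "'a::topological_space measure set" where
  "borel_prob = {\<mu>. prob_space \<mu> \<and> sets \<mu> = sets borel}"

definition finite_moment_prob :: "real \<Rightarrow> 'a::euclidean_space measure set" where
  "finite_moment_prob p = {\<mu> \<in> borel_prob. integrable \<mu> (\<lambda>x. norm x powr p)}"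

definition barycentre :: "'a::euclidean_space measure \<Rightarrow> 'a" where
  "barycentre \<mu> = (\<integral>x. x \<partial>\<mu>)"

definition bounded_borel :: "('a::euclidean_space \<Rightarrow> real) \<Rightarrow> bool" where
  "bounded_borel g \<longleftrightarrow> g \<in> borel_measurable borel \<and> bounded (range g)"

section \<open>Convex-concave order\<close>

definition convex_concave :: "'a::euclidean_space set \<Rightarrow> 'a set \<Rightarrow> ('a \<Rightarrow> real) \<Rightarrow> bool" where
  "convex_concave V\<^sub>1 V\<^sub>2 f \<longleftrightarrow>
     (\<forall>v\<^sub>2\<in>V\<^sub>2. convex_on V\<^sub>1 (\<lambda>v\<^sub>1. f (v\<^sub>1 + v\<^sub>2))) \<and>
     (\<forall>v\<^sub>1\<in>V\<^sub>1. concave_on V\<^sub>2 (\<lambda>v\<^sub>2. f (v\<^sub>1 + v\<^sub>2)))"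

definition quadratic_growth :: "('a::euclidean_space \<Rightarrow> real) \<Rightarrow> bool" where
  "quadratic_growth f \<longleftrightarrow> (\<exists>C\<ge>0. \<forall>v. \<bar>f v\<bar> \<le> C * (1 + (norm v)\<^sup>2))"

text \<open>Real-valued convex-concave functions on a finite-dimensional space are continuous, hence
  Borel; with quadratic growth they are integrable against measures with finite second moment,
  so for such measures the Bochner integrals below never take their default value.\<close>

definition cc_order_wrt ::
    "'a::euclidean_space set \<Rightarrow> 'a set \<Rightarrow> 'a measure \<Rightarrow> 'a measure \<Rightarrow> bool" where
  "cc_order_wrt V\<^sub>1 V\<^sub>2 \<mu> \<nu> \<longleftrightarrow>
     (\<forall>f. convex_concave V\<^sub>1 V\<^sub>2 f \<and> quadratic_growth f \<longrightarrow> (\<integral>v. f v \<partial>\<mu>) \<le> (\<integral>v. f v \<partial>\<nu>))"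

definition cc_order :: "'a::euclidean_space measure \<Rightarrow> 'a measure \<Rightarrow> bool" where
  "cc_order \<mu> \<nu> \<longleftrightarrow> (\<exists>V\<^sub>1 V\<^sub>2. orthogonal_complementing V\<^sub>1 V\<^sub>2 \<and> cc_order_wrt V\<^sub>1 V\<^sub>2 \<mu> \<nu>)"

section \<open>Bimartingale couplings\<close>

definition couplings ::
    "'a::euclidean_space measure \<Rightarrow> 'a measure \<Rightarrow> ('a \<times> 'a) measure set" where
  "couplings \<mu> \<nu> = {\<pi> \<in> borel_prob. distr \<pi> borel fst = \<mu> \<and> distr \<pi> borel snd = \<nu>}"

definition bimartingale_couplings_wrt ::
    "'a::euclidean_space measure \<Rightarrow> 'a measure \<Rightarrow> 'a set \<Rightarrow> 'a set \<Rightarrow> ('a \<times> 'a) measure set" where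
  "bimartingale_couplings_wrt \<mu> \<nu> V\<^sub>1 V\<^sub>2 = {\<pi> \<in> couplings \<mu> \<nu>.
     \<forall>g h. bounded_borel g \<and> bounded_borel h \<longrightarrow>
       (\<integral>(x, y). g x *\<^sub>R orth_proj V\<^sub>1 y \<partial>\<pi>) = (\<integral>(x, y). g x *\<^sub>R orth_proj V\<^sub>1 x \<partial>\<pi>) \<and>
       (\<integral>(x, y). h y *\<^sub>R orth_proj V\<^sub>2 x \<partial>\<pi>) = (\<integral>(x, y). h y *\<^sub>R orth_proj V\<^sub>2 y \<partial>\<pi>)}"

definition bimartingale_couplings ::
    "'a::euclidean_space measure \<Rightarrow> 'a measure \<Rightarrow> ('a \<times> 'a) measure set" where
  "bimartingale_couplings \<mu> \<nu> =
     {\<pi>. \<exists>V\<^sub>1 V\<^sub>2. orthogonal_complementing V\<^sub>1 V\<^sub>2 \<and> \<pi> \<in> bimartingale_couplings_wrt \<mu> \<nu> V\<^sub>1 V\<^sub>2}"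

section \<open>The three-marginal problem\<close>

definition martingale_triples ::
    "'a::euclidean_space measure \<Rightarrow> 'a measure \<Rightarrow> ('a \<times> 'a \<times> 'a) measure set" where
  "martingale_triples \<mu> \<nu> = {\<sigma> \<in> borel_prob.
     distr \<sigma> borel (\<lambda>(x, y, z). x) = \<mu> \<and>
     distr \<sigma> borel (\<lambda>(x, y, z). y) = \<nu> \<and>
     distr \<sigma> borel (\<lambda>(x, y, z). z) \<in> finite_moment_prob 1 \<and>
     (\<forall>g h. bounded_borel g \<and> bounded_borel h \<longrightarrow>
       (\<integral>(x, y, z). g x *\<^sub>R (z - x) \<partial>\<sigma>) = 0 \<and> (\<integral>(x, y, z). h y *\<^sub>R (z - y) \<partial>\<sigma>) = 0)}"

text \<open>The third marginal is only required to have a finite first moment, so the cost may be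
  infinite; it is therefore taken in \<^typ>\<open>ennreal\<close>.\<close>

definition triple_cost :: "('a::euclidean_space \<times> 'a \<times> 'a) measure \<Rightarrow> ennreal" where
  "triple_cost \<sigma> =
     (\<integral>\<^sup>+(x, y, z). ennreal (1/2 * ((norm (x - z))\<^sup>2 + (norm (y - z))\<^sup>2)) \<partial>\<sigma>)"

definition triple_value :: "'a::euclidean_space measure \<Rightarrow> 'a measure \<Rightarrow> ennreal" where
  "triple_value \<mu> \<nu> = (INF \<sigma>\<in>martingale_triples \<mu> \<nu>. triple_cost \<sigma>)"

definition optimal_triple ::
    "'a::euclidean_space measure \<Rightarrow> 'a measure \<Rightarrow> ('a \<times> 'a \<times> 'a) measure \<Rightarrow> bool" where
  "optimal_triple \<mu> \<nu> \<sigma> \<longleftrightarrow>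
     \<sigma> \<in> martingale_triples \<mu> \<nu> \<and> triple_cost \<sigma> = triple_value \<mu> \<nu>"

definition marginal12 :: "('a::euclidean_space \<times> 'a \<times> 'a) measure \<Rightarrow> ('a \<times> 'a) measure" where
  "marginal12 \<sigma> = distr \<sigma> borel (\<lambda>(x, y, z). (x, y))"

definition recon_map ::
    "'a::euclidean_space set \<Rightarrow> 'a set \<Rightarrow> 'a \<times> 'a \<Rightarrow> 'a \<times> 'a \<times> 'a" where
  "recon_map V\<^sub>1 V\<^sub>2 = (\<lambda>(x, y). (x, y, orth_proj V\<^sub>2 x + orth_proj V\<^sub>1 y))"

end

theory Submission
  imports Defs
begin

text \<open>
  Write \<open>P\<close>, \<open>Q\<close> for the projections onto \<open>V\<^sub>1\<close>, \<open>V\<^sub>2\<close>. Three statements are proved for a fixed pair of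
  subspaces.

  A bimartingale coupling of \<open>\<mu>\<close> and \<open>\<nu>\<close> forces the convex-concave order: for a pair \<open>(x, y)\<close> with that
  law and a convex-concave \<open>f\<close>, Jensen's inequality along \<open>V\<^sub>1\<close> given \<open>x\<close> and along \<open>V\<^sub>2\<close> given \<open>y\<close> shows
  \<open>E f(x) \<le> E f(P y + Q x) \<le> E f(y)\<close> (\<open>convex_concave_Jensen\<close>, \<open>bimartingale_imp_cc_order\<close>). The conditional
  Jensen inequality rests on subgradients of linear growth; these also show that convex-concave functions
  of quadratic growth are locally Lipschitz, hence Borel.

  Conversely, let the order hold. Consider the functions
  \<open>t(x, y) = a(x) - \<integral>a d\<mu> + b(y) - \<integral>b d\<nu> + g(x) \<bullet> (P y - P x) + h(y) \<bullet> (Q x - Q y)\<close>. If such a \<open>t\<close> were bounded below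
  by some \<open>\<epsilon> > 0\<close>, then the supremum of \<open>\<Sum>\<lambda>\<^sub>i (\<integral>a d\<mu> - a(x\<^sub>i) - g(x\<^sub>i) \<bullet> (P w - P x\<^sub>i))\<close> over the convex combinations
  with \<open>\<Sum>\<lambda>\<^sub>i Q x\<^sub>i = Q w\<close> would be a convex-concave function \<open>f\<close> of \<open>w\<close> with
  \<open>\<integral>a d\<mu> - a \<le> f \<le> b - \<integral>b d\<nu> - \<epsilon>\<close>, and integration would contradict the order (\<open>convex_concave_hull\<close>,
  \<open>no_positive_coupling_test\<close>). As these functions form a vector space, separation in finite dimension yields
  finitely supported probability measures on which any finitely many of them are almost 0
  (\<open>approximate_coupling\<close>). Second moments are among the tests, so a subsequence converges weakly
  (\<open>weakly_convergent_subsequence\<close>), and countably many continuous tests suffice to recognize the limit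
  as a bimartingale coupling (\<open>cc_order_imp_bimartingale\<close>).

  Finally, for every \<open>\<sigma> \<in> \<Sigma>(\<mu>, \<nu>)\<close> whose third marginal has a second moment, the cost equals
  \<open>\<integral>\<parallel>P z - P y\<parallel>\<^sup>2 + \<parallel>Q z - Q x\<parallel>\<^sup>2 d\<sigma>\<close> plus a constant that depends on the marginals only
  (\<open>triple_cost_decomposition\<close>). A bimartingale coupling provides a triple for which the integral vanishes.
  Hence it vanishes for every optimal triple, that is, \<open>z = Q x + P y\<close> almost surely, and the martingale
  conditions on \<open>z\<close> become the bimartingale conditions on \<open>(x, y)\<close> (\<open>optimal_triple_bimartingale\<close>).
\<close>

section \<open>Orthogonal decompositions\<close>

text \<open>An orthogonal decomposition into two subspaces \<open>V\<close> and \<open>W\<close>, with orthogonal projections \<open>P\<close> and \<open>Q\<close>.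
  The situation is symmetric, and lemma \<open>swap\<close> transfers every statement to the pair \<open>W\<close>, \<open>V\<close>.\<close>

locale orth_decomp =
  fixes V W :: "'a::euclidean_space set"
  assumes orth_compl: "orthogonal_complementing V W"
begin

abbreviation P where "P \<equiv> orth_proj V"
abbreviation Q where "Q \<equiv> orth_proj W"

lemma subspace_V: "subspace V" and subspace_W: "subspace W"
  using orth_compl by (simp_all add: orthogonal_complementing_def mutually_complementing_def)

lemma swap: "orth_decomp W V"
proof
  have "\<exists>v\<^sub>1 v\<^sub>2. x = v\<^sub>1 + v\<^sub>2 \<and> v\<^sub>1 \<in> W \<and> v\<^sub>2 \<in> V" for x
  proof -
    have "x \<in> {v\<^sub>1 + v\<^sub>2 | v\<^sub>1 v\<^sub>2. v\<^sub>1 \<in> V \<and> v\<^sub>2 \<in> W}"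
      using orth_compl unfolding orthogonal_complementing_def mutually_complementing_def by blast
    then obtain v w where "v \<in> V" "w \<in> W" "x = w + v" by (auto simp: add.commute)
    then show ?thesis by blast
  qed
  then have "{v\<^sub>1 + v\<^sub>2 | v\<^sub>1 v\<^sub>2. v\<^sub>1 \<in> W \<and> v\<^sub>2 \<in> V} = UNIV" by blast
  moreover have "W \<inter> V = {0}"
    using orth_compl unfolding orthogonal_complementing_def mutually_complementing_def by blast
  moreover have "orthogonal w v" if "w \<in> W" "v \<in> V" for w v
    using orth_compl that unfolding orthogonal_complementing_def by (metis orthogonal_commute)
  ultimately show "orthogonal_complementing W V"
    using subspace_V subspace_W
    by (simp add: orthogonal_complementing_def mutually_complementing_def)
qed

lemma V_orth_W: "v \<in> V \<Longrightarrow> w \<in> W \<Longrightarrow> v \<bullet> w = 0"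
  using orth_compl by (simp add: orthogonal_complementing_def orthogonal_def)

lemma proj_unique:
  assumes "v \<in> V" "w \<in> W" shows "P (v + w) = v"
  using assms V_orth_W
  by (intro orth_proj_unique subspace_V) (auto simp: orthogonal_comp_def orthogonal_def)

lemma proj_in: "P x \<in> V" "Q x \<in> W"
  by (auto intro: orth_proj_in subspace_V subspace_W)

lemma proj_sum: "P x + Q x = x"
proof -
  obtain v w where "v \<in> V" "w \<in> W" "x = v + w"
    using orth_compl unfolding orthogonal_complementing_def mutually_complementing_def by blast
  moreover from this have "P x = v" by (simp add: proj_unique)
  moreover have "Q x = w"
    using orth_decomp.proj_unique[OF swap] calculation by (metis add.commute)
  ultimately show ?thesis by simp
qed

lemma proj_V [simp]: "v \<in> V \<Longrightarrow> P v = v"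
  using proj_unique[of v 0] subspace_W by (simp add: subspace_0)

lemma proj_W [simp]: "w \<in> W \<Longrightarrow> P w = 0"
  using proj_unique[of 0 w] subspace_V by (simp add: subspace_0)

lemma linear_P: "linear P"
proof
  fix x y :: 'a and r :: real
  have "P x + P y + (Q x + Q y) = x + y"
    by (metis proj_sum add.assoc add.left_commute)
  then show "P (x + y) = P x + P y"
    using proj_unique[of "P x + P y" "Q x + Q y"] proj_in
    by (simp add: subspace_add subspace_V subspace_W)
  have "r *\<^sub>R P x + r *\<^sub>R Q x = r *\<^sub>R x"
    by (metis proj_sum scaleR_add_right)
  then show "P (r *\<^sub>R x) = r *\<^sub>R P x"
    using proj_unique[of "r *\<^sub>R P x" "r *\<^sub>R Q x"] proj_in
    by (simp add: subspace_scale subspace_V subspace_W)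
qed

lemma linear_Q: "linear Q"
  using orth_decomp.linear_P[OF swap] .

lemma bounded_linear_P: "bounded_linear P" and bounded_linear_Q: "bounded_linear Q"
  using linear_P linear_Q by (simp_all add: linear_conv_bounded_linear)

lemmas proj_linear_simps =
  linear_add[OF linear_P] linear_diff[OF linear_P] linear_cmul[OF linear_P] linear_0[OF linear_P]
  linear_add[OF linear_Q] linear_diff[OF linear_Q] linear_cmul[OF linear_Q] linear_0[OF linear_Q]

lemma proj_proj [simp]: "P (P x) = P x" "P (Q x) = 0" "Q (Q x) = Q x" "Q (P x) = 0"
  using proj_in orth_decomp.proj_V[OF swap] orth_decomp.proj_W[OF swap] by auto

lemma inner_PQ [simp]: "P x \<bullet> Q y = 0" "Q x \<bullet> P y = 0"
  using V_orth_W proj_in by (auto simp: inner_commute)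

lemma inner_P: "x \<bullet> P y = P x \<bullet> P y" and inner_Q: "x \<bullet> Q y = Q x \<bullet> Q y"
  by (metis add.right_neutral inner_PQ(2) inner_add_left proj_sum,
      metis add_0 inner_PQ(1) inner_add_left proj_sum)

lemma norm_sq_decomp: "(norm x)\<^sup>2 = (norm (P x))\<^sup>2 + (norm (Q x))\<^sup>2"
proof -
  have "x \<bullet> x = (P x + Q x) \<bullet> (P x + Q x)" by (simp add: proj_sum)
  then show ?thesis by (simp add: power2_norm_eq_inner inner_add_left inner_add_right)
qed

lemma norm_P_le: "norm (P x) \<le> norm x" and norm_Q_le: "norm (Q x) \<le> norm x"
  by (rule power2_le_imp_le; simp add: norm_sq_decomp[of x])+

lemma continuous_P [continuous_intros]: "continuous_on S P"
  and continuous_Q [continuous_intros]: "continuous_on S Q"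
  by (rule linear_continuous_on bounded_linear_P bounded_linear_Q)+

lemma measurable_P [measurable]: "P \<in> borel_measurable borel"
  and measurable_Q [measurable]: "Q \<in> borel_measurable borel"
  by (rule borel_measurable_continuous_onI continuous_P continuous_Q)+

end

section \<open>Subgradients of convex functions of quadratic growth\<close>

lemma convex_subgradient:
  fixes F :: "'a::euclidean_space \<Rightarrow> real"
  assumes F: "convex_on UNIV F"
  obtains p where "\<And>v. F u + p \<bullet> (v - u) \<le> F v"
proof -
  have "convex {(v, r). F v < r}"
  proof (rule convexI)
    fix x y :: "'a \<times> real" and a b :: real
    assume xy: "x \<in> {(v, r). F v < r}" "y \<in> {(v, r). F v < r}" and ab: "0 \<le> a" "0 \<le> b" "a + b = 1"
    have "F (a *\<^sub>R fst x + b *\<^sub>R fst y) \<le> a * F (fst x) + b * F (fst y)"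
      using F ab by (auto simp: convex_on_def)
    also have "\<dots> < a * snd x + b * snd y"
    proof (cases "a = 0")
      case True then show ?thesis using xy ab by auto
    next
      case False
      then have "a * F (fst x) < a * snd x" "b * F (fst y) \<le> b * snd y"
        using xy ab by (auto intro!: mult_left_mono mult_strict_left_mono)
      then show ?thesis by linarith
    qed
    finally show "a *\<^sub>R x + b *\<^sub>R y \<in> {(v, r). F v < r}"
      by (auto simp: case_prod_unfold)
  qed
  moreover have "{(v, r). F v < r} \<noteq> {}"
    using gt_ex by blast
  ultimately have "\<exists>c \<beta>. c \<noteq> 0 \<and> (\<forall>z\<in>{(v, r). F v < r}. c \<bullet> z \<le> \<beta>) \<and> (\<forall>z\<in>{(u, F u)}. \<beta> \<le> c \<bullet> z)"
    by (intro separating_hyperplane_sets) auto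
  then obtain c \<beta> where c: "c \<noteq> 0" "\<And>z. z \<in> {(v, r). F v < r} \<Longrightarrow> c \<bullet> z \<le> \<beta>" "\<beta> \<le> c \<bullet> (u, F u)"
    by (metis singletonI)
  define q s where "q = fst c" and "s = snd c"
  have *: "q \<bullet> v + s * r \<le> q \<bullet> u + s * F u" if "F v < r" for v r
    using c(2)[of "(v, r)"] c(3) that by (simp add: inner_prod_def q_def s_def)
  have "s * (F u + 1) \<le> s * F u" using *[of u "F u + 1"] by simp
  then have "s \<le> 0" by (simp add: algebra_simps)
  moreover have "s \<noteq> 0"
  proof
    assume "s = 0"
    then have "q \<bullet> q \<le> 0"
      using *[of "u + q" "F (u + q) + 1"] by (simp add: inner_add_right)
    then have "q = 0" by (metis inner_gt_zero_iff not_le)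
    then show False using c(1) \<open>s = 0\<close> by (simp add: q_def s_def prod_eq_iff)
  qed
  ultimately have s: "s < 0" by simp
  have "F u + ((- 1 / s) *\<^sub>R q) \<bullet> (v - u) \<le> F v" for v
  proof (rule field_le_epsilon)
    fix e :: real assume "e > 0"
    then have "q \<bullet> (v - u) \<le> - s * (F v + e - F u)"
      using *[of v "F v + e"] by (simp add: inner_diff_right algebra_simps)
    then have "q \<bullet> (v - u) / (- s) \<le> F v + e - F u"
      using s by (simp add: field_simps)
    then show "F u + ((- 1 / s) *\<^sub>R q) \<bullet> (v - u) \<le> F v + e" by simp
  qed
  then show ?thesis using that by blast
qed

text \<open>Testing the subgradient inequality at distance \<open>1 + norm u + m\<close> from \<open>u\<close> turns the quadratic
  growth of the function into linear growth of its subgradients.\<close>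

lemma convex_subgradient_bound:
  fixes F :: "'a::euclidean_space \<Rightarrow> real"
  assumes F: "convex_on UNIV F" and A: "A \<ge> 0" and m: "m \<ge> 0"
    and growth: "\<And>v. \<bar>F v\<bar> \<le> A * (1 + (norm v + m)\<^sup>2)"
  obtains p where "norm p \<le> 10 * A * (1 + norm u + m)" "\<And>v. F u + p \<bullet> (v - u) \<le> F v"
proof -
  obtain p where p: "\<And>v. F u + p \<bullet> (v - u) \<le> F v" using convex_subgradient[OF F] by metis
  define \<rho> where "\<rho> = 1 + norm u + m"
  have \<rho>: "\<rho> \<ge> 1" using m by (simp add: \<rho>_def)
  define w where "w = u + \<rho> *\<^sub>R sgn p"
  have pp: "p \<bullet> p = norm p * norm p" by (metis dot_square_norm power2_eq_square)
  have "p \<bullet> (w - u) = \<rho> * norm p"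
    by (cases "p = 0") (simp_all add: w_def sgn_div_norm pp field_simps)
  then have "\<rho> * norm p \<le> F w - F u" using p[of w] by simp
  also have "\<dots> \<le> \<bar>F w\<bar> + \<bar>F u\<bar>" by linarith
  also have "\<dots> \<le> A * (5 * \<rho>\<^sup>2) + A * (5 * \<rho>\<^sup>2)"
  proof -
    have "1 + (norm w + m)\<^sup>2 \<le> 5 * \<rho>\<^sup>2"
    proof -
      have "norm w \<le> norm u + \<rho>"
        unfolding w_def using \<rho> by (intro order.trans[OF norm_triangle_ineq]) (simp add: norm_sgn)
      then have "norm w + m \<le> 2 * \<rho>" by (simp add: \<rho>_def)
      then have "(norm w + m)\<^sup>2 \<le> (2 * \<rho>)\<^sup>2" using m by (intro power_mono) auto
      moreover have "1 \<le> \<rho>\<^sup>2" using \<rho> by simp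
      ultimately show ?thesis by (simp add: power_mult_distrib)
    qed
    moreover have "1 + (norm u + m)\<^sup>2 \<le> 5 * \<rho>\<^sup>2"
    proof -
      have "(norm u + m)\<^sup>2 \<le> \<rho>\<^sup>2" using m by (intro power_mono) (auto simp: \<rho>_def)
      moreover have "1 \<le> \<rho>\<^sup>2" using \<rho> by simp
      ultimately show ?thesis by simp
    qed
    ultimately show ?thesis
      using growth[of w] growth[of u] A by (meson add_mono order.trans mult_left_mono)
  qed
  also have "\<dots> = \<rho> * (10 * A * \<rho>)" by (simp add: power2_eq_square)
  finally have "norm p \<le> 10 * A * \<rho>" using \<rho> by simp
  then show ?thesis using p that by (auto simp: \<rho>_def)
qed

section \<open>Regularity of convex-concave functions of quadratic growth\<close>

context orth_decomp
begin

lemma convex_concave_swap: "convex_concave V W f \<Longrightarrow> convex_concave W V (\<lambda>x. - f x)"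
  by (auto simp: convex_concave_def concave_on_def add.commute)

lemma convex_on_V_shift:
  assumes "convex_concave V W f"
  shows "convex_on UNIV (\<lambda>v. f (P v + Q w))"
proof -
  have "convex_on V (\<lambda>v. f (v + Q w))"
    using assms proj_in by (auto simp: convex_concave_def)
  then show ?thesis
    using proj_in by (auto simp: convex_on_def proj_linear_simps)
qed

lemma growth_shift:
  assumes "\<forall>v. \<bar>f v\<bar> \<le> C * (1 + (norm v)\<^sup>2)" "C \<ge> 0"
  shows "\<bar>f (P v + Q w)\<bar> \<le> C * (1 + (norm v + norm w)\<^sup>2)"
proof -
  have "norm (P v + Q w) \<le> norm v + norm w"
    by (intro order.trans[OF norm_triangle_ineq] add_mono norm_P_le norm_Q_le)
  then have "(norm (P v + Q w))\<^sup>2 \<le> (norm v + norm w)\<^sup>2" by (intro power_mono) auto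
  then show ?thesis
    using assms by (meson add_left_mono mult_left_mono order.trans)
qed

lemma convex_concave_subgradient:
  assumes cc: "convex_concave V W f" and C: "C \<ge> 0" "\<forall>v. \<bar>f v\<bar> \<le> C * (1 + (norm v)\<^sup>2)"
  obtains p where "norm p \<le> 20 * C * (1 + norm u)" "\<And>v. f u + p \<bullet> (P v - P u) \<le> f (P v + Q u)"
proof -
  obtain p where p: "norm p \<le> 10 * C * (1 + norm u + norm u)"
    "\<And>v. f (P u + Q u) + p \<bullet> (v - u) \<le> f (P v + Q u)"
    using convex_subgradient_bound[OF convex_on_V_shift[OF cc] C(1) norm_ge_zero growth_shift[OF C(2,1)]]
    by metis
  have "f u + p \<bullet> (P v - P u) \<le> f (P v + Q u)" for v
    using p(2)[of "P v + Q u"] proj_sum[of u]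
    by (simp add: proj_linear_simps) (metis add_diff_cancel_right)
  moreover have "10 * C * (1 + norm u + norm u) \<le> 20 * C * (1 + norm u)"
    using C by (simp add: algebra_simps)
  ultimately show ?thesis using p(1) by (intro that[of p]) auto
qed

lemma convex_concave_diff_V:
  assumes cc: "convex_concave V W f" and C: "C \<ge> 0" "\<forall>v. \<bar>f v\<bar> \<le> C * (1 + (norm v)\<^sup>2)"
  shows "f u - f (P v + Q u) \<le> 20 * C * (1 + norm u) * norm (u - v)"
proof -
  obtain p where p: "norm p \<le> 20 * C * (1 + norm u)" "\<And>v. f u + p \<bullet> (P v - P u) \<le> f (P v + Q u)"
    using convex_concave_subgradient[OF assms] by blast
  have "f u - f (P v + Q u) \<le> - (p \<bullet> P (v - u))" using p(2)[of v] by (simp add: proj_linear_simps)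
  also have "\<dots> \<le> norm p * norm (P (v - u))" by (metis abs_le_iff Cauchy_Schwarz_ineq2)
  also have "\<dots> \<le> 20 * C * (1 + norm u) * norm (v - u)"
    using p(1) norm_P_le[of "v - u"] C(1) by (intro mult_mono) auto
  finally show ?thesis by (simp add: norm_minus_commute)
qed

text \<open>The concave direction is the convex direction of \<open>- f\<close> with the two subspaces exchanged, so the
  path from \<open>u\<close> to \<open>v\<close> through \<open>P v + Q u\<close> is controlled by two subgradient bounds.\<close>

lemma convex_concave_local_Lipschitz:
  assumes cc: "convex_concave V W f" and C: "C \<ge> 0" "\<forall>v. \<bar>f v\<bar> \<le> C * (1 + (norm v)\<^sup>2)"
  shows "\<bar>f u - f v\<bar> \<le> 40 * C * (1 + norm u + norm v) * norm (u - v)"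
proof -
  have *: "f u - f v \<le> 40 * C * (1 + norm u + norm v) * norm (u - v)" for u v
  proof -
    have 1: "f u - f (P v + Q u) \<le> 20 * C * (1 + norm u) * norm (u - v)"
      by (rule convex_concave_diff_V[OF assms])
    interpret s: orth_decomp W V by (rule swap)
    have "- f v - - f (Q u + P v) \<le> 20 * C * (1 + norm v) * norm (v - u)"
      using C by (intro s.convex_concave_diff_V convex_concave_swap cc) auto
    then have 2: "f (P v + Q u) - f v \<le> 20 * C * (1 + norm v) * norm (u - v)"
      by (simp add: norm_minus_commute add.commute)
    have "f u - f v \<le> (20 * C * (1 + norm u) + 20 * C * (1 + norm v)) * norm (u - v)"
      using 1 2 by (simp add: algebra_simps)
    also have "\<dots> \<le> 40 * C * (1 + norm u + norm v) * norm (u - v)"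
      using C by (intro mult_right_mono) (auto simp: algebra_simps)
    finally show ?thesis .
  qed
  from *[of u v] *[of v u] show ?thesis by (simp add: norm_minus_commute add.commute add.left_commute abs_le_iff)
qed

lemma convex_concave_continuous:
  assumes cc: "convex_concave V W f" and qg: "quadratic_growth f"
  shows "continuous_on UNIV f"
proof -
  obtain C where C: "C \<ge> 0" "\<forall>v. \<bar>f v\<bar> \<le> C * (1 + (norm v)\<^sup>2)"
    using qg by (auto simp: quadratic_growth_def)
  have "isCont f u" for u
  proof -
    have "((\<lambda>v. 40 * C * (1 + norm u + norm v) * norm (u - v)) \<longlongrightarrow> 40 * C * (1 + norm u + norm u) * norm (u - u)) (at u)"
      by (intro tendsto_intros)
    then have "((\<lambda>v. 40 * C * (1 + norm u + norm v) * norm (u - v)) \<longlongrightarrow> 0) (at u)" by simp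
    moreover have "\<forall>\<^sub>F v in at u. norm (f v - f u) \<le> 40 * C * (1 + norm u + norm v) * norm (u - v)"
      using convex_concave_local_Lipschitz[OF cc C, of u] by (auto simp: abs_minus_commute)
    ultimately have "((\<lambda>v. f v - f u) \<longlongrightarrow> 0) (at u)" by (rule Lim_null_comparison[rotated])
    then show ?thesis by (simp add: isCont_def LIM_zero_iff)
  qed
  then show ?thesis by (simp add: continuous_at_imp_continuous_on)
qed

end

section \<open>Martingale conditions and Jensen's inequality\<close>

lemma (in prob_space) integrable_quadratic_growth:
  fixes F :: "'a \<Rightarrow> 'b::{banach, second_countable_topology}"
  assumes "F \<in> borel_measurable M" "integrable M A"
    and "\<And>\<omega>. \<omega> \<in> space M \<Longrightarrow> norm (F \<omega>) \<le> C * (1 + A \<omega>)"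
  shows "integrable M F"
proof (rule Bochner_Integration.integrable_bound)
  show "integrable M (\<lambda>\<omega>. C * (1 + A \<omega>))" using assms(2) by simp
  show "AE \<omega> in M. norm (F \<omega>) \<le> norm (C * (1 + A \<omega>))"
    using assms(3) by (intro AE_I2) (metis abs_ge_self order.trans real_norm_def)
qed fact

lemma (in prob_space) integrable_of_square:
  fixes X :: "'a \<Rightarrow> 'b::{banach, second_countable_topology}"
  assumes "X \<in> borel_measurable M" "integrable M (\<lambda>\<omega>. (norm (X \<omega>))\<^sup>2)"
  shows "integrable M X"
proof (rule integrable_quadratic_growth[OF assms])
  fix \<omega>
  show "norm (X \<omega>) \<le> 1 * (1 + (norm (X \<omega>))\<^sup>2)"
    using sum_squares_ge_zero[of "norm (X \<omega>) - 1" 0] sum_power2_ge_zero[of "norm (X \<omega>) - 1" 0]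
    by (simp add: power2_eq_square algebra_simps) (smt (verit) norm_ge_zero mult_nonneg_nonneg)
qed

text \<open>A martingale increment \<open>U\<close>, tested only against bounded functions of \<open>X\<close>, is orthogonal to every
  vector field \<open>G\<close> of \<open>X\<close> for which the product is integrable.\<close>

lemma martingale_increment_orthogonal:
  fixes X :: "'w \<Rightarrow> 'a::euclidean_space" and U :: "'w \<Rightarrow> 'b::euclidean_space"
  assumes [measurable]: "X \<in> borel_measurable M" "G \<in> borel_measurable borel"
    and U: "integrable M U"
    and mart: "\<And>g. bounded_borel g \<Longrightarrow> (\<integral>\<omega>. g (X \<omega>) *\<^sub>R U \<omega> \<partial>M) = 0"
    and int: "integrable M (\<lambda>\<omega>. norm (G (X \<omega>)) * norm (U \<omega>))"
  shows "(\<integral>\<omega>. G (X \<omega>) \<bullet> U \<omega> \<partial>M) = 0"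
proof -
  have [measurable]: "U \<in> borel_measurable M" using U by auto
  define Gk where "Gk k x = (if norm (G x) \<le> real k then G x else 0)" for k x
  have [measurable]: "Gk k \<in> borel_measurable borel" for k unfolding Gk_def by measurable
  have bb: "bounded_borel (\<lambda>x. Gk k x \<bullet> b)" if "b \<in> Basis" for k b
  proof -
    have "norm (Gk k x \<bullet> b) \<le> real k" for x
      using Basis_le_norm[OF that, of "Gk k x"] by (auto simp: Gk_def)
    then have "bounded (range (\<lambda>x. Gk k x \<bullet> b))" by (intro boundedI) auto
    then show ?thesis by (simp add: bounded_borel_def)
  qed
  have int_b: "integrable M (\<lambda>\<omega>. (Gk k (X \<omega>) \<bullet> b) *\<^sub>R U \<omega>)" if "b \<in> Basis" for k b
  proof (rule Bochner_Integration.integrable_bound)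
    show "integrable M (\<lambda>\<omega>. real k * norm (U \<omega>))" using U by auto
    show "AE \<omega> in M. norm ((Gk k (X \<omega>) \<bullet> b) *\<^sub>R U \<omega>) \<le> norm (real k * norm (U \<omega>))"
    proof (rule AE_I2)
      fix \<omega>
      have "\<bar>Gk k (X \<omega>) \<bullet> b\<bar> \<le> real k"
        using Basis_le_norm[OF that, of "Gk k (X \<omega>)"] by (auto simp: Gk_def)
      then show "norm ((Gk k (X \<omega>) \<bullet> b) *\<^sub>R U \<omega>) \<le> norm (real k * norm (U \<omega>))"
        by (simp add: mult_right_mono)
    qed
  qed auto
  have zero: "(\<integral>\<omega>. Gk k (X \<omega>) \<bullet> U \<omega> \<partial>M) = 0" for k
  proof -
    have "(\<integral>\<omega>. Gk k (X \<omega>) \<bullet> U \<omega> \<partial>M) = (\<integral>\<omega>. (\<Sum>b\<in>Basis. ((Gk k (X \<omega>) \<bullet> b) *\<^sub>R U \<omega>) \<bullet> b) \<partial>M)"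
      by (subst euclidean_inner) simp
    also have "\<dots> = (\<Sum>b\<in>Basis. (\<integral>\<omega>. ((Gk k (X \<omega>) \<bullet> b) *\<^sub>R U \<omega>) \<bullet> b \<partial>M))"
      using int_b by (intro Bochner_Integration.integral_sum integrable_inner_left) auto
    also have "\<dots> = (\<Sum>b\<in>Basis. (\<integral>\<omega>. (Gk k (X \<omega>) \<bullet> b) *\<^sub>R U \<omega> \<partial>M) \<bullet> b)"
      using int_b by (intro sum.cong refl integral_inner_left) auto
    also have "\<dots> = 0" using mart[OF bb] by simp
    finally show ?thesis .
  qed
  have "(\<lambda>k. \<integral>\<omega>. Gk k (X \<omega>) \<bullet> U \<omega> \<partial>M) \<longlonglongrightarrow> (\<integral>\<omega>. G (X \<omega>) \<bullet> U \<omega> \<partial>M)"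
  proof (rule integral_dominated_convergence[OF _ _ int])
    show "AE \<omega> in M. (\<lambda>k. Gk k (X \<omega>) \<bullet> U \<omega>) \<longlonglongrightarrow> G (X \<omega>) \<bullet> U \<omega>"
    proof (rule AE_I2)
      fix \<omega>
      obtain n where "norm (G (X \<omega>)) \<le> real n" using real_arch_simple by blast
      then have "\<forall>\<^sub>F k in sequentially. Gk k (X \<omega>) \<bullet> U \<omega> = G (X \<omega>) \<bullet> U \<omega>"
        unfolding eventually_sequentially Gk_def by (intro exI[of _ n]) auto
      then show "(\<lambda>k. Gk k (X \<omega>) \<bullet> U \<omega>) \<longlonglongrightarrow> G (X \<omega>) \<bullet> U \<omega>" by (rule tendsto_eventually)
    qed
    show "AE \<omega> in M. norm (Gk k (X \<omega>) \<bullet> U \<omega>) \<le> norm (G (X \<omega>)) * norm (U \<omega>)" for k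
      by (intro AE_I2) (auto simp: Gk_def Cauchy_Schwarz_ineq2)
  qed auto
  then show ?thesis by (simp add: zero LIMSEQ_const_iff)
qed

text \<open>A Borel map that moves points by at most \<open>\<delta>\<close> and factors through the natural numbers, so that
  composing it with any function whatsoever is again Borel.\<close>

lemma borel_discretization:
  fixes \<delta> :: real
  assumes "\<delta> > 0"
  obtains n :: "'a::euclidean_space \<Rightarrow> nat" and D :: "nat \<Rightarrow> 'a"
  where "n \<in> measurable borel (count_space UNIV)" "\<And>x. norm (D (n x) - x) \<le> \<delta>"
proof -
  obtain S :: "'a set" where S: "countable S" "\<And>X. open X \<Longrightarrow> X \<noteq> {} \<Longrightarrow> \<exists>d\<in>S. d \<in> X"
    using countable_dense_exists by blast
  define D where "D = from_nat_into S"
  define n where "n x = (LEAST k. dist (D k) x < \<delta>)" for x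
  have ex: "\<exists>k. dist (D k) x < \<delta>" for x
  proof -
    obtain d where "d \<in> S" "d \<in> ball x \<delta>" using S(2)[of "ball x \<delta>"] assms by auto
    moreover obtain k where "d = D k"
      using from_nat_into_surj[OF S(1) \<open>d \<in> S\<close>] by (auto simp: D_def)
    ultimately show ?thesis by (auto simp: dist_commute)
  qed
  have "n \<in> measurable borel (count_space UNIV)" unfolding n_def by measurable
  moreover have "norm (D (n x) - x) \<le> \<delta>" for x
    using LeastI_ex[OF ex[of x]] by (simp add: n_def dist_norm)
  ultimately show ?thesis using that by blast
qed

text \<open>Conditional Jensen inequality along \<open>V\<close>. In place of a measurable selection of subgradients, a
  subgradient is chosen at each of countably many points, and \<open>X\<close> is moved to a nearby one of them;
  the local Lipschitz bound makes the error of order \<open>\<delta>\<close>.\<close>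

lemma (in orth_decomp) convex_concave_Jensen:
  fixes X Y :: "'w \<Rightarrow> 'a" and f :: "'a \<Rightarrow> real"
  assumes "prob_space M"
    and [measurable]: "X \<in> borel_measurable M" "Y \<in> borel_measurable M"
    and X2: "integrable M (\<lambda>\<omega>. (norm (X \<omega>))\<^sup>2)" and Y2: "integrable M (\<lambda>\<omega>. (norm (Y \<omega>))\<^sup>2)"
    and mart: "\<And>g. bounded_borel g \<Longrightarrow> (\<integral>\<omega>. g (X \<omega>) *\<^sub>R (P (Y \<omega>) - P (X \<omega>)) \<partial>M) = 0"
    and cc: "convex_concave V W f" and qg: "quadratic_growth f"
  shows "(\<integral>\<omega>. f (X \<omega>) \<partial>M) \<le> (\<integral>\<omega>. f (P (Y \<omega>) + Q (X \<omega>)) \<partial>M)"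
proof -
  interpret prob_space M by fact
  obtain C where C: "C \<ge> 0" "\<forall>v. \<bar>f v\<bar> \<le> C * (1 + (norm v)\<^sup>2)"
    using qg by (auto simp: quadratic_growth_def)
  have [measurable]: "f \<in> borel_measurable borel"
    by (intro borel_measurable_continuous_onI convex_concave_continuous cc qg)
  have XY2: "integrable M (\<lambda>\<omega>. (norm (X \<omega>))\<^sup>2 + (norm (Y \<omega>))\<^sup>2)" using X2 Y2 by simp
  have Xi: "integrable M X" and Yi: "integrable M Y"
    by (simp_all add: integrable_of_square X2 Y2)
  then have X1: "integrable M (\<lambda>\<omega>. norm (X \<omega>))" and Y1: "integrable M (\<lambda>\<omega>. norm (Y \<omega>))" by auto
  have fX: "integrable M (\<lambda>\<omega>. f (X \<omega>))"
    using C by (intro integrable_quadratic_growth[OF _ X2]) auto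
  have fZ: "integrable M (\<lambda>\<omega>. f (P (Y \<omega>) + Q (X \<omega>)))"
  proof (rule integrable_quadratic_growth[OF _ XY2])
    fix \<omega>
    have "(norm (P (Y \<omega>) + Q (X \<omega>)))\<^sup>2 = (norm (P (Y \<omega>)))\<^sup>2 + (norm (Q (X \<omega>)))\<^sup>2"
      by (subst norm_sq_decomp) (simp add: proj_linear_simps)
    also have "\<dots> \<le> (norm (Y \<omega>))\<^sup>2 + (norm (X \<omega>))\<^sup>2"
      by (intro add_mono power_mono norm_P_le norm_Q_le norm_ge_zero)
    finally have "C * (1 + (norm (P (Y \<omega>) + Q (X \<omega>)))\<^sup>2) \<le> C * (1 + ((norm (X \<omega>))\<^sup>2 + (norm (Y \<omega>))\<^sup>2))"
      using C(1) by (intro mult_left_mono) auto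
    then show "norm (f (P (Y \<omega>) + Q (X \<omega>))) \<le> C * (1 + ((norm (X \<omega>))\<^sup>2 + (norm (Y \<omega>))\<^sup>2))"
      using C(2)[rule_format, of "P (Y \<omega>) + Q (X \<omega>)"] by simp
  qed measurable
  have U: "integrable M (\<lambda>\<omega>. P (Y \<omega>) - P (X \<omega>))"
    by (rule Bochner_Integration.integrable_diff[OF
        integrable_bounded_linear[OF bounded_linear_P Yi] integrable_bounded_linear[OF bounded_linear_P Xi]])
  define K where "K = 200 * C * (\<integral>\<omega>. 1 + norm (X \<omega>) + norm (Y \<omega>) \<partial>M)"
  have "K \<ge> 0" unfolding K_def using C by (auto intro!: mult_nonneg_nonneg Bochner_Integration.integral_nonneg)
  have approx: "(\<integral>\<omega>. f (X \<omega>) \<partial>M) - (\<integral>\<omega>. f (P (Y \<omega>) + Q (X \<omega>)) \<partial>M) \<le> \<delta> * K"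
    if \<delta>: "0 < \<delta>" "\<delta> \<le> 1" for \<delta>
  proof -
    obtain n :: "'a \<Rightarrow> nat" and D where [measurable]: "n \<in> measurable borel (count_space UNIV)"
      and D: "\<And>x. norm (D (n x) - x) \<le> \<delta>" using borel_discretization[OF \<delta>(1)] by blast
    obtain p where p: "\<And>c. norm (p c) \<le> 20 * C * (1 + norm c)"
      "\<And>c v. f c + p c \<bullet> (P v - P c) \<le> f (P v + Q c)"
    proof -
      have "\<forall>c. \<exists>p. norm p \<le> 20 * C * (1 + norm c) \<and> (\<forall>v. f c + p \<bullet> (P v - P c) \<le> f (P v + Q c))"
        using convex_concave_subgradient[OF cc C] by blast
      from choice[OF this] show ?thesis using that by blast
    qed
    define G where "G x = p (D (n x))" for x
    have [measurable]: "G \<in> borel_measurable borel"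
      unfolding G_def by (rule measurable_compose[of n _ "count_space UNIV" "\<lambda>k. p (D k)"]) auto
    have near: "norm (D (n x)) \<le> 1 + norm x" for x
      using D[of x] \<delta>(2) norm_triangle_sub[of "D (n x)" x] by linarith
    have Gb: "norm (G x) \<le> 20 * C * (2 + norm x)" for x
    proof -
      have "20 * C * (1 + norm (D (n x))) \<le> 20 * C * (2 + norm x)"
        using near[of x] C by (intro mult_left_mono) auto
      then show ?thesis using p(1)[of "D (n x)"] by (simp add: G_def)
    qed
    have GU: "integrable M (\<lambda>\<omega>. norm (G (X \<omega>)) * norm (P (Y \<omega>) - P (X \<omega>)))"
    proof (rule integrable_quadratic_growth[OF _ XY2])
      fix \<omega>
      let ?x = "norm (X \<omega>)" and ?y = "norm (Y \<omega>)"
      have "norm (P (Y \<omega>) - P (X \<omega>)) \<le> ?x + ?y"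
        using norm_triangle_ineq4[of "P (Y \<omega>)" "P (X \<omega>)"] norm_P_le[of "X \<omega>"] norm_P_le[of "Y \<omega>"] by linarith
      then have "norm (G (X \<omega>)) * norm (P (Y \<omega>) - P (X \<omega>)) \<le> (20 * C * (2 + ?x)) * (?x + ?y)"
        using Gb C by (intro mult_mono) auto
      also have "\<dots> = (20 * C) * ((2 + ?x) * (?x + ?y))" by simp
      also have "\<dots> \<le> (20 * C) * (4 * (1 + (?x\<^sup>2 + ?y\<^sup>2)))"
      proof (rule mult_left_mono)
        have "4 * (1 + (?x\<^sup>2 + ?y\<^sup>2)) - (2 + ?x) * (?x + ?y)
            = (?x - 1)\<^sup>2 + (?y - 1)\<^sup>2 + (?x - ?y)\<^sup>2 / 2 + 3 / 2 * ?x\<^sup>2 + 5 / 2 * ?y\<^sup>2 + 2"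
          by (simp add: power2_eq_square field_simps)
        also have "\<dots> \<ge> 0" by (intro add_nonneg_nonneg) auto
        finally show "(2 + ?x) * (?x + ?y) \<le> 4 * (1 + (?x\<^sup>2 + ?y\<^sup>2))" by simp
      qed (use C in simp)
      finally show "norm (norm (G (X \<omega>)) * norm (P (Y \<omega>) - P (X \<omega>))) \<le> (80 * C) * (1 + (?x\<^sup>2 + ?y\<^sup>2))"
        by (simp add: algebra_simps)
    qed measurable
    have zero: "(\<integral>\<omega>. G (X \<omega>) \<bullet> (P (Y \<omega>) - P (X \<omega>)) \<partial>M) = 0"
      by (rule martingale_increment_orthogonal[where X = X and G = G, OF _ _ U mart GU]) auto
    have intGU: "integrable M (\<lambda>\<omega>. G (X \<omega>) \<bullet> (P (Y \<omega>) - P (X \<omega>)))"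
      by (rule Bochner_Integration.integrable_bound[OF GU]) (auto simp: Cauchy_Schwarz_ineq2)
    \<comment> \<open>Pointwise subgradient inequality; the three errors come from replacing \<open>X\<close> by the chosen point \<open>c\<close>
      in \<open>f (P Y + Q X)\<close>, in \<open>f X\<close> and in the increment \<open>P Y - P X\<close>.\<close>
    have pw: "f (X \<omega>) + G (X \<omega>) \<bullet> (P (Y \<omega>) - P (X \<omega>)) - \<delta> * (200 * C * (1 + norm (X \<omega>) + norm (Y \<omega>)))
        \<le> f (P (Y \<omega>) + Q (X \<omega>))" for \<omega>
    proof -
      define x y c where "x = X \<omega>" and "y = Y \<omega>" and "c = D (n x)"
      have cx: "norm (c - x) \<le> \<delta>" "norm c \<le> 1 + norm x" using D near by (auto simp: c_def)
      have "f (P y + Q c) - f (P y + Q x)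
          \<le> 40 * C * (1 + norm (P y + Q c) + norm (P y + Q x)) * norm ((P y + Q c) - (P y + Q x))"
        using convex_concave_local_Lipschitz[OF cc C] by (meson abs_le_D1)
      also have "\<dots> \<le> 40 * C * (2 + 2 * norm x + 2 * norm y) * \<delta>"
      proof (intro mult_mono)
        show "norm ((P y + Q c) - (P y + Q x)) \<le> \<delta>"
          using norm_Q_le[of "c - x"] cx by (simp add: proj_linear_simps)
        show "1 + norm (P y + Q c) + norm (P y + Q x) \<le> 2 + 2 * norm x + 2 * norm y"
          using norm_triangle_ineq[of "P y" "Q c"] norm_triangle_ineq[of "P y" "Q x"] cx
            norm_P_le[of y] norm_Q_le[of c] norm_Q_le[of x] by linarith
      qed (use C in auto)
      finally have 1: "f (P y + Q c) - f (P y + Q x) \<le> 40 * C * (2 + 2 * norm x + 2 * norm y) * \<delta>" .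
      have "f x - f c \<le> 40 * C * (1 + norm x + norm c) * norm (x - c)"
        using convex_concave_local_Lipschitz[OF cc C] by (meson abs_le_D1)
      also have "\<dots> \<le> 40 * C * (2 + 2 * norm x) * \<delta>"
        using C cx by (intro mult_mono) (auto simp: norm_minus_commute)
      finally have 2: "f x - f c \<le> 40 * C * (2 + 2 * norm x) * \<delta>" .
      have "p c \<bullet> P (c - x) \<le> norm (p c) * norm (P (c - x))" by (rule norm_cauchy_schwarz)
      also have "\<dots> \<le> (20 * C * (2 + norm x)) * \<delta>"
        using Gb[of x] norm_P_le[of "c - x"] cx C by (intro mult_mono) (auto simp: G_def c_def)
      finally have 3: "p c \<bullet> (P c - P x) \<le> 20 * C * (2 + norm x) * \<delta>" by (simp add: proj_linear_simps)
      have 4: "f c + p c \<bullet> (P y - P x) - p c \<bullet> (P c - P x) \<le> f (P y + Q c)"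
        using p(2)[of c y] by (simp add: inner_diff_right)
      have "40 * C * (2 + 2 * norm x + 2 * norm y) * \<delta> + 40 * C * (2 + 2 * norm x) * \<delta> + 20 * C * (2 + norm x) * \<delta>
          \<le> \<delta> * (200 * C * (1 + norm x + norm y))"
        using C \<delta> by (simp add: algebra_simps)
      then have "f x + p c \<bullet> (P y - P x) - \<delta> * (200 * C * (1 + norm x + norm y)) \<le> f (P y + Q x)"
        using 1 2 3 4 by linarith
      then show ?thesis by (simp add: x_def y_def c_def G_def)
    qed
    have "(\<integral>\<omega>. f (X \<omega>) + G (X \<omega>) \<bullet> (P (Y \<omega>) - P (X \<omega>)) - \<delta> * (200 * C * (1 + norm (X \<omega>) + norm (Y \<omega>))) \<partial>M)
        \<le> (\<integral>\<omega>. f (P (Y \<omega>) + Q (X \<omega>)) \<partial>M)"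
      using fX fZ intGU X1 Y1 by (intro integral_mono pw) auto
    moreover have "(\<integral>\<omega>. f (X \<omega>) + G (X \<omega>) \<bullet> (P (Y \<omega>) - P (X \<omega>)) - \<delta> * (200 * C * (1 + norm (X \<omega>) + norm (Y \<omega>))) \<partial>M)
      = (\<integral>\<omega>. f (X \<omega>) \<partial>M) - \<delta> * K"
      using fX intGU X1 Y1 zero by (simp add: K_def)
    ultimately show ?thesis by linarith
  qed
  show ?thesis
  proof (rule field_le_epsilon)
    fix e :: real assume e: "e > 0"
    define \<delta> where "\<delta> = min 1 (e / (K + 1))"
    have "\<delta> * K \<le> e / (K + 1) * K" using \<open>K \<ge> 0\<close> by (intro mult_right_mono) (auto simp: \<delta>_def)
    also have "\<dots> \<le> e" using e \<open>K \<ge> 0\<close> by (simp add: field_simps)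
    finally have "\<delta> * K \<le> e" .
    moreover have "0 < \<delta>" "\<delta> \<le> 1" using e \<open>K \<ge> 0\<close> by (auto simp: \<delta>_def)
    ultimately show "(\<integral>\<omega>. f (X \<omega>) \<partial>M) \<le> (\<integral>\<omega>. f (P (Y \<omega>) + Q (X \<omega>)) \<partial>M) + e"
      using approx[of \<delta>] by linarith
  qed
qed

section \<open>A continuous curve through Euclidean space\<close>

lemma binary_expansion:
  fixes x :: real
  assumes x: "0 \<le> x" "x < 1"
  obtains b :: "nat \<Rightarrow> real" where "\<And>k. b k \<in> {0, 1}" "(\<lambda>k. b k / 2 ^ Suc k) sums x"
proof -
  \<comment> \<open>The digits are differences of the dyadic floors, so that the partial sums telescope.\<close>
  define f where "f n = \<lfloor>2 ^ n * x\<rfloor>" for n :: nat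
  define b where "b k = real_of_int (f (Suc k) - 2 * f k)" for k
  have b01: "b k \<in> {0, 1}" for k
  proof -
    have "of_int (f k) \<le> 2 ^ k * x" "2 ^ k * x < of_int (f k) + 1"
      "of_int (f (Suc k)) \<le> 2 * (2 ^ k * x)" "2 * (2 ^ k * x) < of_int (f (Suc k)) + 1"
      unfolding f_def by (simp_all add: floor_correct mult.assoc)
    then have "f (Suc k) - 2 * f k < 2" "f (Suc k) - 2 * f k > - 1" by linarith+
    then have "f (Suc k) - 2 * f k = 0 \<or> f (Suc k) - 2 * f k = 1" by linarith
    then show ?thesis by (auto simp: b_def)
  qed
  have part: "(\<Sum>k<n. b k / 2 ^ Suc k) = of_int (f n) / 2 ^ n" for n
  proof (induction n)
    case 0
    then show ?case using x by (simp add: f_def floor_eq_iff)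
  next
    case (Suc n)
    then show ?case by (simp add: b_def field_simps)
  qed
  have "(\<lambda>n. of_int (f n) / 2 ^ n) \<longlonglongrightarrow> x"
  proof (rule LIM_zero_cancel, rule Lim_null_comparison)
    have "\<bar>of_int (f n) / 2 ^ n - x\<bar> \<le> (1 / 2) ^ n" for n
    proof -
      have "of_int (f n) \<le> 2 ^ n * x" "2 ^ n * x < of_int (f n) + 1"
        unfolding f_def by (simp_all add: floor_correct)
      then have "\<bar>of_int (f n) - 2 ^ n * x\<bar> \<le> 1" by linarith
      then have "\<bar>of_int (f n) - 2 ^ n * x\<bar> / 2 ^ n \<le> 1 / 2 ^ n" by (simp add: divide_right_mono)
      moreover have "of_int (f n) / 2 ^ n - x = (of_int (f n) - 2 ^ n * x) / 2 ^ n"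
        by (simp add: field_simps)
      ultimately show ?thesis by (simp add: power_one_over)
    qed
    then show "\<forall>\<^sub>F n in sequentially. norm (of_int (f n) / 2 ^ n - x) \<le> (1 / 2) ^ n" by simp
    show "(\<lambda>n. (1 / 2) ^ n :: real) \<longlonglongrightarrow> 0" by (rule LIMSEQ_realpow_zero) auto
  qed
  then have "(\<lambda>k. b k / 2 ^ Suc k) sums x" unfolding sums_def part .
  then show ?thesis using that b01 by blast
qed

text \<open>Distance to the nearest even integer. On \<open>[0, 1]\<close> it is the identity.\<close>

definition even_dist :: "real \<Rightarrow> real" where
  "even_dist t = arccos (cos (pi * t)) / pi"

lemma continuous_even_dist: "continuous_on S even_dist"
  unfolding even_dist_def by (intro continuous_intros) auto

lemma even_dist_periodic: "even_dist (t + 2 * of_int m) = even_dist t"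
proof -
  have "cos (pi * (t + 2 * of_int m)) = cos (pi * t + 2 * pi * of_int m)" by (simp add: algebra_simps)
  also have "\<dots> = cos (pi * t)"
    using cos_int_2pin[of m] sin_int_2pin[of m] by (simp add: cos_add)
  finally show ?thesis by (simp add: even_dist_def)
qed

lemma even_dist_eq: "0 \<le> t \<Longrightarrow> t \<le> 1 \<Longrightarrow> even_dist t = t"
  unfolding even_dist_def by (subst arccos_cos) auto

text \<open>The 2-periodic function of Schoenberg's curve: it vanishes on \<open>[0, 1/3]\<close> and equals 1 on \<open>[2/3, 1]\<close>,
  and thus tells the leading ternary digits 0 and 2 of a point of the Cantor set apart.\<close>

definition schoenberg_hat :: "real \<Rightarrow> real" where
  "schoenberg_hat t = max 0 (min 1 (3 * even_dist t - 1))"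

lemma continuous_schoenberg_hat: "continuous_on S schoenberg_hat"
  unfolding schoenberg_hat_def by (intro continuous_intros continuous_even_dist)

lemma schoenberg_hat_bounds: "0 \<le> schoenberg_hat t" "schoenberg_hat t \<le> 1"
  by (auto simp: schoenberg_hat_def)

lemma schoenberg_hat_periodic: "schoenberg_hat (t + 2 * of_int m) = schoenberg_hat t"
  by (simp add: schoenberg_hat_def even_dist_periodic)

text \<open>The point of the Cantor set with ternary digits \<open>2 * a l\<close>, where every \<open>a l\<close> is 0 or 1.\<close>

definition cantor_point :: "(nat \<Rightarrow> real) \<Rightarrow> real" where
  "cantor_point a = (\<Sum>l. 2 * a l / 3 ^ Suc l)"

lemma cantor_point:
  assumes a: "\<And>l. a l \<in> {0, 1 :: real}"
  shows "0 \<le> cantor_point a" "cantor_point a \<le> 1"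
    "3 * cantor_point a = 2 * a 0 + cantor_point (\<lambda>l. a (Suc l))"
proof -
  have geo: "(\<lambda>l. 2 / 3 ^ Suc l :: real) sums 1"
    using sums_mult[OF geometric_sums[of "1 / 3 :: real"], of "2 / 3"] by (simp add: power_one_over field_simps)
  have b: "0 \<le> 2 * a l / 3 ^ Suc l" "2 * a l / 3 ^ Suc l \<le> 2 / 3 ^ Suc l" for l
    using a[of l] by auto
  have s: "summable (\<lambda>l. 2 * a l / 3 ^ Suc l)"
  proof (rule summable_comparison_test'[OF sums_summable[OF geo]])
    show "norm (2 * a l / 3 ^ Suc l) \<le> 2 / 3 ^ Suc l" for l
      using b[of l] by (simp only: real_norm_def abs_of_nonneg)
  qed
  show "0 \<le> cantor_point a" unfolding cantor_point_def by (intro suminf_nonneg s b)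
  show "cantor_point a \<le> 1"
    using suminf_le[OF b(2) s sums_summable[OF geo]] sums_unique[OF geo] by (simp add: cantor_point_def)
  have s': "summable (\<lambda>l. 2 * a (Suc l) / 3 ^ Suc (Suc l))"
    using s summable_Suc_iff[of "\<lambda>l. 2 * a l / 3 ^ Suc l"] by simp
  have "cantor_point a = 2 * a 0 / 3 + (\<Sum>l. 2 * a (Suc l) / 3 ^ Suc (Suc l))"
    using suminf_split_head[OF s] by (simp add: cantor_point_def)
  also have "(\<Sum>l. 2 * a (Suc l) / 3 ^ Suc (Suc l)) = cantor_point (\<lambda>l. a (Suc l)) / 3"
  proof -
    have "(\<lambda>l. 2 * a (Suc l) / 3 ^ Suc l) = (\<lambda>l. 3 * (2 * a (Suc l) / 3 ^ Suc (Suc l)))" by auto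
    then have "cantor_point (\<lambda>l. a (Suc l)) = 3 * (\<Sum>l. 2 * a (Suc l) / 3 ^ Suc (Suc l))"
      unfolding cantor_point_def using suminf_mult[OF s', of 3] by simp
    then show ?thesis by simp
  qed
  finally show "3 * cantor_point a = 2 * a 0 + cantor_point (\<lambda>l. a (Suc l))" by simp
qed

lemma cantor_point_power:
  assumes a: "\<And>l. a l \<in> {0, 1 :: real}"
  shows "\<exists>m :: int. 3 ^ j * cantor_point a = 2 * of_int m + cantor_point (\<lambda>l. a (j + l))"
proof (induction j)
  case 0
  show ?case by (intro exI[of _ 0]) simp
next
  case (Suc j)
  then obtain m :: int where m: "3 ^ j * cantor_point a = 2 * of_int m + cantor_point (\<lambda>l. a (j + l))" by blast
  obtain i :: int where i: "a j = of_int i" using a[of j] by (metis insertE of_int_0 of_int_1 singletonD)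
  have "3 * cantor_point (\<lambda>l. a (j + l)) = 2 * a j + cantor_point (\<lambda>l. a (Suc j + l))"
    using cantor_point(3)[of "\<lambda>l. a (j + l)"] a by simp
  then have "3 ^ Suc j * cantor_point a = 2 * of_int (3 * m + i) + cantor_point (\<lambda>l. a (Suc j + l))"
    using m i by simp
  then show ?case by blast
qed

lemma schoenberg_hat_cantor_point:
  assumes a: "\<And>l. a l \<in> {0, 1 :: real}"
  shows "schoenberg_hat (3 ^ j * cantor_point a) = a j"
proof -
  obtain m :: int where m: "3 ^ j * cantor_point a = cantor_point (\<lambda>l. a (j + l)) + 2 * of_int m"
    using cantor_point_power[of a, OF a] by (metis add.commute)
  define u where "u = cantor_point (\<lambda>l. a (j + l))"
  have u: "0 \<le> u" "u \<le> 1" using cantor_point[of "\<lambda>l. a (j + l)"] a by (auto simp: u_def)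
  have "3 * u = 2 * a j + cantor_point (\<lambda>l. a (Suc j + l))"
    using cantor_point(3)[of "\<lambda>l. a (j + l)"] a by (simp add: u_def)
  moreover have "0 \<le> cantor_point (\<lambda>l. a (Suc j + l))" "cantor_point (\<lambda>l. a (Suc j + l)) \<le> 1"
    using cantor_point[of "\<lambda>l. a (Suc j + l)"] a by auto
  ultimately have "schoenberg_hat u = a j"
    using a[of j] u by (auto simp: schoenberg_hat_def even_dist_eq)
  then show ?thesis using m by (simp add: u_def schoenberg_hat_periodic)
qed

text \<open>Schoenberg's space-filling curve, with one coordinate for each basis vector and with an amplitude that
  grows along the curve, so that every ball is covered within a compact parameter interval.\<close>

lemma continuous_curve_covers_balls:
  obtains \<Gamma> :: "real \<Rightarrow> 'b::euclidean_space"
  where "continuous_on UNIV \<Gamma>" "\<And>R. \<exists>T\<ge>0. cball 0 R \<subseteq> \<Gamma> ` {0..T}"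
proof -
  define N where "N = DIM('b)"
  have N: "N > 0" by (simp add: N_def)
  obtain idx where "bij_betw idx (Basis :: 'b set) {0..<N}"
    using ex_bij_betw_finite_nat[of "Basis :: 'b set"] by (auto simp: N_def)
  then have idx: "inj_on idx (Basis :: 'b set)" "\<And>b. b \<in> (Basis :: 'b set) \<Longrightarrow> idx b < N"
    by (auto simp: bij_betw_def)
  define s where "s b t = (\<Sum>k. schoenberg_hat (3 ^ (N * k + idx b) * t) / 2 ^ Suc k)" for b :: 'b and t
  \<comment> \<open>A continuous amplitude with the constant value \<open>m\<close> on \<open>[2 * m, 2 * m + 1]\<close>.\<close>
  define A where "A t = (t - even_dist t) / 2" for t
  define \<Gamma> where "\<Gamma> t = (\<Sum>b\<in>Basis. (A t * (2 * s b t - 1)) *\<^sub>R b)" for t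
  have cont_s: "continuous_on UNIV (s b)" for b
  proof -
    have lim: "uniform_limit UNIV (\<lambda>n t. \<Sum>k<n. schoenberg_hat (3 ^ (N * k + idx b) * t) / 2 ^ Suc k) (s b) sequentially"
      unfolding s_def
    proof (rule Weierstrass_m_test)
      show "norm (schoenberg_hat (3 ^ (N * n + idx b) * t) / 2 ^ Suc n) \<le> (1 / 2) ^ Suc n" for n t
        using schoenberg_hat_bounds by (auto simp: power_one_over divide_simps)
      show "summable (\<lambda>n. (1 / 2) ^ Suc n :: real)"
        using summable_geometric[of "1 / 2 :: real"] by (simp add: summable_mult)
    qed
    have "continuous_on UNIV (\<lambda>t. schoenberg_hat (c * t))" for c
      by (rule continuous_on_compose2[OF continuous_schoenberg_hat[of UNIV]]) (auto intro: continuous_intros)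
    then show ?thesis
      by (intro uniform_limit_theorem[OF _ lim] always_eventually allI continuous_intros) auto
  qed
  have "continuous_on UNIV \<Gamma>"
    unfolding \<Gamma>_def A_def by (intro continuous_intros cont_s continuous_even_dist) auto
  moreover have "\<exists>T\<ge>0. cball 0 R \<subseteq> \<Gamma> ` {0..T}" for R
  proof -
    define m :: int where "m = max 1 (\<lceil>R\<rceil> + 1)"
    have m: "of_int m > R" "m \<ge> 1" by (auto simp: m_def) linarith
    have "v \<in> \<Gamma> ` {0..2 * of_int m + 1}" if v: "v \<in> cball 0 R" for v
    proof -
      have "\<exists>c. (\<forall>k. c k \<in> {0, 1}) \<and> (\<lambda>k. c k / 2 ^ Suc k) sums ((v \<bullet> b / of_int m + 1) / 2)"
        if "b \<in> Basis" for b
      proof -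
        have "\<bar>v \<bullet> b\<bar> < of_int m"
          using Basis_le_norm[OF that, of v] v m by auto
        then have "0 \<le> (v \<bullet> b / of_int m + 1) / 2" "(v \<bullet> b / of_int m + 1) / 2 < 1"
          using m(2) by (auto simp: field_simps abs_less_iff)
        then show ?thesis using binary_expansion by metis
      qed
      then obtain c where c: "\<And>b k. b \<in> Basis \<Longrightarrow> c b k \<in> {0, 1}"
        "\<And>b. b \<in> Basis \<Longrightarrow> (\<lambda>k. c b k / 2 ^ Suc k) sums ((v \<bullet> b / of_int m + 1) / 2)"
        by metis
      \<comment> \<open>The digits of all coordinates are interleaved: digit \<open>k\<close> of coordinate \<open>b\<close> has place \<open>N * k + idx b\<close>.\<close>
      define a where "a j = (if \<exists>b\<in>Basis. idx b = j mod N then c (THE b. b \<in> Basis \<and> idx b = j mod N) (j div N) else 0)" for j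
      have the: "(THE b'. b' \<in> Basis \<and> idx b' = idx b) = b" if "b \<in> Basis" for b :: 'b
        using that idx(1) by (intro the_equality) (auto dest: inj_onD)
      have a01: "a j \<in> {0, 1}" for j
      proof (cases "\<exists>b\<in>(Basis :: 'b set). idx b = j mod N")
        case True
        then obtain b where "b \<in> (Basis :: 'b set)" "idx b = j mod N" by blast
        then show ?thesis using c(1)[of b] the[of b] by (auto simp: a_def)
      qed (simp add: a_def)
      have a_eq: "a (N * k + idx b) = c b k" if "b \<in> Basis" for b k
        using that idx(2)[OF that] N by (auto simp: a_def the)
      define t where "t = cantor_point a + 2 * of_int m"
      have t01: "0 \<le> cantor_point a" "cantor_point a \<le> 1" using cantor_point[of a] a01 by auto
      have At: "A t = of_int m"
        unfolding A_def t_def even_dist_periodic using t01 by (simp add: even_dist_eq)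
      have "s b t = (v \<bullet> b / of_int m + 1) / 2" if "b \<in> Basis" for b
      proof -
        have "schoenberg_hat (3 ^ j * t) = a j" for j
        proof -
          have "3 ^ j * t = 3 ^ j * cantor_point a + 2 * of_int (3 ^ j * m)"
            by (simp add: t_def algebra_simps)
          then show ?thesis by (simp only: schoenberg_hat_periodic schoenberg_hat_cantor_point a01)
        qed
        then have "s b t = (\<Sum>k. c b k / 2 ^ Suc k)"
          by (simp only: s_def a_eq[OF that])
        then show ?thesis using sums_unique[OF c(2)[OF that]] by simp
      qed
      then have "\<Gamma> t = (\<Sum>b\<in>Basis. (v \<bullet> b) *\<^sub>R b)"
        unfolding \<Gamma>_def At using m(2) by (intro sum.cong refl) (simp add: field_simps)
      then have "\<Gamma> t = v" by (simp add: euclidean_representation)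
      moreover have "t \<in> {0..2 * of_int m + 1}" using t01 m by (auto simp: t_def)
      ultimately show ?thesis by (metis imageI)
    qed
    moreover have "0 \<le> 2 * real_of_int m + 1" using m(2) by simp
    ultimately show ?thesis by blast
  qed
  ultimately show ?thesis using that by blast
qed

section \<open>Weak compactness under a bound on second moments\<close>

text \<open>A Borel section of the covering curve carries the measures to the real line, where Helly's selection
  theorem applies; the limit is carried back by the curve, which is continuous.\<close>

theorem weakly_convergent_subsequence:
  fixes \<pi> :: "nat \<Rightarrow> 'b::euclidean_space measure"
  assumes prob: "\<And>k. prob_space (\<pi> k)" and sets: "\<And>k. sets (\<pi> k) = sets borel"
    and int: "\<And>k. integrable (\<pi> k) (\<lambda>v. (norm v)\<^sup>2)" and bound: "\<And>k. (\<integral>v. (norm v)\<^sup>2 \<partial>\<pi> k) \<le> B"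
  obtains r :: "nat \<Rightarrow> nat" and \<rho> :: "'b measure"
  where "strict_mono r" "prob_space \<rho>" "sets \<rho> = sets borel"
    "\<And>F :: 'b \<Rightarrow> real. continuous_on UNIV F \<Longrightarrow> bounded (range F) \<Longrightarrow>
      (\<lambda>k. \<integral>v. F v \<partial>\<pi> (r k)) \<longlonglongrightarrow> (\<integral>v. F v \<partial>\<rho>)"
proof -
  obtain \<Gamma> :: "real \<Rightarrow> 'b" where \<Gamma>: "continuous_on UNIV \<Gamma>" "\<And>R. \<exists>T\<ge>0. cball 0 R \<subseteq> \<Gamma> ` {0..T}"
    by (rule continuous_curve_covers_balls) blast
  have [measurable]: "\<Gamma> \<in> borel_measurable borel" by (intro borel_measurable_continuous_onI \<Gamma>)
  \<comment> \<open>The first nonnegative parameter at which the curve meets a given point is a lower semicontinuous section.\<close>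
  define s where "s v = Inf {t. 0 \<le> t \<and> \<Gamma> t = v}" for v
  have s: "0 \<le> s v \<and> \<Gamma> (s v) = v" for v
  proof -
    have "{t. 0 \<le> t \<and> \<Gamma> t = v} = {0..} \<inter> \<Gamma> -` {v}" by auto
    also have "closed \<dots>" by (intro closed_Int closed_atLeast continuous_closed_vimage closed_singleton)
        (use \<Gamma>(1) in \<open>simp add: continuous_on_eq_continuous_at\<close>)
    finally have "closed {t. 0 \<le> t \<and> \<Gamma> t = v}" .
    moreover have "{t. 0 \<le> t \<and> \<Gamma> t = v} \<noteq> {}"
      using \<Gamma>(2)[of "norm v"] by (force simp: subset_iff)
    moreover have "bdd_below {t. 0 \<le> t \<and> \<Gamma> t = v}" by (auto simp: bdd_below_def)
    ultimately have "s v \<in> {t. 0 \<le> t \<and> \<Gamma> t = v}" unfolding s_def by (intro closed_contains_Inf)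
    then show ?thesis by simp
  qed
  have s_le: "s (\<Gamma> t) \<le> t" if "0 \<le> t" for t
    unfolding s_def using that by (intro cInf_lower) (auto simp: bdd_below_def)
  have level: "{v. s v \<le> a} = \<Gamma> ` {0..a}" for a
    using s s_le by (force intro: order.trans)
  have [measurable]: "s \<in> borel_measurable borel"
  proof (rule borel_measurableI_le)
    fix a
    have "compact (\<Gamma> ` {0..a})"
      by (intro compact_continuous_image continuous_on_subset[OF \<Gamma>(1)]) auto
    then show "{v \<in> space borel. s v \<le> a} \<in> sets borel"
      using level[of a] by (simp add: compact_imp_closed borel_closed)
  qed
  define \<mu> where "\<mu> k = distr (\<pi> k) borel s" for k
  have s_meas[measurable]: "s \<in> borel_measurable (\<pi> k)" for k
    using sets by (simp cong: measurable_cong_sets)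
  have rd: "real_distribution (\<mu> k)" for k
  proof -
    interpret prob_space "\<pi> k" by (rule prob)
    show ?thesis unfolding \<mu>_def by (rule real_distribution_distr) auto
  qed
  have "tight \<mu>"
    unfolding tight_def
  proof (rule conjI; intro allI impI)
    show "real_distribution (\<mu> n)" for n by (rule rd)
    fix \<epsilon> :: real assume \<epsilon>: "\<epsilon> > 0"
    have "0 \<le> (\<integral>v. (norm v)\<^sup>2 \<partial>\<pi> 0)" by simp
    then have "B \<ge> 0" using bound[of 0] by linarith
    define R where "R = sqrt ((B + 1) / \<epsilon>)"
    have R: "R > 0" "R\<^sup>2 = (B + 1) / \<epsilon>" using \<epsilon> \<open>B \<ge> 0\<close> by (auto simp: R_def)
    obtain T where T: "T \<ge> 0" "cball 0 R \<subseteq> \<Gamma> ` {0..T}" using \<Gamma>(2) by blast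
    have "measure (\<mu> k) {-1<..T} > 1 - \<epsilon>" for k
    proof -
      interpret prob_space "\<pi> k" by (rule prob)
      have sp: "space (\<pi> k) = UNIV" using sets_eq_imp_space_eq[OF sets] by simp
      have cb: "cball 0 R \<in> events" "{v. R\<^sup>2 \<le> (norm v)\<^sup>2} \<in> events"
        by (auto simp: sets)
      have "prob {v \<in> space (\<pi> k). R\<^sup>2 \<le> (norm v)\<^sup>2} \<le> expectation (\<lambda>v. (norm v)\<^sup>2) / R\<^sup>2"
        using R(1) by (intro integral_Markov_inequality_measure[where A = "{}"] int) auto
      also have "\<dots> \<le> B / R\<^sup>2" using bound by (intro divide_right_mono) auto
      also have "\<dots> < \<epsilon>" using \<epsilon> \<open>B \<ge> 0\<close> by (simp add: R(2) field_simps)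
      finally have "prob {v. R\<^sup>2 \<le> (norm v)\<^sup>2} < \<epsilon>" by (simp add: sp)
      moreover have "prob UNIV \<le> prob (cball 0 R \<union> {v. R\<^sup>2 \<le> (norm v)\<^sup>2})"
        using cb R(1) by (intro finite_measure_mono) (auto intro: power_mono)
      moreover have "prob (cball 0 R \<union> {v. R\<^sup>2 \<le> (norm v)\<^sup>2}) \<le> prob (cball 0 R) + prob {v. R\<^sup>2 \<le> (norm v)\<^sup>2}"
        by (intro measure_Un_le cb)
      moreover have "prob UNIV = 1" using prob_space sp by simp
      moreover have "prob (cball 0 R) \<le> measure (\<mu> k) {-1<..T}"
      proof -
        have "cball 0 R \<subseteq> s -` {-1<..T}"
        proof
          fix v :: 'b assume "v \<in> cball 0 R"
          then have "v \<in> {v. s v \<le> T}" unfolding level using T(2) by blast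
          then show "v \<in> s -` {-1<..T}" using s[of v] by auto
        qed
        then show ?thesis
          unfolding \<mu>_def by (subst measure_distr) (auto simp: sp sets intro!: finite_measure_mono measurable_sets_borel[of s borel])
      qed
      ultimately show ?thesis by linarith
    qed
    moreover have "-1 < T" using T by simp
    ultimately show "\<exists>a b. a < b \<and> (\<forall>n. measure (\<mu> n) {a<..b} > 1 - \<epsilon>)" by blast
  qed
  from tight_imp_convergent_subsubsequence[OF this strict_mono_id]
  obtain r M where r: "strict_mono (r :: nat \<Rightarrow> nat)" and M: "real_distribution M" and conv: "weak_conv_m (\<mu> \<circ> id \<circ> r) M"
    by auto
  interpret M: real_distribution M by (rule M)
  define \<rho> where "\<rho> = distr M borel \<Gamma>"
  have "prob_space \<rho>" unfolding \<rho>_def by (intro M.prob_space_distr) simp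
  moreover have "sets \<rho> = sets borel" by (simp add: \<rho>_def)
  moreover have "(\<lambda>k. \<integral>v. F v \<partial>\<pi> (r k)) \<longlonglongrightarrow> (\<integral>v. F v \<partial>\<rho>)"
    if F: "continuous_on UNIV F" "bounded (range F)" for F :: "'b \<Rightarrow> real"
  proof -
    have [measurable]: "F \<in> borel_measurable borel" by (intro borel_measurable_continuous_onI F)
    obtain K where K: "\<And>v. norm (F v) \<le> K" using F(2) by (auto simp: bounded_iff)
    have "(\<lambda>k. \<integral>t. F (\<Gamma> t) \<partial>(\<mu> \<circ> id \<circ> r) k) \<longlonglongrightarrow> (\<integral>t. F (\<Gamma> t) \<partial>M)"
    proof (rule weak_conv_imp_integral_bdd_continuous_conv[OF _ M conv])
      show "isCont (\<lambda>t. F (\<Gamma> t)) t" for t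
        using continuous_on_compose2[OF F(1) \<Gamma>(1)] by (simp add: continuous_on_eq_continuous_at)
    qed (use rd K in auto)
    moreover have "(\<integral>t. F (\<Gamma> t) \<partial>(\<mu> \<circ> id \<circ> r) k) = (\<integral>v. F v \<partial>\<pi> (r k))" for k
      unfolding \<mu>_def comp_def by (subst integral_distr) (auto simp: s)
    moreover have "(\<integral>t. F (\<Gamma> t) \<partial>M) = (\<integral>v. F v \<partial>\<rho>)"
      unfolding \<rho>_def by (subst integral_distr) auto
    ultimately show ?thesis by simp
  qed
  ultimately show ?thesis by (rule that[OF r])
qed

section \<open>Separation in finitely many coordinates\<close>

text \<open>The mixture \<open>(1 - s) p + s q\<close> of two probability mass functions.\<close>

definition mix_pmf :: "real \<Rightarrow> 'a pmf \<Rightarrow> 'a pmf \<Rightarrow> 'a pmf" where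
  "mix_pmf s p q = bernoulli_pmf s \<bind> (\<lambda>b. if b then q else p)"

lemma finite_mix_pmf: "finite (set_pmf p) \<Longrightarrow> finite (set_pmf q) \<Longrightarrow> finite (set_pmf (mix_pmf s p q))"
  unfolding mix_pmf_def set_bind_pmf
  by (rule finite_UN_I) (auto intro: finite_subset[OF subset_UNIV])

lemma expectation_mix_pmf:
  fixes F :: "'a \<Rightarrow> 'b::{banach, second_countable_topology}"
  assumes "finite (set_pmf p)" "finite (set_pmf q)" "0 \<le> s" "s \<le> 1"
  shows "measure_pmf.expectation (mix_pmf s p q) F =
    (1 - s) *\<^sub>R measure_pmf.expectation p F + s *\<^sub>R measure_pmf.expectation q F"
  unfolding mix_pmf_def
  by (subst pmf_expectation_bind[of UNIV]) (use assms in \<open>auto simp: UNIV_bool\<close>)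

text \<open>A convex set of vectors, indexed by a finite set of arbitrary size, contains vectors with arbitrarily
  small coordinates unless a linear functional has a positive lower bound on it. The functional is given by
  the point of least Euclidean norm in the closure, which is obtained as the limit of a minimizing
  sequence.\<close>

lemma finite_coordinates_separation:
  fixes K :: "('i \<Rightarrow> real) set"
  assumes I: "finite I" and K: "K \<noteq> {}"
    and conv: "\<And>p q s. p \<in> K \<Longrightarrow> q \<in> K \<Longrightarrow> 0 \<le> s \<Longrightarrow> s \<le> 1 \<Longrightarrow> (\<lambda>i. (1 - s) * p i + s * q i) \<in> K"
    and sep: "\<And>c d. d > 0 \<Longrightarrow> \<exists>q\<in>K. (\<Sum>i\<in>I. c i * q i) < d"
    and \<epsilon>: "\<epsilon> > 0"
  shows "\<exists>p\<in>K. \<forall>i\<in>I. \<bar>p i\<bar> < \<epsilon>"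
proof (rule ccontr)
  assume neg: "\<not> ?thesis"
  define n2 where "n2 p = (\<Sum>i\<in>I. (p i)\<^sup>2)" for p :: "'i \<Rightarrow> real"
  have n2_ge: "(p i)\<^sup>2 \<le> n2 p" if "i \<in> I" for p i
    unfolding n2_def by (rule member_le_sum) (use I that in auto)
  have lower: "\<epsilon>\<^sup>2 \<le> n2 p" if p: "p \<in> K" for p
  proof -
    obtain i where "i \<in> I" "\<epsilon> \<le> \<bar>p i\<bar>" using neg p by (meson not_less)
    then have "\<epsilon>\<^sup>2 \<le> (p i)\<^sup>2" using \<epsilon> by (simp add: abs_le_square_iff[symmetric])
    then show ?thesis using n2_ge[OF \<open>i \<in> I\<close>, of p] by linarith
  qed
  define d where "d = Inf (n2 ` K)"
  have bdd: "bdd_below (n2 ` K)" using lower by (auto simp: bdd_below_def)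
  have d_le: "d \<le> n2 p" if "p \<in> K" for p unfolding d_def by (intro cInf_lower bdd imageI that)
  have "\<epsilon>\<^sup>2 \<le> d" unfolding d_def using K lower by (intro cInf_greatest) auto
  then have d: "d > 0" using \<epsilon> by (smt (verit) zero_less_power)
  have "\<exists>p\<in>K. n2 p < d + 1 / Suc k" for k
    using cInf_lessD[of "n2 ` K" "d + 1 / Suc k"] K by (auto simp: d_def)
  then obtain p where pK: "\<And>k. p k \<in> K" and pn: "\<And>k. n2 (p k) < d + 1 / Suc k" by metis
  \<comment> \<open>By the parallelogram identity a minimizing sequence is Cauchy.\<close>
  have para: "n2 (\<lambda>i. p k i - p l i) \<le> 2 * (1 / Suc k) + 2 * (1 / Suc l)" for k l
  proof -
    have "d \<le> n2 (\<lambda>i. (1 - 1/2) * p k i + 1/2 * p l i)" by (intro d_le conv pK) auto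
    moreover have "n2 (\<lambda>i. p k i - p l i) + 4 * n2 (\<lambda>i. (1 - 1/2) * p k i + 1/2 * p l i) = 2 * n2 (p k) + 2 * n2 (p l)"
      unfolding n2_def sum_distrib_left sum.distrib[symmetric]
      by (intro sum.cong refl) (simp add: power2_eq_square field_simps)
    ultimately show ?thesis using pn[of k] pn[of l] by linarith
  qed
  have "Cauchy (\<lambda>k. p k i)" if i: "i \<in> I" for i
  proof (rule CauchyI')
    fix e :: real assume e: "e > 0"
    obtain M where M: "4 / e\<^sup>2 < real (Suc M)" using reals_Archimedean2[of "4 / e\<^sup>2"] by (metis less_Suc_eq of_nat_less_iff less_trans lessI)
    have "dist (p m i) (p n i) < e" if "m \<ge> M" "n > m" for m n
    proof -
      have "1 / Suc m \<le> 1 / real (Suc M)" "1 / Suc n \<le> 1 / real (Suc M)" using that by (auto intro!: divide_left_mono)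
      then have "(p m i - p n i)\<^sup>2 \<le> 4 * (1 / real (Suc M))"
        using n2_ge[OF i, of "\<lambda>i. p m i - p n i"] para[of m n] by linarith
      also have "\<dots> < e\<^sup>2" using M e by (simp add: field_simps)
      finally have "\<bar>p m i - p n i\<bar>\<^sup>2 < e\<^sup>2" by simp
      then show ?thesis unfolding dist_real_def by (rule power2_less_imp_less) (use e in simp)
    qed
    then show "\<exists>M. \<forall>m\<ge>M. \<forall>n>m. dist (p m i) (p n i) < e" by blast
  qed
  moreover define c where "c i = lim (\<lambda>k. p k i)" for i
  ultimately have c: "(\<lambda>k. p k i) \<longlonglongrightarrow> c i" if "i \<in> I" for i
    using that by (simp add: Cauchy_convergent_iff convergent_LIMSEQ_iff)
  have "(\<lambda>k. n2 (p k)) \<longlonglongrightarrow> n2 c" unfolding n2_def by (intro tendsto_intros c)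
  moreover have "(\<lambda>k. n2 (p k)) \<longlonglongrightarrow> d"
  proof (rule tendsto_sandwich)
    show "\<forall>\<^sub>F k in sequentially. d \<le> n2 (p k)" using d_le[OF pK] by simp
    show "\<forall>\<^sub>F k in sequentially. n2 (p k) \<le> d + 1 / Suc k" using pn by (simp add: less_imp_le)
    show "(\<lambda>k. d + 1 / Suc k) \<longlonglongrightarrow> d"
      using tendsto_add[OF tendsto_const[of d] LIMSEQ_inverse_real_of_nat] by (simp add: inverse_eq_divide)
  qed simp
  ultimately have n2c: "n2 c = d" by (rule LIMSEQ_unique)
  \<comment> \<open>First-order optimality of the limit \<open>c\<close> along the segment towards \<open>q\<close>.\<close>
  have "d \<le> (\<Sum>i\<in>I. c i * q i)" if q: "q \<in> K" for q
  proof -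
    define S where "S = (\<Sum>i\<in>I. c i * (q i - c i))"
    have *: "0 \<le> 2 * S + s * n2 (\<lambda>i. q i - c i)" if s: "0 < s" "s \<le> 1" for s
    proof -
      have "d \<le> n2 (\<lambda>i. (1 - s) * c i + s * q i)"
      proof (rule LIMSEQ_le_const)
        show "(\<lambda>k. n2 (\<lambda>i. (1 - s) * p k i + s * q i)) \<longlonglongrightarrow> n2 (\<lambda>i. (1 - s) * c i + s * q i)"
          unfolding n2_def by (intro tendsto_intros c)
        show "\<exists>N. \<forall>k\<ge>N. d \<le> n2 (\<lambda>i. (1 - s) * p k i + s * q i)"
          using s by (intro exI[of _ 0] allI impI d_le conv pK q) auto
      qed
      also have "n2 (\<lambda>i. (1 - s) * c i + s * q i) = n2 c + s * (2 * S + s * n2 (\<lambda>i. q i - c i))"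
        unfolding n2_def S_def sum_distrib_left distrib_left sum.distrib[symmetric]
        by (intro sum.cong refl) (simp add: power2_eq_square algebra_simps)
      finally have "0 \<le> s * (2 * S + s * n2 (\<lambda>i. q i - c i))" using n2c by simp
      then show ?thesis using s by (simp add: zero_le_mult_iff)
    qed
    have "0 \<le> 2 * S"
    proof (rule tendsto_lowerbound)
      have "((\<lambda>s. 2 * S + s * n2 (\<lambda>i. q i - c i)) \<longlongrightarrow> 2 * S + 0 * n2 (\<lambda>i. q i - c i)) (at_right 0)"
        by (intro tendsto_intros)
      then show "((\<lambda>s. 2 * S + s * n2 (\<lambda>i. q i - c i)) \<longlongrightarrow> 2 * S) (at_right 0)" by simp
      show "\<forall>\<^sub>F s in at_right 0. 0 \<le> 2 * S + s * n2 (\<lambda>i. q i - c i)"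
        using * by (auto simp: eventually_at_right_field intro!: exI[of _ 1])
    qed simp
    moreover have "(\<Sum>i\<in>I. c i * q i) = S + n2 c"
      unfolding S_def n2_def sum.distrib[symmetric]
      by (intro sum.cong refl) (simp add: power2_eq_square algebra_simps)
    ultimately show ?thesis using n2c by linarith
  qed
  then show False using sep[OF d, of c] by force
qed

section \<open>Duality: the convex-concave order excludes positive tests\<close>

lemma finite_moment_2D:
  assumes "\<mu> \<in> finite_moment_prob 2"
  shows "prob_space \<mu>" "sets \<mu> = sets borel" "integrable \<mu> (\<lambda>x. (norm x)\<^sup>2)"
proof -
  have "(\<lambda>x. norm x powr 2) = (\<lambda>x :: 'a. (norm x)\<^sup>2)"
    by (auto simp: powr_numeral)
  then show "prob_space \<mu>" "sets \<mu> = sets borel" "integrable \<mu> (\<lambda>x. (norm x)\<^sup>2)"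
    using assms by (auto simp: finite_moment_prob_def borel_prob_def)
qed

lemma integrable_finite_moment_2:
  assumes \<mu>: "\<mu> \<in> finite_moment_prob 2" and "f \<in> borel_measurable borel" "quadratic_growth f"
  shows "integrable \<mu> f"
proof -
  interpret prob_space \<mu> by (rule finite_moment_2D[OF \<mu>])
  obtain C where "\<forall>v. \<bar>f v\<bar> \<le> C * (1 + (norm v)\<^sup>2)" using assms(3) by (auto simp: quadratic_growth_def)
  moreover have "f \<in> borel_measurable \<mu>"
    using assms(2) finite_moment_2D(2)[OF \<mu>] by (simp cong: measurable_cong_sets)
  ultimately show ?thesis by (intro integrable_quadratic_growth[OF _ finite_moment_2D(3)[OF \<mu>]]) auto
qed

text \<open>A convex-concave function between \<open>\<phi>\<close> and \<open>\<beta>\<close>: the concave hull along \<open>W\<close> of a family of functions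
  \<open>l x\<close>, each affine along \<open>V\<close> and constant along \<open>W\<close>. Every competitor in the supremum is
  affine along \<open>V\<close>, so that taking the hull in \<open>W\<close> does not destroy convexity along \<open>V\<close>.\<close>

lemma (in orth_decomp) convex_concave_hull:
  fixes \<phi> \<beta> :: "'a \<Rightarrow> real" and g :: "'a \<Rightarrow> 'a"
  defines "l \<equiv> \<lambda>x w. \<phi> x - g x \<bullet> (P w - P x)"
  assumes upper: "\<And>p w. finite (set_pmf p) \<Longrightarrow> measure_pmf.expectation p Q = Q w \<Longrightarrow>
      measure_pmf.expectation p (\<lambda>x. l x w) \<le> \<beta> w"
  obtains f where "convex_concave V W f" "\<And>w. \<phi> w \<le> f w" "\<And>w. f w \<le> \<beta> w"
proof -
  define A where "A w = {p. finite (set_pmf p) \<and> measure_pmf.expectation p Q = Q w}" for w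
  define E where "E p w = measure_pmf.expectation p (\<lambda>x. l x w)" for p w
  define f where "f w = (SUP p\<in>A w. E p w)" for w
  have ret: "return_pmf w \<in> A w" for w by (simp add: A_def)
  have bdd: "bdd_above ((\<lambda>p. E p w) ` A w)" for w
    using upper by (auto simp: A_def E_def bdd_above_def)
  have f_ge: "E p w \<le> f w" if "p \<in> A w" for p w
    unfolding f_def by (intro cSUP_upper bdd that)
  have f_le: "f w \<le> c" if "\<And>p. p \<in> A w \<Longrightarrow> E p w \<le> c" for c w
    unfolding f_def using ret that by (intro cSUP_least) auto
  have l_affine: "l x (s *\<^sub>R u + t *\<^sub>R v + w) = s * l x (u + w) + t * l x (v + w)" if "s + t = 1" for s t x u v w
  proof -
    have "P (s *\<^sub>R u + t *\<^sub>R v + w) - P x = s *\<^sub>R (P (u + w) - P x) + t *\<^sub>R (P (v + w) - P x)"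
    proof -
      have "P w - P x = s *\<^sub>R (P w - P x) + t *\<^sub>R (P w - P x)" using that by (metis scaleR_add_left scaleR_one)
      then show ?thesis by (simp add: proj_linear_simps algebra_simps)
    qed
    then have "g x \<bullet> (P (s *\<^sub>R u + t *\<^sub>R v + w) - P x) = s * (g x \<bullet> (P (u + w) - P x)) + t * (g x \<bullet> (P (v + w) - P x))"
      by (simp only: inner_add_right inner_scaleR_right)
    moreover have "\<phi> x = s * \<phi> x + t * \<phi> x" using that by (metis distrib_right mult_1)
    ultimately show ?thesis unfolding l_def right_diff_distrib by linarith
  qed
  have int: "integrable (measure_pmf p) F" if "finite (set_pmf p)" for p and F :: "'a \<Rightarrow> real"
    using that by (rule integrable_measure_pmf_finite)
  have "convex_on V (\<lambda>v. f (v + w))" if w: "w \<in> W" for w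
  proof (rule convex_onI[OF _ subspace_imp_convex[OF subspace_V]])
    fix t :: real and u v assume t: "0 < t" "t < 1" and uv: "u \<in> V" "v \<in> V"
    show "f ((1 - t) *\<^sub>R u + t *\<^sub>R v + w) \<le> (1 - t) * f (u + w) + t * f (v + w)"
    proof (rule f_le)
      fix p assume "p \<in> A ((1 - t) *\<^sub>R u + t *\<^sub>R v + w)"
      moreover have "Q v = 0" if "v \<in> V" for v
        using orth_decomp.proj_W[OF swap that] .
      ultimately have p: "finite (set_pmf p)" "p \<in> A (u + w)" "p \<in> A (v + w)"
        using uv by (auto simp: A_def proj_linear_simps)
      have "E p ((1 - t) *\<^sub>R u + t *\<^sub>R v + w) = (1 - t) * E p (u + w) + t * E p (v + w)"
        unfolding E_def using int[OF p(1)] by (simp add: l_affine)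
      also have "\<dots> \<le> (1 - t) * f (u + w) + t * f (v + w)"
        using t p by (intro add_mono mult_left_mono f_ge) auto
      finally show "E p ((1 - t) *\<^sub>R u + t *\<^sub>R v + w) \<le> (1 - t) * f (u + w) + t * f (v + w)" .
    qed
  qed
  moreover have "concave_on W (\<lambda>w. f (v + w))" if v: "v \<in> V" for v
    unfolding concave_on_def
  proof (rule convex_onI[OF _ subspace_imp_convex[OF subspace_W]])
    fix t :: real and w w' assume t: "0 < t" "t < 1" and w: "w \<in> W" "w' \<in> W"
    have Pw: "P (v + w) = v" if "w \<in> W" for w using v that by (rule proj_unique)
    have Qw: "Q (v + w) = w" if "w \<in> W" for w
      using orth_decomp.proj_unique[OF swap that v] by (simp add: add.commute)
    define z where "z = (1 - t) *\<^sub>R w + t *\<^sub>R w'"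
    have z: "z \<in> W" using w subspace_W by (auto simp: z_def intro: subspace_add subspace_scale)
    have l_const: "l x (v + w) = l x v" if "w \<in> W" for x w using Pw[OF that] v by (simp add: l_def)
    have mix: "(1 - t) * E p (v + w) + t * E q (v + w') \<le> f (v + z)" if p: "p \<in> A (v + w)" and q: "q \<in> A (v + w')" for p q
    proof -
      have fin: "finite (set_pmf p)" "finite (set_pmf q)" using p q by (auto simp: A_def)
      have "mix_pmf t p q \<in> A (v + z)"
        using p q t w by (auto simp: A_def expectation_mix_pmf finite_mix_pmf Qw z Qw[OF z]) (simp add: z_def)
      then have "E (mix_pmf t p q) (v + z) \<le> f (v + z)" by (rule f_ge)
      then show ?thesis using t fin w z by (simp add: E_def expectation_mix_pmf l_const)
    qed
    have "(1 - t) * f (v + w) + t * f (v + w') \<le> f (v + z)"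
    proof -
      have "f (v + w) \<le> (f (v + z) - t * E q (v + w')) / (1 - t)" if "q \<in> A (v + w')" for q
        using mix[OF _ that] t by (intro f_le) (simp add: pos_le_divide_eq algebra_simps)
      then have "t * E q (v + w') \<le> f (v + z) - (1 - t) * f (v + w)" if "q \<in> A (v + w')" for q
        using that t by (simp add: pos_le_divide_eq algebra_simps)
      then have "f (v + w') \<le> (f (v + z) - (1 - t) * f (v + w)) / t"
        using t by (intro f_le) (simp add: pos_le_divide_eq algebra_simps)
      then show ?thesis using t by (simp add: pos_le_divide_eq algebra_simps)
    qed
    then show "- f (v + ((1 - t) *\<^sub>R w + t *\<^sub>R w')) \<le> (1 - t) * - f (v + w) + t * - f (v + w')"
      by (simp add: z_def)
  qed
  ultimately have "convex_concave V W f" by (simp add: convex_concave_def)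
  moreover have "\<phi> w \<le> f w" for w
    using f_ge[OF ret, of w] by (simp add: E_def l_def)
  moreover have "f w \<le> \<beta> w" for w
    by (rule f_le) (auto simp: A_def E_def upper)
  ultimately show ?thesis using that by blast
qed

lemma quadratic_growth_combine:
  assumes "quadratic_growth f" "quadratic_growth g"
  shows "quadratic_growth (\<lambda>x. f x + c * g x)"
proof -
  obtain A B where A: "A \<ge> 0" "\<forall>v. \<bar>f v\<bar> \<le> A * (1 + (norm v)\<^sup>2)"
    and B: "B \<ge> 0" "\<forall>v. \<bar>g v\<bar> \<le> B * (1 + (norm v)\<^sup>2)"
    using assms by (auto simp: quadratic_growth_def)
  have "\<bar>f v + c * g v\<bar> \<le> (A + \<bar>c\<bar> * B) * (1 + (norm v)\<^sup>2)" for v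
  proof -
    have "\<bar>f v + c * g v\<bar> \<le> \<bar>f v\<bar> + \<bar>c\<bar> * \<bar>g v\<bar>" by (metis abs_mult abs_triangle_ineq)
    also have "\<dots> \<le> A * (1 + (norm v)\<^sup>2) + \<bar>c\<bar> * (B * (1 + (norm v)\<^sup>2))"
      using A B by (intro add_mono mult_left_mono) auto
    finally show ?thesis by (simp add: algebra_simps)
  qed
  moreover have "A + \<bar>c\<bar> * B \<ge> 0" using A B by simp
  ultimately show ?thesis unfolding quadratic_growth_def by blast
qed

lemma quadratic_growth_const: "quadratic_growth (\<lambda>x. c)"
proof -
  have "\<bar>c\<bar> \<le> \<bar>c\<bar> * (1 + (norm v)\<^sup>2)" for v :: 'a
    by (simp add: algebra_simps)
  then show ?thesis unfolding quadratic_growth_def by (intro exI[of _ "\<bar>c\<bar>"]) auto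
qed

lemma quadratic_growth_between:
  assumes "quadratic_growth f" "quadratic_growth g" "\<And>x. f x \<le> h x" "\<And>x. h x \<le> g x"
  shows "quadratic_growth h"
proof -
  obtain A B where A: "A \<ge> 0" "\<forall>v. \<bar>f v\<bar> \<le> A * (1 + (norm v)\<^sup>2)"
    and B: "B \<ge> 0" "\<forall>v. \<bar>g v\<bar> \<le> B * (1 + (norm v)\<^sup>2)"
    using assms by (auto simp: quadratic_growth_def)
  have "\<bar>h v\<bar> \<le> (A + B) * (1 + (norm v)\<^sup>2)" for v
  proof -
    have "\<bar>h v\<bar> \<le> \<bar>f v\<bar> + \<bar>g v\<bar>" using assms(3,4)[of v] by linarith
    also have "\<dots> \<le> A * (1 + (norm v)\<^sup>2) + B * (1 + (norm v)\<^sup>2)" using A B by (intro add_mono) auto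
    finally show ?thesis by (simp add: algebra_simps)
  qed
  then show ?thesis using A B unfolding quadratic_growth_def by (intro exI[of _ "A + B"]) auto
qed

text \<open>Functions of a pair \<open>(x, y)\<close> that measure the deviation from a bimartingale coupling: deviations of
  the two marginals, and martingale increments weighted by vector fields \<open>g\<close> and \<open>h\<close>. No regularity is
  asked of \<open>g\<close> and \<open>h\<close>, because the duality argument only evaluates them pointwise.\<close>

definition (in orth_decomp) coupling_tests :: "'a measure \<Rightarrow> 'a measure \<Rightarrow> ('a \<times> 'a \<Rightarrow> real) set" where
  "coupling_tests \<mu> \<nu> = {t. \<exists>a b g h.
     a \<in> borel_measurable borel \<and> b \<in> borel_measurable borel \<and> quadratic_growth a \<and> quadratic_growth b \<and>
     t = (\<lambda>(x, y). (a x - (\<integral>x. a x \<partial>\<mu>)) + (b y - (\<integral>y. b y \<partial>\<nu>)) + g x \<bullet> (P y - P x) + h y \<bullet> (Q x - Q y))}"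

text \<open>If \<open>t \<ge> \<epsilon>\<close> everywhere, then the function \<open>\<phi>\<close> of \<open>x\<close> lies below the function \<open>\<beta>\<close> of \<open>y\<close> up to the
  martingale increments, and a convex-concave function fits between the two. Its integrals against
  \<open>\<mu>\<close> and \<open>\<nu>\<close> are then at least 0 and at most \<open>- \<epsilon>\<close>.\<close>

lemma (in orth_decomp) no_positive_coupling_test:
  assumes \<mu>: "\<mu> \<in> finite_moment_prob 2" and \<nu>: "\<nu> \<in> finite_moment_prob 2"
    and cc: "cc_order_wrt V W \<mu> \<nu>" and t: "t \<in> coupling_tests \<mu> \<nu>" and \<epsilon>: "\<epsilon> > 0"
  shows "\<exists>z. t z < \<epsilon>"
proof (rule ccontr)
  assume "\<not> ?thesis"
  then have pos: "\<epsilon> \<le> t z" for z by (meson not_less)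
  interpret \<mu>: prob_space \<mu> by (rule finite_moment_2D[OF \<mu>])
  interpret \<nu>: prob_space \<nu> by (rule finite_moment_2D[OF \<nu>])
  obtain a b g h where a: "a \<in> borel_measurable borel" "quadratic_growth a"
    and b: "b \<in> borel_measurable borel" "quadratic_growth b"
    and t_eq: "t = (\<lambda>(x, y). (a x - (\<integral>x. a x \<partial>\<mu>)) + (b y - (\<integral>y. b y \<partial>\<nu>)) + g x \<bullet> (P y - P x) + h y \<bullet> (Q x - Q y))"
    using t unfolding coupling_tests_def by blast
  define \<phi> where "\<phi> x = (\<integral>x. a x \<partial>\<mu>) - a x" for x
  define \<beta> where "\<beta> y = b y - (\<integral>y. b y \<partial>\<nu>) - \<epsilon>" for y
  have "measure_pmf.expectation p (\<lambda>x. \<phi> x - g x \<bullet> (P w - P x)) \<le> \<beta> w"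
    if p: "finite (set_pmf p)" "measure_pmf.expectation p Q = Q w" for p w
  proof -
    have "measure_pmf.expectation p (\<lambda>x. \<phi> x - g x \<bullet> (P w - P x)) \<le> measure_pmf.expectation p (\<lambda>x. \<beta> w + h w \<bullet> (Q x - Q w))"
    proof (rule integral_mono)
      show "\<phi> x - g x \<bullet> (P w - P x) \<le> \<beta> w + h w \<bullet> (Q x - Q w)" for x
        using pos[of "(x, w)"] by (simp add: t_eq \<phi>_def \<beta>_def)
    qed (rule integrable_measure_pmf_finite[OF p(1)])+
    also have "\<dots> = \<beta> w + h w \<bullet> (measure_pmf.expectation p Q - Q w)"
      using p(1) by (simp add: integrable_measure_pmf_finite inner_diff_right)
    finally show ?thesis using p(2) by simp
  qed
  then obtain f where f: "convex_concave V W f" "\<And>w. \<phi> w \<le> f w" "\<And>w. f w \<le> \<beta> w"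
    using convex_concave_hull[of \<phi> g \<beta>] by blast
  have \<phi>: "quadratic_growth \<phi>" and \<beta>: "quadratic_growth \<beta>"
    using quadratic_growth_combine[OF quadratic_growth_const a(2), of "\<integral>x. a x \<partial>\<mu>" "-1"]
      quadratic_growth_combine[OF b(2) quadratic_growth_const, of 1 "- (\<integral>y. b y \<partial>\<nu>) - \<epsilon>"]
    by (simp_all add: \<phi>_def[abs_def] \<beta>_def[abs_def] algebra_simps)
  have fq: "quadratic_growth f" by (rule quadratic_growth_between[OF \<phi> \<beta> f(2,3)])
  have fm: "f \<in> borel_measurable borel"
    by (intro borel_measurable_continuous_onI convex_concave_continuous f(1) fq)
  have ai: "integrable \<mu> a" and bi: "integrable \<nu> b" and f\<mu>: "integrable \<mu> f" and f\<nu>: "integrable \<nu> f"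
    by (intro integrable_finite_moment_2 \<mu> \<nu> a b fm fq)+
  have "0 = (\<integral>x. \<phi> x \<partial>\<mu>)" using ai by (simp add: \<phi>_def[abs_def] \<mu>.prob_space)
  also have "\<dots> \<le> (\<integral>x. f x \<partial>\<mu>)" using ai f\<mu> f(2) by (intro integral_mono) (auto simp: \<phi>_def[abs_def])
  also have "\<dots> \<le> (\<integral>x. f x \<partial>\<nu>)" using cc f(1) fq by (simp add: cc_order_wrt_def)
  also have "\<dots> \<le> (\<integral>x. \<beta> x \<partial>\<nu>)" using bi f\<nu> f(3) by (intro integral_mono) (auto simp: \<beta>_def[abs_def])
  also have "\<dots> = - \<epsilon>" using bi by (simp add: \<beta>_def[abs_def] \<nu>.prob_space)
  finally show False using \<epsilon> by simp
qed

lemma (in orth_decomp) coupling_tests_combine: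
  assumes \<mu>: "\<mu> \<in> finite_moment_prob 2" and \<nu>: "\<nu> \<in> finite_moment_prob 2"
    and "t \<in> coupling_tests \<mu> \<nu>" "t' \<in> coupling_tests \<mu> \<nu>"
  shows "(\<lambda>z. t z + c * t' z) \<in> coupling_tests \<mu> \<nu>"
proof -
  obtain a b g h where a: "a \<in> borel_measurable borel" "quadratic_growth a"
    and b: "b \<in> borel_measurable borel" "quadratic_growth b"
    and t: "t = (\<lambda>(x, y). (a x - (\<integral>x. a x \<partial>\<mu>)) + (b y - (\<integral>y. b y \<partial>\<nu>)) + g x \<bullet> (P y - P x) + h y \<bullet> (Q x - Q y))"
    using assms(3) unfolding coupling_tests_def by blast
  obtain a' b' g' h' where a': "a' \<in> borel_measurable borel" "quadratic_growth a'"
    and b': "b' \<in> borel_measurable borel" "quadratic_growth b'"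
    and t': "t' = (\<lambda>(x, y). (a' x - (\<integral>x. a' x \<partial>\<mu>)) + (b' y - (\<integral>y. b' y \<partial>\<nu>)) + g' x \<bullet> (P y - P x) + h' y \<bullet> (Q x - Q y))"
    using assms(4) unfolding coupling_tests_def by blast
  have int: "(\<integral>x. a x + c * a' x \<partial>\<mu>) = (\<integral>x. a x \<partial>\<mu>) + c * (\<integral>x. a' x \<partial>\<mu>)"
    "(\<integral>x. b x + c * b' x \<partial>\<nu>) = (\<integral>x. b x \<partial>\<nu>) + c * (\<integral>x. b' x \<partial>\<nu>)"
    using integrable_finite_moment_2[OF \<mu> a] integrable_finite_moment_2[OF \<mu> a']
      integrable_finite_moment_2[OF \<nu> b] integrable_finite_moment_2[OF \<nu> b'] by simp_all
  show ?thesis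
    unfolding coupling_tests_def
    by (intro CollectI exI[of _ "\<lambda>x. a x + c * a' x"] exI[of _ "\<lambda>x. b x + c * b' x"]
        exI[of _ "\<lambda>x. g x + c *\<^sub>R g' x"] exI[of _ "\<lambda>x. h x + c *\<^sub>R h' x"] conjI
        quadratic_growth_combine a(2) a'(2) b(2) b'(2))
      (use a b a' b' int in \<open>auto simp: t t' fun_eq_iff inner_add_left algebra_simps\<close>)
qed

lemma (in orth_decomp) coupling_tests_zero: "(\<lambda>z. 0) \<in> coupling_tests \<mu> \<nu>"
  unfolding coupling_tests_def
  by (intro CollectI exI[of _ "\<lambda>x. 0"] conjI) (auto simp: quadratic_growth_const)

lemma (in orth_decomp) coupling_tests_sum:
  assumes \<mu>: "\<mu> \<in> finite_moment_prob 2" and \<nu>: "\<nu> \<in> finite_moment_prob 2"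
    and "finite F" "F \<subseteq> coupling_tests \<mu> \<nu>"
  shows "(\<lambda>z. \<Sum>t\<in>F. c t * t z) \<in> coupling_tests \<mu> \<nu>"
  using assms(3,4)
proof (induction F rule: finite_induct)
  case empty
  then show ?case by (simp add: coupling_tests_zero)
next
  case (insert t F)
  have "(\<lambda>z. (\<Sum>t\<in>F. c t * t z) + c t * t z) \<in> coupling_tests \<mu> \<nu>"
    using insert by (intro coupling_tests_combine[OF \<mu> \<nu>]) auto
  then show ?case using insert by (simp add: add.commute)
qed

text \<open>Point masses already exclude a separating functional, since a linear combination of tests is a test.\<close>

lemma (in orth_decomp) approximate_coupling:
  assumes \<mu>: "\<mu> \<in> finite_moment_prob 2" and \<nu>: "\<nu> \<in> finite_moment_prob 2"
    and cc: "cc_order_wrt V W \<mu> \<nu>"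
    and F: "finite F" "F \<subseteq> coupling_tests \<mu> \<nu>" and \<epsilon>: "\<epsilon> > 0"
  obtains p where "finite (set_pmf p)" "\<And>t. t \<in> F \<Longrightarrow> \<bar>measure_pmf.expectation p t\<bar> < \<epsilon>"
proof -
  define K where "K = {(\<lambda>t :: 'a \<times> 'a \<Rightarrow> real. measure_pmf.expectation p t) | p. finite (set_pmf p)}"
  have "\<exists>e\<in>K. \<forall>t\<in>F. \<bar>e t\<bar> < \<epsilon>"
  proof (rule finite_coordinates_separation[OF F(1) _ _ _ \<epsilon>])
    have ret: "(\<lambda>t. t z) \<in> K" for z
      unfolding K_def by (intro CollectI exI[of _ "return_pmf z"]) auto
    then show "K \<noteq> {}" by blast
    show "(\<lambda>t. (1 - s) * e t + s * e' t) \<in> K" if "e \<in> K" "e' \<in> K" "0 \<le> s" "s \<le> 1" for e e' s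
    proof -
      obtain p q where "finite (set_pmf p)" "e = (\<lambda>t. measure_pmf.expectation p t)"
        "finite (set_pmf q)" "e' = (\<lambda>t. measure_pmf.expectation q t)"
        using \<open>e \<in> K\<close> \<open>e' \<in> K\<close> unfolding K_def by blast
      then show ?thesis
        unfolding K_def using that(3,4)
        by (intro CollectI exI[of _ "mix_pmf s p q"]) (simp add: fun_eq_iff expectation_mix_pmf finite_mix_pmf)
    qed
    show "\<exists>e\<in>K. (\<Sum>t\<in>F. c t * e t) < d" if pos: "d > 0" for c d
    proof -
      obtain z where "(\<Sum>t\<in>F. c t * t z) < d"
        using no_positive_coupling_test[OF \<mu> \<nu> cc coupling_tests_sum[OF \<mu> \<nu> F] pos] by blast
      then show ?thesis by (intro bexI[OF _ ret[of z]])
    qed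
  qed
  then show ?thesis using that by (auto simp: K_def)
qed

section \<open>Countably many continuous functions that determine Borel measures\<close>

text \<open>The points with rational coordinates, and the open boxes spanned by them.\<close>

definition rational_points :: "'a::euclidean_space set" where
  "rational_points = {a. \<forall>i\<in>Basis. a \<bullet> i \<in> \<rat>}"

lemma countable_rational_points: "countable (rational_points :: 'a::euclidean_space set)"
proof -
  have "rational_points \<subseteq> (\<lambda>f. \<Sum>i\<in>Basis. f i *\<^sub>R i) ` (PiE Basis (\<lambda>_. \<rat>) :: ('a \<Rightarrow> real) set)"
  proof
    fix a :: 'a assume a: "a \<in> rational_points"
    have "a = (\<Sum>i\<in>Basis. restrict (\<lambda>i. a \<bullet> i) Basis i *\<^sub>R i)"
      by (simp add: euclidean_representation)
    moreover have "restrict (\<lambda>i. a \<bullet> i) Basis \<in> PiE Basis (\<lambda>_. \<rat>)"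
      using a by (auto simp: rational_points_def)
    ultimately show "a \<in> (\<lambda>f. \<Sum>i\<in>Basis. f i *\<^sub>R i) ` PiE Basis (\<lambda>_. \<rat>)" by blast
  qed
  moreover have "countable (PiE Basis (\<lambda>_. \<rat>) :: ('a \<Rightarrow> real) set)"
    by (intro countable_PiE) (auto simp: countable_rat)
  ultimately show ?thesis by (meson countable_image countable_subset)
qed

definition rational_boxes :: "'a::euclidean_space set set" where
  "rational_boxes = (\<lambda>(a, b). box a b) ` (rational_points \<times> rational_points)"

lemma countable_rational_boxes: "countable rational_boxes"
  unfolding rational_boxes_def by (intro countable_image countable_SIGMA countable_rational_points)

lemma Int_stable_rational_boxes: "Int_stable rational_boxes"
proof (rule Int_stableI)
  fix A B :: "'a set" assume "A \<in> rational_boxes" "B \<in> rational_boxes"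
  then obtain a b c d where *: "A = box a b" "B = box c d" "a \<in> rational_points" "b \<in> rational_points"
    "c \<in> rational_points" "d \<in> rational_points" by (auto simp: rational_boxes_def)
  define l u where "l = (\<Sum>i\<in>Basis. max (a \<bullet> i) (c \<bullet> i) *\<^sub>R i)" and "u = (\<Sum>i\<in>Basis. min (b \<bullet> i) (d \<bullet> i) *\<^sub>R i)"
  have "A \<inter> B = box l u" unfolding *(1,2) by (auto simp: box_def l_def u_def)
  moreover have "l \<in> rational_points" "u \<in> rational_points"
    using *(3-6) by (auto simp: l_def u_def rational_points_def max_def min_def)
  ultimately show "A \<inter> B \<in> rational_boxes" by (auto simp: rational_boxes_def)
qed

lemma borel_eq_rational_boxes: "sets borel = sigma_sets UNIV (rational_boxes :: 'a::euclidean_space set set)"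
proof -
  have "sets (borel :: 'a measure) = sigma_sets UNIV {S. open S}" by (rule sets_borel)
  also have "\<dots> = sigma_sets UNIV rational_boxes"
  proof (rule sigma_sets_eqI)
    fix S :: "'a set" assume "S \<in> {S. open S}"
    then have S: "open S" by simp
    let ?B = "{B \<in> rational_boxes. B \<subseteq> S}"
    have "x \<in> \<Union>?B" if x: "x \<in> S" for x
    proof -
      obtain e where e: "e > 0" "ball x e \<subseteq> S" using S x open_contains_ball by blast
      obtain a b where "\<forall>i\<in>Basis. a \<bullet> i \<in> \<rat> \<and> b \<bullet> i \<in> \<rat>" "x \<in> box a b" "box a b \<subseteq> ball x e"
        using rational_boxes[OF e(1)] by blast
      then have "box a b \<in> ?B" using e by (auto simp: rational_boxes_def rational_points_def)
      then show ?thesis using \<open>x \<in> box a b\<close> by blast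
    qed
    then have "S = \<Union>?B" by blast
    also have "\<dots> \<in> sigma_sets UNIV rational_boxes"
      by (rule sigma_sets_UNION) (auto intro: countable_subset[OF _ countable_rational_boxes])
    finally show "S \<in> sigma_sets UNIV rational_boxes" .
  next
    fix B :: "'a set" assume "B \<in> rational_boxes"
    then have "open B" by (auto simp: rational_boxes_def)
    then show "B \<in> sigma_sets UNIV {S. open S}" by auto
  qed
  finally show ?thesis .
qed

text \<open>Continuous functions increasing to the indicator function of a bounded open set \<open>B\<close>. Boundedness
  keeps the complement nonempty; the distance to the empty set is 0 by convention.\<close>

definition box_cutoff :: "'a::euclidean_space set \<Rightarrow> nat \<Rightarrow> 'a \<Rightarrow> real" where
  "box_cutoff B m x = min 1 (real m * infdist x (- B))"

lemma continuous_box_cutoff: "continuous_on S (box_cutoff B m)"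
  unfolding box_cutoff_def[abs_def] by (intro continuous_intros)

lemma measurable_box_cutoff [measurable]: "box_cutoff B m \<in> borel_measurable borel"
  by (intro borel_measurable_continuous_onI continuous_box_cutoff)

lemma box_cutoff_bounds: "0 \<le> box_cutoff B m x" "box_cutoff B m x \<le> 1" "\<bar>box_cutoff B m x\<bar> \<le> 1"
  by (auto simp: box_cutoff_def infdist_nonneg)

lemma box_cutoff_tendsto:
  fixes B :: "'a::euclidean_space set"
  assumes "B \<in> rational_boxes"
  shows "(\<lambda>m. box_cutoff B m x) \<longlonglongrightarrow> indicator B x"
proof (cases "x \<in> B")
  case True
  have B: "open B" "bounded B" using assms by (auto simp: rational_boxes_def)
  then have "- B \<noteq> {}" using not_bounded_UNIV by (metis Compl_UNIV_eq double_complement)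
  then have d: "infdist x (- B) > 0"
    using B True by (intro infdist_pos_not_in_closed) auto
  obtain n where n: "1 / infdist x (- B) < real n" using reals_Archimedean2 by blast
  have "box_cutoff B m x = 1" if "m \<ge> n" for m
  proof -
    have "1 / infdist x (- B) < real m" using n that by (meson less_le_trans of_nat_le_iff)
    then show ?thesis using d by (simp add: box_cutoff_def field_simps min_def)
  qed
  then have "\<forall>\<^sub>F m in sequentially. box_cutoff B m x = indicator B x"
    using True by (auto simp: eventually_sequentially)
  then show ?thesis by (rule tendsto_eventually)
qed (simp add: box_cutoff_def)

lemma measure_eqI_box_cutoffs:
  fixes M N :: "'a::euclidean_space measure"
  assumes "finite_measure M" "finite_measure N" and sets: "sets M = sets borel" "sets N = sets borel"
    and eq: "\<And>B m. B \<in> rational_boxes \<Longrightarrow> (\<integral>x. box_cutoff B m x \<partial>M) = (\<integral>x. box_cutoff B m x \<partial>N)"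
  shows "M = N"
proof -
  interpret M: finite_measure M by fact
  interpret N: finite_measure N by fact
  have lim: "(\<lambda>m. \<integral>x. box_cutoff B m x \<partial>L) \<longlonglongrightarrow> measure L B"
    if B: "B \<in> rational_boxes" and L: "finite_measure L" "sets L = sets borel" for B :: "'a set" and L
  proof -
    interpret L: finite_measure L by fact
    have [measurable]: "box_cutoff B m \<in> borel_measurable L" for m
      using L(2) by (simp cong: measurable_cong_sets)
    have "B \<in> sets L" using B L(2) borel_eq_rational_boxes by auto
    then have "(\<integral>x. indicator B x \<partial>L) = measure L B" by simp
    moreover have "(\<lambda>m. \<integral>x. box_cutoff B m x \<partial>L) \<longlonglongrightarrow> (\<integral>x. indicator B x \<partial>L)"
      by (rule integral_dominated_convergence[where w = "\<lambda>_. 1"])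
        (use \<open>B \<in> sets L\<close> in \<open>auto intro!: AE_I2 box_cutoff_tendsto[OF B] simp: box_cutoff_bounds\<close>)
    ultimately show ?thesis by simp
  qed
  have UN: "(\<Union>n. box (- real n *\<^sub>R One) (real n *\<^sub>R One)) = (UNIV :: 'a set)"
    using UN_box_eq_UNIV by simp
  show ?thesis
  proof (rule measure_eqI_generator_eq[OF Int_stable_rational_boxes _ _ _ _ _ UN])
    show "emeasure M B = emeasure N B" if B: "B \<in> rational_boxes" for B
    proof -
      have "measure M B = measure N B"
        using lim[OF B assms(1) sets(1)] lim[OF B assms(2) sets(2)] eq[OF B] by (simp add: LIMSEQ_unique)
      then show ?thesis by (simp add: M.emeasure_eq_measure N.emeasure_eq_measure)
    qed
    show "range (\<lambda>n. box (- real n *\<^sub>R One) (real n *\<^sub>R One)) \<subseteq> (rational_boxes :: 'a set set)"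
      by (auto simp: rational_boxes_def rational_points_def intro!: image_eqI[where x = "(_, _)"])
  qed (auto simp: sets borel_eq_rational_boxes)
qed

text \<open>The positive and the negative part of \<open>U\<close> are densities whose images under \<open>X\<close> are finite measures
  with the same integrals of cutoffs, hence equal.\<close>

lemma martingale_condition_box_cutoffs:
  fixes U :: "'w \<Rightarrow> real" and X :: "'w \<Rightarrow> 'a::euclidean_space"
  assumes [measurable]: "X \<in> borel_measurable M" and U: "integrable M U"
    and eq: "\<And>B m. B \<in> rational_boxes \<Longrightarrow> (\<integral>\<omega>. box_cutoff B m (X \<omega>) * U \<omega> \<partial>M) = 0"
    and g: "bounded_borel g"
  shows "(\<integral>\<omega>. g (X \<omega>) * U \<omega> \<partial>M) = 0"
proof -
  have [measurable]: "U \<in> borel_measurable M" using U by auto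
  define part where "part s = distr (density M (\<lambda>\<omega>. ennreal (max 0 (s * U \<omega>)))) borel X" for s :: real
  have Us: "integrable M (\<lambda>\<omega>. max 0 (s * U \<omega>))" for s using U by auto
  have fin: "finite_measure (part s)" for s
  proof -
    have "emeasure (density M (\<lambda>\<omega>. ennreal (max 0 (s * U \<omega>)))) (space M) = (\<integral>\<^sup>+\<omega>. ennreal (max 0 (s * U \<omega>)) \<partial>M)"
      by (subst emeasure_density) (auto intro!: nn_integral_cong)
    also have "\<dots> = ennreal (\<integral>\<omega>. max 0 (s * U \<omega>) \<partial>M)" by (intro nn_integral_eq_integral Us) auto
    finally have "finite_measure (density M (\<lambda>\<omega>. ennreal (max 0 (s * U \<omega>))))"
      by (intro finite_measureI) simp
    then show ?thesis unfolding part_def by (rule finite_measure.finite_measure_distr) simp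
  qed
  have int: "(\<integral>x. f x \<partial>part s) = (\<integral>\<omega>. f (X \<omega>) * max 0 (s * U \<omega>) \<partial>M)"
    if [measurable]: "f \<in> borel_measurable borel" for f :: "'a \<Rightarrow> real" and s
  proof -
    have "(\<integral>x. f x \<partial>part s) = (\<integral>\<omega>. f (X \<omega>) \<partial>density M (\<lambda>\<omega>. ennreal (max 0 (s * U \<omega>))))"
      unfolding part_def by (rule integral_distr) measurable
    also have "\<dots> = (\<integral>\<omega>. max 0 (s * U \<omega>) *\<^sub>R f (X \<omega>) \<partial>M)"
      by (rule integral_density) auto
    finally show ?thesis by (simp add: mult.commute)
  qed
  have split: "(\<integral>\<omega>. f (X \<omega>) * U \<omega> \<partial>M) = (\<integral>x. f x \<partial>part 1) - (\<integral>x. f x \<partial>part (- 1))"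
    if [measurable]: "f \<in> borel_measurable borel" and b: "\<And>x. \<bar>f x\<bar> \<le> C" for f :: "'a \<Rightarrow> real" and C
  proof -
    have i: "integrable M (\<lambda>\<omega>. f (X \<omega>) * max 0 (s * U \<omega>))" for s
    proof (rule Bochner_Integration.integrable_bound)
      show "integrable M (\<lambda>\<omega>. C * max 0 (s * U \<omega>))" using Us by simp
      have "\<bar>f x * max 0 r\<bar> \<le> \<bar>C * max 0 r\<bar>" for x r
        using b[of x] by (auto simp: abs_mult max_def intro!: mult_right_mono)
      then show "AE \<omega> in M. norm (f (X \<omega>) * max 0 (s * U \<omega>)) \<le> norm (C * max 0 (s * U \<omega>))" by simp
    qed simp
    have "f (X \<omega>) * U \<omega> = f (X \<omega>) * max 0 (1 * U \<omega>) - f (X \<omega>) * max 0 (- 1 * U \<omega>)" for \<omega>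
      by (auto simp: max_def)
    then show ?thesis unfolding int[OF that(1)] by (simp only: Bochner_Integration.integral_diff[OF i i])
  qed
  have "part 1 = part (- 1)"
  proof (rule measure_eqI_box_cutoffs[OF fin fin])
    show "(\<integral>x. box_cutoff B m x \<partial>part 1) = (\<integral>x. box_cutoff B m x \<partial>part (- 1))" if "B \<in> rational_boxes" for B m
      using split[OF measurable_box_cutoff box_cutoff_bounds(3), of B m] eq[OF that, of m] by simp
  qed (simp_all add: part_def)
  moreover obtain C where "\<And>x. \<bar>g x\<bar> \<le> C" using g by (auto simp: bounded_borel_def bounded_iff)
  ultimately show ?thesis using split[of g C] g by (simp add: bounded_borel_def)
qed

section \<open>Convergence of integrals of functions of linear growth\<close>

text \<open>Truncation at height \<open>R\<close> changes \<open>F\<close> by at most \<open>F\<^sup>2 / R\<close>.\<close>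

lemma integral_truncation_error:
  fixes F :: "'b::euclidean_space \<Rightarrow> real"
  assumes "prob_space \<pi>" "sets \<pi> = sets borel" "integrable \<pi> (\<lambda>v. (norm v)\<^sup>2)" "(\<integral>v. (norm v)\<^sup>2 \<partial>\<pi>) \<le> B"
    and [measurable]: "F \<in> borel_measurable borel" and F: "\<And>v. \<bar>F v\<bar> \<le> L * (1 + norm v)" and R: "R > 0"
  shows "\<bar>(\<integral>v. F v \<partial>\<pi>) - (\<integral>v. max (- R) (min R (F v)) \<partial>\<pi>)\<bar> \<le> 2 * L\<^sup>2 * (1 + B) / R"
proof -
  interpret prob_space \<pi> by fact
  have [measurable]: "F \<in> borel_measurable \<pi>" "norm \<in> borel_measurable \<pi>" using assms(2) by (simp_all cong: measurable_cong_sets)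
  have L0: "L \<ge> 0" using F[of 0] by simp
  have sq: "(F v)\<^sup>2 \<le> 2 * L\<^sup>2 * (1 + (norm v)\<^sup>2)" for v
  proof -
    have "(F v)\<^sup>2 \<le> (L * (1 + norm v))\<^sup>2" using F[of v] L0 by (intro abs_le_square_iff[THEN iffD1]) auto
    also have "\<dots> = L\<^sup>2 * (1 + norm v)\<^sup>2" by (simp add: power_mult_distrib)
    also have "\<dots> \<le> L\<^sup>2 * (2 * (1 + (norm v)\<^sup>2))"
      using sum_squares_ge_zero[of "1 - norm v" 0]
      by (intro mult_left_mono) (auto simp: power2_eq_square algebra_simps)
    finally show ?thesis by (simp add: algebra_simps)
  qed
  have F2: "integrable \<pi> (\<lambda>v. (F v)\<^sup>2)"
    by (rule integrable_quadratic_growth[OF _ assms(3), of _ "2 * L\<^sup>2"]) (use sq in simp_all)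
  then have F1: "integrable \<pi> F" by (simp add: integrable_of_square)
  have FR: "integrable \<pi> (\<lambda>v. max (- R) (min R (F v)))"
    using R by (intro integrable_const_bound[where B = R]) auto
  have "\<bar>(\<integral>v. F v \<partial>\<pi>) - (\<integral>v. max (- R) (min R (F v)) \<partial>\<pi>)\<bar> \<le> (\<integral>v. \<bar>F v - max (- R) (min R (F v))\<bar> \<partial>\<pi>)"
    using F1 FR integral_abs_bound[of \<pi> "\<lambda>v. F v - max (- R) (min R (F v))"] by simp
  also have "\<dots> \<le> (\<integral>v. (F v)\<^sup>2 / R \<partial>\<pi>)"
  proof (rule integral_mono)
    show "\<bar>F v - max (- R) (min R (F v))\<bar> \<le> (F v)\<^sup>2 / R" for v
    proof -
      have "\<bar>F v - max (- R) (min R (F v))\<bar> * R \<le> (F v)\<^sup>2"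
      proof (cases "\<bar>F v\<bar> \<le> R")
        case False
        then have "\<bar>F v - max (- R) (min R (F v))\<bar> \<le> \<bar>F v\<bar>" using R by (auto simp: max_def min_def)
        then have "\<bar>F v - max (- R) (min R (F v))\<bar> * R \<le> \<bar>F v\<bar> * \<bar>F v\<bar>"
          using False R by (intro mult_mono) auto
        then show ?thesis by (simp add: power2_eq_square)
      qed (use R in \<open>auto simp: max_def min_def\<close>)
      then show ?thesis using R by (simp add: pos_le_divide_eq)
    qed
  qed (use F1 FR F2 in auto)
  also have "\<dots> = (\<integral>v. (F v)\<^sup>2 \<partial>\<pi>) / R" by simp
  also have "\<dots> \<le> (2 * L\<^sup>2 * (1 + B)) / R"
  proof (rule divide_right_mono)
    have "(\<integral>v. (F v)\<^sup>2 \<partial>\<pi>) \<le> (\<integral>v. 2 * L\<^sup>2 * (1 + (norm v)\<^sup>2) \<partial>\<pi>)"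
      using F2 assms(3) by (intro integral_mono sq) auto
    also have "\<dots> = 2 * L\<^sup>2 * (1 + (\<integral>v. (norm v)\<^sup>2 \<partial>\<pi>))" using assms(3) by (simp add: prob_space)
    also have "\<dots> \<le> 2 * L\<^sup>2 * (1 + B)" using assms(4) by (intro mult_left_mono) auto
    finally show "(\<integral>v. (F v)\<^sup>2 \<partial>\<pi>) \<le> 2 * L\<^sup>2 * (1 + B)" .
  qed (use R in simp)
  finally show ?thesis .
qed

lemma weak_convergence_linear_growth:
  fixes F :: "'b::euclidean_space \<Rightarrow> real"
  assumes \<pi>: "\<And>k. prob_space (\<pi> k)" "\<And>k. sets (\<pi> k) = sets borel" "\<And>k. integrable (\<pi> k) (\<lambda>v. (norm v)\<^sup>2)"
      "\<And>k. (\<integral>v. (norm v)\<^sup>2 \<partial>\<pi> k) \<le> B"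
    and \<rho>: "prob_space \<rho>" "sets \<rho> = sets borel" "integrable \<rho> (\<lambda>v. (norm v)\<^sup>2)"
    and conv: "\<And>F :: 'b \<Rightarrow> real. continuous_on UNIV F \<Longrightarrow> bounded (range F) \<Longrightarrow>
      (\<lambda>k. \<integral>v. F v \<partial>\<pi> k) \<longlonglongrightarrow> (\<integral>v. F v \<partial>\<rho>)"
    and F: "continuous_on UNIV F" "\<And>v. \<bar>F v\<bar> \<le> L * (1 + norm v)"
  shows "(\<lambda>k. \<integral>v. F v \<partial>\<pi> k) \<longlonglongrightarrow> (\<integral>v. F v \<partial>\<rho>)"
proof (rule LIMSEQ_I)
  fix e :: real assume e: "e > 0"
  have [measurable]: "F \<in> borel_measurable borel" by (intro borel_measurable_continuous_onI F)
  define B' where "B' = max B (\<integral>v. (norm v)\<^sup>2 \<partial>\<rho>)"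
  have "B' \<ge> 0" unfolding B'_def by (intro max.coboundedI2) simp
  define K where "K = 2 * L\<^sup>2 * (1 + B')"
  have "K \<ge> 0" using \<open>B' \<ge> 0\<close> by (simp add: K_def)
  define R where "R = 3 * (K + 1) / e"
  have R: "R > 0" using e \<open>K \<ge> 0\<close> by (simp add: R_def)
  have KR: "K / R < e / 3" using e \<open>K \<ge> 0\<close> by (simp add: R_def field_simps)
  define FR where "FR v = max (- R) (min R (F v))" for v
  have "continuous_on UNIV FR" unfolding FR_def by (intro continuous_intros F)
  moreover have "bounded (range FR)" unfolding FR_def using R by (intro boundedI[where B = R]) auto
  ultimately have "(\<lambda>k. \<integral>v. FR v \<partial>\<pi> k) \<longlonglongrightarrow> (\<integral>v. FR v \<partial>\<rho>)" by (rule conv)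
  then obtain N where N: "\<And>k. k \<ge> N \<Longrightarrow> \<bar>(\<integral>v. FR v \<partial>\<pi> k) - (\<integral>v. FR v \<partial>\<rho>)\<bar> < e / 3"
    using e LIMSEQ_D[of _ _ "e / 3"] by (metis real_norm_def zero_less_divide_iff zero_less_numeral)
  have 1: "\<bar>(\<integral>v. F v \<partial>\<pi> k) - (\<integral>v. FR v \<partial>\<pi> k)\<bar> \<le> K / R" for k
    unfolding FR_def K_def using \<pi>(4)[of k]
    by (intro integral_truncation_error \<pi> F R) (auto simp: B'_def)
  have 2: "\<bar>(\<integral>v. F v \<partial>\<rho>) - (\<integral>v. FR v \<partial>\<rho>)\<bar> \<le> K / R"
    unfolding FR_def K_def by (intro integral_truncation_error \<rho> F R) (auto simp: B'_def)
  have "norm ((\<integral>v. F v \<partial>\<pi> k) - (\<integral>v. F v \<partial>\<rho>)) < e" if "k \<ge> N" for k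
    using 1[of k] 2 N[OF that] KR unfolding real_norm_def by linarith
  then show "\<exists>N. \<forall>k\<ge>N. norm ((\<integral>v. F v \<partial>\<pi> k) - (\<integral>v. F v \<partial>\<rho>)) < e" by blast
qed

section \<open>Couplings and their martingale conditions\<close>

lemma borel_measurable_projections:
  "fst \<in> borel_measurable (borel :: ('a::euclidean_space \<times> 'b::euclidean_space) measure)"
  "snd \<in> borel_measurable (borel :: ('a::euclidean_space \<times> 'b::euclidean_space) measure)"
  by (intro borel_measurable_continuous_onI continuous_intros)+

lemma distr_L2:
  fixes X :: "'w \<Rightarrow> 'a::euclidean_space"
  assumes \<mu>: "\<mu> \<in> finite_moment_prob 2" and X: "X \<in> borel_measurable M" "distr M borel X = \<mu>"
  shows "integrable M (\<lambda>\<omega>. (norm (X \<omega>))\<^sup>2)"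
proof -
  have "integrable (distr M borel X) (\<lambda>x. (norm x)\<^sup>2)" using finite_moment_2D(3)[OF \<mu>] X(2) by simp
  then show ?thesis using X(1) by (subst (asm) integrable_distr_eq) auto
qed

lemma integrable_bounded_borel_scaleR:
  fixes X :: "'w \<Rightarrow> 'a::euclidean_space" and U :: "'w \<Rightarrow> 'b::euclidean_space"
  assumes [measurable]: "X \<in> borel_measurable M" and U: "integrable M U" and g: "bounded_borel g"
  shows "integrable M (\<lambda>\<omega>. g (X \<omega>) *\<^sub>R U \<omega>)"
proof -
  have [measurable]: "g \<in> borel_measurable borel" using g by (simp add: bounded_borel_def)
  obtain C where C: "\<And>x. \<bar>g x\<bar> \<le> C" using g by (auto simp: bounded_borel_def bounded_iff)
  show ?thesis
  proof (rule Bochner_Integration.integrable_bound)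
    show "integrable M (\<lambda>\<omega>. C * norm (U \<omega>))" using U by simp
    have "norm (g (X \<omega>) *\<^sub>R U \<omega>) \<le> norm (C * norm (U \<omega>))" for \<omega>
    proof -
      have "\<bar>g (X \<omega>)\<bar> * norm (U \<omega>) \<le> C * norm (U \<omega>)" by (intro mult_right_mono C) simp
      then show ?thesis by simp
    qed
    then show "AE \<omega> in M. norm (g (X \<omega>) *\<^sub>R U \<omega>) \<le> norm (C * norm (U \<omega>))" by simp
  qed (use U in simp)
qed

lemma martingale_condition_from_cutoffs:
  fixes X :: "'w \<Rightarrow> 'a::euclidean_space" and U :: "'w \<Rightarrow> 'b::euclidean_space"
  assumes X: "X \<in> borel_measurable M" and U: "integrable M U"
    and eq: "\<And>B m b. B \<in> rational_boxes \<Longrightarrow> b \<in> Basis \<Longrightarrow> (\<integral>\<omega>. box_cutoff B m (X \<omega>) * (U \<omega> \<bullet> b) \<partial>M) = 0"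
    and g: "bounded_borel g"
  shows "(\<integral>\<omega>. g (X \<omega>) *\<^sub>R U \<omega> \<partial>M) = 0"
proof (rule euclidean_eqI)
  fix b :: 'b assume b: "b \<in> Basis"
  have "(\<integral>\<omega>. g (X \<omega>) *\<^sub>R U \<omega> \<partial>M) \<bullet> b = (\<integral>\<omega>. g (X \<omega>) * (U \<omega> \<bullet> b) \<partial>M)"
    using integral_inner_left[OF integrable_bounded_borel_scaleR[OF X U g], of b] by simp
  also have "\<dots> = 0"
    by (rule martingale_condition_box_cutoffs[OF X _ _ g]) (use U eq b in auto)
  finally show "(\<integral>\<omega>. g (X \<omega>) *\<^sub>R U \<omega> \<partial>M) \<bullet> b = 0 \<bullet> b" by simp
qed

lemma couplingsD:
  assumes "\<pi> \<in> couplings \<mu> \<nu>"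
  shows "prob_space \<pi>" "sets \<pi> = sets borel" "distr \<pi> borel fst = \<mu>" "distr \<pi> borel snd = \<nu>"
    "fst \<in> borel_measurable \<pi>" "snd \<in> borel_measurable \<pi>"
proof -
  show "prob_space \<pi>" and s: "sets \<pi> = sets borel" and "distr \<pi> borel fst = \<mu>" "distr \<pi> borel snd = \<nu>"
    using assms by (auto simp: couplings_def borel_prob_def)
  show "fst \<in> borel_measurable \<pi>" "snd \<in> borel_measurable \<pi>"
    using borel_measurable_projections s by (simp_all cong: measurable_cong_sets)
qed

context orth_decomp
begin

lemma integrable_P: "integrable M X \<Longrightarrow> integrable M (\<lambda>\<omega>. P (X \<omega>))"
  and integrable_Q: "integrable M X \<Longrightarrow> integrable M (\<lambda>\<omega>. Q (X \<omega>))"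
  using bounded_linear_P bounded_linear_Q by (auto intro: integrable_bounded_linear)

lemma bimartingale_couplings_wrt_iff:
  assumes \<mu>: "\<mu> \<in> finite_moment_prob 2" and \<nu>: "\<nu> \<in> finite_moment_prob 2"
  shows "\<pi> \<in> bimartingale_couplings_wrt \<mu> \<nu> V W \<longleftrightarrow> \<pi> \<in> couplings \<mu> \<nu> \<and>
    (\<forall>g. bounded_borel g \<longrightarrow> (\<integral>v. g (fst v) *\<^sub>R (P (snd v) - P (fst v)) \<partial>\<pi>) = 0) \<and>
    (\<forall>h. bounded_borel h \<longrightarrow> (\<integral>v. h (snd v) *\<^sub>R (Q (fst v) - Q (snd v)) \<partial>\<pi>) = 0)"
proof (cases "\<pi> \<in> couplings \<mu> \<nu>")
  case True
  note \<pi> = couplingsD[OF True]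
  interpret prob_space \<pi> by (rule \<pi>)
  have int: "integrable \<pi> fst" "integrable \<pi> snd"
    using distr_L2[OF \<mu> \<pi>(5,3)] distr_L2[OF \<nu> \<pi>(6,4)] \<pi>(5,6) by (simp_all add: integrable_of_square)
  have 1: "(\<integral>v. g (fst v) *\<^sub>R (P (snd v) - P (fst v)) \<partial>\<pi>) =
      (\<integral>v. g (fst v) *\<^sub>R P (snd v) \<partial>\<pi>) - (\<integral>v. g (fst v) *\<^sub>R P (fst v) \<partial>\<pi>)" if "bounded_borel g" for g
    unfolding scaleR_diff_right
    by (intro Bochner_Integration.integral_diff integrable_bounded_borel_scaleR \<pi> that integrable_P int)
  have 2: "(\<integral>v. g (snd v) *\<^sub>R (Q (fst v) - Q (snd v)) \<partial>\<pi>) =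
      (\<integral>v. g (snd v) *\<^sub>R Q (fst v) \<partial>\<pi>) - (\<integral>v. g (snd v) *\<^sub>R Q (snd v) \<partial>\<pi>)" if "bounded_borel g" for g
    unfolding scaleR_diff_right
    by (intro Bochner_Integration.integral_diff integrable_bounded_borel_scaleR \<pi> that integrable_Q int)
  have "bounded_borel (\<lambda>x :: 'a. 0)" by (simp add: bounded_borel_def)
  then show ?thesis
    using True 1 2 by (auto simp: bimartingale_couplings_wrt_def case_prod_unfold)
next
  case False
  then show ?thesis by (simp add: bimartingale_couplings_wrt_def)
qed

section \<open>Bimartingale couplings imply the convex-concave order\<close>

text \<open>For a bimartingale pair \<open>(x, y)\<close> the point \<open>P y + Q x\<close> has conditional mean \<open>x\<close> along \<open>V\<close> given \<open>x\<close>, and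
  conditional mean \<open>y\<close> along \<open>W\<close> given \<open>y\<close>; Jensen's inequality is applied on either side of it.\<close>

lemma bimartingale_imp_cc_order:
  assumes \<mu>: "\<mu> \<in> finite_moment_prob 2" and \<nu>: "\<nu> \<in> finite_moment_prob 2"
    and bm: "\<pi> \<in> bimartingale_couplings_wrt \<mu> \<nu> V W"
  shows "cc_order_wrt V W \<mu> \<nu>"
  unfolding cc_order_wrt_def
proof (intro allI impI, elim conjE)
  fix f :: "'a \<Rightarrow> real" assume f: "convex_concave V W f" "quadratic_growth f"
  have \<pi>c: "\<pi> \<in> couplings \<mu> \<nu>"
    and m1: "\<And>g. bounded_borel g \<Longrightarrow> (\<integral>v. g (fst v) *\<^sub>R (P (snd v) - P (fst v)) \<partial>\<pi>) = 0"
    and m2: "\<And>h. bounded_borel h \<Longrightarrow> (\<integral>v. h (snd v) *\<^sub>R (Q (fst v) - Q (snd v)) \<partial>\<pi>) = 0"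
    using bm unfolding bimartingale_couplings_wrt_iff[OF \<mu> \<nu>] by auto
  note \<pi> = couplingsD[OF \<pi>c]
  note L2 = distr_L2[OF \<mu> \<pi>(5,3)] distr_L2[OF \<nu> \<pi>(6,4)]
  have fm: "f \<in> borel_measurable borel"
    by (intro borel_measurable_continuous_onI convex_concave_continuous f)
  interpret s: orth_decomp W V by (rule swap)
  have "(\<integral>x. f x \<partial>\<mu>) = (\<integral>v. f (fst v) \<partial>\<pi>)"
    using integral_distr[OF \<pi>(5) fm] \<pi>(3) by simp
  also have "\<dots> \<le> (\<integral>v. f (P (snd v) + Q (fst v)) \<partial>\<pi>)"
    by (rule convex_concave_Jensen[OF \<pi>(1,5,6) L2 m1 f])
  also have "\<dots> \<le> (\<integral>v. f (snd v) \<partial>\<pi>)"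
  proof -
    have "quadratic_growth (\<lambda>x. - f x)" using f(2) by (simp add: quadratic_growth_def)
    then have "(\<integral>v. - f (snd v) \<partial>\<pi>) \<le> (\<integral>v. - f (Q (fst v) + P (snd v)) \<partial>\<pi>)"
      by (intro s.convex_concave_Jensen[OF \<pi>(1,6,5) L2(2,1) m2] convex_concave_swap f)
    then show ?thesis by (simp add: add.commute)
  qed
  also have "\<dots> = (\<integral>x. f x \<partial>\<nu>)"
    using integral_distr[OF \<pi>(6) fm] \<pi>(4) by simp
  finally show "(\<integral>x. f x \<partial>\<mu>) \<le> (\<integral>x. f x \<partial>\<nu>)" .
qed

section \<open>The convex-concave order yields a bimartingale coupling\<close>

lemma quadratic_growth_norm_sq: "quadratic_growth (\<lambda>x :: 'a. (norm x)\<^sup>2)"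
  unfolding quadratic_growth_def by (intro exI[of _ 1]) auto

lemma quadratic_growth_box_cutoff: "quadratic_growth (box_cutoff B m :: 'a \<Rightarrow> real)"
  by (rule quadratic_growth_between[OF quadratic_growth_const quadratic_growth_const box_cutoff_bounds(1,2)])

text \<open>Countably many tests that suffice to recognize a bimartingale coupling; the second moment among
  them provides tightness.\<close>

definition basic_tests :: "'a measure \<Rightarrow> 'a measure \<Rightarrow> ('a \<times> 'a \<Rightarrow> real) set" where
  "basic_tests \<mu> \<nu> =
    {\<lambda>v. ((norm (fst v))\<^sup>2 - (\<integral>x. (norm x)\<^sup>2 \<partial>\<mu>)) + ((norm (snd v))\<^sup>2 - (\<integral>y. (norm y)\<^sup>2 \<partial>\<nu>))} \<union>
    (\<lambda>(B, m) v. box_cutoff B m (fst v) - (\<integral>x. box_cutoff B m x \<partial>\<mu>)) ` (rational_boxes \<times> UNIV) \<union>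
    (\<lambda>(B, m) v. box_cutoff B m (snd v) - (\<integral>y. box_cutoff B m y \<partial>\<nu>)) ` (rational_boxes \<times> UNIV) \<union>
    (\<lambda>(B, m, b) v. box_cutoff B m (fst v) * ((P (snd v) - P (fst v)) \<bullet> b)) ` (rational_boxes \<times> UNIV \<times> Basis) \<union>
    (\<lambda>(B, m, b) v. box_cutoff B m (snd v) * ((Q (fst v) - Q (snd v)) \<bullet> b)) ` (rational_boxes \<times> UNIV \<times> Basis)"

lemma countable_basic_tests: "countable (basic_tests \<mu> \<nu>)"
  unfolding basic_tests_def
  by (intro countable_Un countable_image countable_SIGMA countable_rational_boxes) (auto intro: countable_finite)

lemma coupling_testsI:
  assumes "a \<in> borel_measurable borel" "b \<in> borel_measurable borel" "quadratic_growth a" "quadratic_growth b"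
    and "\<And>x y. t (x, y) = (a x - (\<integral>x. a x \<partial>\<mu>)) + (b y - (\<integral>y. b y \<partial>\<nu>)) + g x \<bullet> (P y - P x) + h y \<bullet> (Q x - Q y)"
  shows "t \<in> coupling_tests \<mu> \<nu>"
  unfolding coupling_tests_def
  by (intro CollectI exI[of _ a] exI[of _ b] exI[of _ g] exI[of _ h] conjI assms(1-4)) (auto simp: assms(5))

lemma basic_tests_subset: "basic_tests \<mu> \<nu> \<subseteq> coupling_tests \<mu> \<nu>"
proof
  fix t assume "t \<in> basic_tests \<mu> \<nu>"
  then consider
    "t = (\<lambda>v. ((norm (fst v))\<^sup>2 - (\<integral>x. (norm x)\<^sup>2 \<partial>\<mu>)) + ((norm (snd v))\<^sup>2 - (\<integral>y. (norm y)\<^sup>2 \<partial>\<nu>)))"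
    | B m where "t = (\<lambda>v. box_cutoff B m (fst v) - (\<integral>x. box_cutoff B m x \<partial>\<mu>))"
    | B m where "t = (\<lambda>v. box_cutoff B m (snd v) - (\<integral>y. box_cutoff B m y \<partial>\<nu>))"
    | B m b where "t = (\<lambda>v. box_cutoff B m (fst v) * ((P (snd v) - P (fst v)) \<bullet> b))"
    | B m b where "t = (\<lambda>v. box_cutoff B m (snd v) * ((Q (fst v) - Q (snd v)) \<bullet> b))"
    unfolding basic_tests_def by auto
  then show "t \<in> coupling_tests \<mu> \<nu>"
  proof cases
    case 1
    then show ?thesis
      by (intro coupling_testsI[where a = "\<lambda>x. (norm x)\<^sup>2" and b = "\<lambda>x. (norm x)\<^sup>2" and g = "\<lambda>_. 0" and h = "\<lambda>_. 0"]
          quadratic_growth_norm_sq) auto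
  next
    case 2
    then show ?thesis
      by (intro coupling_testsI[where a = "box_cutoff B m" and b = "\<lambda>x. 0" and g = "\<lambda>_. 0" and h = "\<lambda>_. 0"]
          quadratic_growth_box_cutoff quadratic_growth_const) auto
  next
    case 3
    then show ?thesis
      by (intro coupling_testsI[where b = "box_cutoff B m" and a = "\<lambda>x. 0" and g = "\<lambda>_. 0" and h = "\<lambda>_. 0"]
          quadratic_growth_box_cutoff quadratic_growth_const) auto
  next
    case 4
    then show ?thesis
      by (intro coupling_testsI[where b = "\<lambda>x. 0" and a = "\<lambda>x. 0" and g = "\<lambda>x. box_cutoff B m x *\<^sub>R b" and h = "\<lambda>_. 0"]
          quadratic_growth_const) (auto simp: inner_commute)
  next
    case 5
    then show ?thesis
      by (intro coupling_testsI[where b = "\<lambda>x. 0" and a = "\<lambda>x. 0" and h = "\<lambda>x. box_cutoff B m x *\<^sub>R b" and g = "\<lambda>_. 0"]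
          quadratic_growth_const) (auto simp: inner_commute)
  qed
qed

lemma approximate_coupling_sequence:
  assumes \<mu>: "\<mu> \<in> finite_moment_prob 2" and \<nu>: "\<nu> \<in> finite_moment_prob 2"
    and cc: "cc_order_wrt V W \<mu> \<nu>"
  obtains p :: "nat \<Rightarrow> ('a \<times> 'a) pmf" where "\<And>k. finite (set_pmf (p k))"
    "\<And>t. t \<in> basic_tests \<mu> \<nu> \<Longrightarrow> (\<lambda>k. measure_pmf.expectation (p k) t) \<longlonglongrightarrow> 0"
    "\<And>k. measure_pmf.expectation (p k) (\<lambda>v. (norm v)\<^sup>2) \<le> (\<integral>x. (norm x)\<^sup>2 \<partial>\<mu>) + (\<integral>y. (norm y)\<^sup>2 \<partial>\<nu>) + 1"
proof -
  define T where "T = from_nat_into (basic_tests \<mu> \<nu>)"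
  define t0 where "t0 v = ((norm (fst v))\<^sup>2 - (\<integral>x. (norm x)\<^sup>2 \<partial>\<mu>)) + ((norm (snd v))\<^sup>2 - (\<integral>y. (norm y)\<^sup>2 \<partial>\<nu>))" for v :: "'a \<times> 'a"
  have t0: "t0 \<in> basic_tests \<mu> \<nu>" unfolding basic_tests_def t0_def[abs_def] by blast
  have T: "T j \<in> basic_tests \<mu> \<nu>" for j unfolding T_def using t0 by (intro from_nat_into) auto
  have "\<exists>p. finite (set_pmf p) \<and> (\<forall>t\<in>insert t0 (T ` {..k}). \<bar>measure_pmf.expectation p t\<bar> < 1 / Suc k)" for k
  proof -
    have "finite (insert t0 (T ` {..k}))" "insert t0 (T ` {..k}) \<subseteq> coupling_tests \<mu> \<nu>" "1 / Suc k > (0 :: real)"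
      using t0 T basic_tests_subset by auto
    from approximate_coupling[OF \<mu> \<nu> cc this] show ?thesis by metis
  qed
  then obtain p where fin: "\<And>k. finite (set_pmf (p k))"
    and p: "\<And>k t. t \<in> insert t0 (T ` {..k}) \<Longrightarrow> \<bar>measure_pmf.expectation (p k) t\<bar> < 1 / Suc k"
    by metis
  have "(\<lambda>k. measure_pmf.expectation (p k) t) \<longlonglongrightarrow> 0" if t: "t \<in> basic_tests \<mu> \<nu>" for t
  proof -
    obtain j where j: "t = T j"
      unfolding T_def using from_nat_into_surj[OF countable_basic_tests t] by metis
    have "\<forall>\<^sub>F k in sequentially. norm (measure_pmf.expectation (p k) t) \<le> 1 / Suc k"
      unfolding eventually_sequentially using p j by (intro exI[of _ j]) (auto simp: less_imp_le)
    moreover have "(\<lambda>k. 1 / Suc k :: real) \<longlonglongrightarrow> 0"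
      using LIMSEQ_inverse_real_of_nat by (simp add: inverse_eq_divide)
    ultimately show ?thesis by (rule Lim_null_comparison)
  qed
  moreover have "measure_pmf.expectation (p k) (\<lambda>v. (norm v)\<^sup>2) \<le> (\<integral>x. (norm x)\<^sup>2 \<partial>\<mu>) + (\<integral>y. (norm y)\<^sup>2 \<partial>\<nu>) + 1" for k
  proof -
    have "(\<lambda>v. (norm v)\<^sup>2) = (\<lambda>v. t0 v + ((\<integral>x. (norm x)\<^sup>2 \<partial>\<mu>) + (\<integral>y. (norm y)\<^sup>2 \<partial>\<nu>)))"
      by (auto simp: t0_def norm_Pair fun_eq_iff)
    then have "measure_pmf.expectation (p k) (\<lambda>v. (norm v)\<^sup>2) =
        measure_pmf.expectation (p k) t0 + ((\<integral>x. (norm x)\<^sup>2 \<partial>\<mu>) + (\<integral>y. (norm y)\<^sup>2 \<partial>\<nu>))"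
      using fin by (simp add: integrable_measure_pmf_finite)
    moreover have "\<bar>measure_pmf.expectation (p k) t0\<bar> < 1 / Suc k" by (rule p) simp
    moreover have "1 / real (Suc k) \<le> 1" by simp
    ultimately show ?thesis by linarith
  qed
  ultimately show ?thesis using that[of p] fin by blast
qed

text \<open>A weak limit of the approximate couplings is a bimartingale coupling: the bounded tests pass to the
  limit directly and identify the marginals, and the martingale tests, which grow linearly, pass to the
  limit by the uniform bound on second moments.\<close>

lemma cc_order_imp_bimartingale:
  assumes \<mu>: "\<mu> \<in> finite_moment_prob 2" and \<nu>: "\<nu> \<in> finite_moment_prob 2"
    and cc: "cc_order_wrt V W \<mu> \<nu>"
  shows "\<exists>\<pi>. \<pi> \<in> bimartingale_couplings_wrt \<mu> \<nu> V W"
proof -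
  obtain p :: "nat \<Rightarrow> ('a \<times> 'a) pmf" where fin: "\<And>k. finite (set_pmf (p k))"
    and test: "\<And>t. t \<in> basic_tests \<mu> \<nu> \<Longrightarrow> (\<lambda>k. measure_pmf.expectation (p k) t) \<longlonglongrightarrow> 0"
    and mom: "\<And>k. measure_pmf.expectation (p k) (\<lambda>v. (norm v)\<^sup>2) \<le> (\<integral>x. (norm x)\<^sup>2 \<partial>\<mu>) + (\<integral>y. (norm y)\<^sup>2 \<partial>\<nu>) + 1"
    using approximate_coupling_sequence[OF assms] by metis
  define \<pi> where "\<pi> k = distr (measure_pmf (p k)) borel (\<lambda>v. v)" for k
  have \<pi>p: "prob_space (\<pi> k)" for k unfolding \<pi>_def by (intro measure_pmf.prob_space_distr) simp
  have \<pi>s: "sets (\<pi> k) = sets borel" for k by (simp add: \<pi>_def)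
  have int\<pi>: "(\<integral>v. F v \<partial>\<pi> k) = measure_pmf.expectation (p k) F" if "F \<in> borel_measurable borel" for F :: "'a \<times> 'a \<Rightarrow> real" and k
    unfolding \<pi>_def by (rule integral_distr) (use that in auto)
  have \<pi>2: "integrable (\<pi> k) (\<lambda>v. (norm v)\<^sup>2)" for k
    unfolding \<pi>_def by (subst integrable_distr_eq) (auto simp: fin integrable_measure_pmf_finite)
  have \<pi>m: "(\<integral>v. (norm v)\<^sup>2 \<partial>\<pi> k) \<le> (\<integral>x. (norm x)\<^sup>2 \<partial>\<mu>) + (\<integral>y. (norm y)\<^sup>2 \<partial>\<nu>) + 1" for k
    using mom[of k] by (subst int\<pi>) auto
  obtain r :: "nat \<Rightarrow> nat" and \<rho> where r: "strict_mono r" and \<rho>p: "prob_space \<rho>" and \<rho>s: "sets \<rho> = sets borel"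
    and conv: "\<And>F :: 'a \<times> 'a \<Rightarrow> real. continuous_on UNIV F \<Longrightarrow> bounded (range F) \<Longrightarrow>
      (\<lambda>k. \<integral>v. F v \<partial>\<pi> (r k)) \<longlonglongrightarrow> (\<integral>v. F v \<partial>\<rho>)"
    by (rule weakly_convergent_subsequence[OF \<pi>p \<pi>s \<pi>2 \<pi>m]) (rule that)
  have test': "(\<lambda>k. measure_pmf.expectation (p (r k)) t) \<longlonglongrightarrow> 0" if "t \<in> basic_tests \<mu> \<nu>" for t
    using LIMSEQ_subseq_LIMSEQ[OF test[OF that] r] by (simp add: comp_def)
  interpret prob_space \<rho> by (rule \<rho>p)
  have fst_m[measurable]: "fst \<in> borel_measurable \<rho>" and snd_m[measurable]: "snd \<in> borel_measurable \<rho>"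
    using borel_measurable_projections \<rho>s by (simp_all cong: measurable_cong_sets)
  have marginal: "distr \<rho> borel X = \<tau>"
    if \<tau>: "\<tau> \<in> finite_moment_prob 2" and X: "continuous_on UNIV X" "X \<in> borel_measurable \<rho>"
      and t: "\<And>B m. B \<in> rational_boxes \<Longrightarrow> (\<lambda>v. box_cutoff B m (X v) - (\<integral>x. box_cutoff B m x \<partial>\<tau>)) \<in> basic_tests \<mu> \<nu>"
    for X :: "'a \<times> 'a \<Rightarrow> 'a" and \<tau>
  proof (rule measure_eqI_box_cutoffs)
    interpret \<tau>: prob_space \<tau> by (rule finite_moment_2D[OF \<tau>])
    show "finite_measure (distr \<rho> borel X)" using X(2) by (intro finite_measure_distr)
    show "finite_measure \<tau>" by unfold_locales
    show "sets (distr \<rho> borel X) = sets borel" "sets \<tau> = sets borel" using finite_moment_2D(2)[OF \<tau>] by auto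
    fix B :: "'a set" and m assume B: "B \<in> rational_boxes"
    have cont: "continuous_on UNIV (\<lambda>v. box_cutoff B m (X v))"
      by (rule continuous_on_compose2[OF continuous_box_cutoff[of UNIV] X(1)]) auto
    have "(\<lambda>k. \<integral>v. box_cutoff B m (X v) \<partial>\<pi> (r k)) \<longlonglongrightarrow> (\<integral>v. box_cutoff B m (X v) \<partial>\<rho>)"
      by (rule conv[OF cont]) (auto intro!: boundedI[where B = 1] simp: box_cutoff_bounds)
    moreover have "(\<integral>v. box_cutoff B m (X v) \<partial>\<pi> (r k)) =
        measure_pmf.expectation (p (r k)) (\<lambda>v. box_cutoff B m (X v) - (\<integral>x. box_cutoff B m x \<partial>\<tau>)) + (\<integral>x. box_cutoff B m x \<partial>\<tau>)" for k
      by (subst int\<pi>[OF borel_measurable_continuous_onI[OF cont]])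
        (simp add: integrable_measure_pmf_finite fin)
    moreover have "(\<lambda>k. measure_pmf.expectation (p (r k)) (\<lambda>v. box_cutoff B m (X v) - (\<integral>x. box_cutoff B m x \<partial>\<tau>)) + (\<integral>x. box_cutoff B m x \<partial>\<tau>))
        \<longlonglongrightarrow> 0 + (\<integral>x. box_cutoff B m x \<partial>\<tau>)"
      by (intro tendsto_add test' t[OF B] tendsto_const)
    ultimately have "(\<integral>v. box_cutoff B m (X v) \<partial>\<rho>) = (\<integral>x. box_cutoff B m x \<partial>\<tau>)"
      by (simp add: LIMSEQ_unique)
    then show "(\<integral>x. box_cutoff B m x \<partial>distr \<rho> borel X) = (\<integral>x. box_cutoff B m x \<partial>\<tau>)"
      by (subst integral_distr[OF X(2)]) auto
  qed
  have m1: "distr \<rho> borel fst = \<mu>"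
    by (rule marginal[OF \<mu> _ fst_m]) (auto intro: continuous_intros simp: basic_tests_def)
  have m2: "distr \<rho> borel snd = \<nu>"
    by (rule marginal[OF \<nu> _ snd_m]) (auto intro: continuous_intros simp: basic_tests_def)
  have c\<rho>: "\<rho> \<in> couplings \<mu> \<nu>" using \<rho>p \<rho>s m1 m2 by (simp add: couplings_def borel_prob_def)
  have L2: "integrable \<rho> (\<lambda>v. (norm (fst v))\<^sup>2)" "integrable \<rho> (\<lambda>v. (norm (snd v))\<^sup>2)"
    by (rule distr_L2[OF \<mu> fst_m m1] distr_L2[OF \<nu> snd_m m2])+
  have L1: "integrable \<rho> fst" "integrable \<rho> snd" using L2 by (simp_all add: integrable_of_square)
  have \<rho>2: "integrable \<rho> (\<lambda>v. (norm v)\<^sup>2)"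
  proof -
    have "(\<lambda>v :: 'a \<times> 'a. (norm v)\<^sup>2) = (\<lambda>v. (norm (fst v))\<^sup>2 + (norm (snd v))\<^sup>2)"
      by (auto simp: norm_Pair fun_eq_iff)
    then show ?thesis using L2 by simp
  qed
  have mart: "(\<integral>v. g (X v) *\<^sub>R (R (Y v) - R (X v)) \<partial>\<rho>) = 0"
    if X: "continuous_on UNIV X" "X \<in> borel_measurable \<rho>" "integrable \<rho> X" "\<And>v. norm (X v) \<le> norm v"
      and Y: "continuous_on UNIV Y" "integrable \<rho> Y" "\<And>v. norm (Y v) \<le> norm v"
      and R: "bounded_linear R" "\<And>x. norm (R x) \<le> norm x"
      and t: "\<And>B m b. B \<in> rational_boxes \<Longrightarrow> b \<in> Basis \<Longrightarrow> (\<lambda>v. box_cutoff B m (X v) * ((R (Y v) - R (X v)) \<bullet> b)) \<in> basic_tests \<mu> \<nu>"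
      and g: "bounded_borel g"
    for X Y :: "'a \<times> 'a \<Rightarrow> 'a" and R :: "'a \<Rightarrow> 'a" and g
  proof (rule martingale_condition_from_cutoffs[OF X(2) _ _ g])
    show "integrable \<rho> (\<lambda>v. R (Y v) - R (X v))"
      by (rule Bochner_Integration.integrable_diff[OF integrable_bounded_linear[OF R(1) Y(2)] integrable_bounded_linear[OF R(1) X(3)]])
    fix B :: "'a set" and m b assume B: "B \<in> rational_boxes" and b: "b \<in> (Basis :: 'a set)"
    define F where "F v = box_cutoff B m (X v) * ((R (Y v) - R (X v)) \<bullet> b)" for v
    have cont: "continuous_on UNIV F"
      unfolding F_def
      by (intro continuous_intros continuous_on_compose2[OF continuous_box_cutoff[of UNIV] X(1)]
          bounded_linear.continuous_on[OF R(1)] X Y) auto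
    have bound: "\<bar>F v\<bar> \<le> 2 * (1 + norm v)" for v
    proof -
      have "\<bar>F v\<bar> \<le> 1 * \<bar>(R (Y v) - R (X v)) \<bullet> b\<bar>"
        unfolding F_def abs_mult by (intro mult_right_mono box_cutoff_bounds) simp
      also have "\<dots> \<le> norm (R (Y v) - R (X v))" using Basis_le_norm[OF b] by simp
      also have "\<dots> \<le> norm (R (Y v)) + norm (R (X v))" by (rule norm_triangle_ineq4)
      also have "\<dots> \<le> norm v + norm v"
        by (intro add_mono order.trans[OF R(2) X(4)] order.trans[OF R(2) Y(3)])
      also have "\<dots> \<le> 2 * (1 + norm v)" by simp
      finally show ?thesis .
    qed
    have "(\<lambda>k. \<integral>v. F v \<partial>\<pi> (r k)) \<longlonglongrightarrow> (\<integral>v. F v \<partial>\<rho>)"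
      by (rule weak_convergence_linear_growth[OF \<pi>p \<pi>s \<pi>2 \<pi>m \<rho>p \<rho>s \<rho>2 conv cont bound])
    moreover have "(\<lambda>k. \<integral>v. F v \<partial>\<pi> (r k)) \<longlonglongrightarrow> 0"
      using test'[OF t[OF B b]] unfolding int\<pi>[OF borel_measurable_continuous_onI[OF cont]]
      by (simp add: F_def[abs_def])
    ultimately have "(\<integral>v. F v \<partial>\<rho>) = 0" by (rule LIMSEQ_unique)
    then show "(\<integral>v. box_cutoff B m (X v) * ((R (Y v) - R (X v)) \<bullet> b) \<partial>\<rho>) = 0" by (simp add: F_def)
  qed
  have nf: "norm (fst v) \<le> norm v" and ns: "norm (snd v) \<le> norm v" for v :: "'a \<times> 'a"
    by (metis norm_fst_le surjective_pairing, metis norm_snd_le surjective_pairing)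
  have "(\<integral>v. g (fst v) *\<^sub>R (P (snd v) - P (fst v)) \<partial>\<rho>) = 0" if "bounded_borel g" for g
  proof (rule mart[OF _ fst_m L1(1) nf _ L1(2) ns bounded_linear_P norm_P_le _ that])
    show "(\<lambda>v. box_cutoff B m (fst v) * ((P (snd v) - P (fst v)) \<bullet> b)) \<in> basic_tests \<mu> \<nu>"
      if "B \<in> rational_boxes" "b \<in> Basis" for B m b
      unfolding basic_tests_def using that by (auto intro!: image_eqI[where x = "(B, m, b)"])
  qed (auto intro: continuous_intros)
  moreover have "(\<integral>v. g (snd v) *\<^sub>R (Q (fst v) - Q (snd v)) \<partial>\<rho>) = 0" if "bounded_borel g" for g
  proof (rule mart[OF _ snd_m L1(2) ns _ L1(1) nf bounded_linear_Q norm_Q_le _ that])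
    show "(\<lambda>v. box_cutoff B m (snd v) * ((Q (fst v) - Q (snd v)) \<bullet> b)) \<in> basic_tests \<mu> \<nu>"
      if "B \<in> rational_boxes" "b \<in> Basis" for B m b
      unfolding basic_tests_def using that by (auto intro!: image_eqI[where x = "(B, m, b)"])
  qed (auto intro: continuous_intros)
  ultimately show ?thesis
    using c\<rho> by (intro exI[of _ \<rho>]) (simp add: bimartingale_couplings_wrt_iff[OF \<mu> \<nu>])
qed

end

section \<open>The cost of a triple\<close>

lemma triplesD:
  fixes \<mu> :: "'a::euclidean_space measure"
  assumes "\<sigma> \<in> martingale_triples \<mu> \<nu>"
  shows "prob_space \<sigma>" "sets \<sigma> = sets borel"
    "fst \<in> borel_measurable \<sigma>" "(\<lambda>v. fst (snd v)) \<in> borel_measurable \<sigma>" "(\<lambda>v. snd (snd v)) \<in> borel_measurable \<sigma>"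
    "distr \<sigma> borel fst = \<mu>" "distr \<sigma> borel (\<lambda>v. fst (snd v)) = \<nu>"
    "integrable \<sigma> (\<lambda>v. snd (snd v))"
    "\<And>g. bounded_borel g \<Longrightarrow> (\<integral>v. g (fst v) *\<^sub>R (snd (snd v) - fst v) \<partial>\<sigma>) = 0"
    "\<And>h. bounded_borel h \<Longrightarrow> (\<integral>v. h (fst (snd v)) *\<^sub>R (snd (snd v) - fst (snd v)) \<partial>\<sigma>) = 0"
proof -
  show "prob_space \<sigma>" and s: "sets \<sigma> = sets borel"
    using assms by (auto simp: martingale_triples_def borel_prob_def)
  have "fst \<in> borel_measurable (borel :: ('a \<times> 'a \<times> 'a) measure)"
    "(\<lambda>v. fst (snd v)) \<in> borel_measurable (borel :: ('a \<times> 'a \<times> 'a) measure)"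
    "(\<lambda>v. snd (snd v)) \<in> borel_measurable (borel :: ('a \<times> 'a \<times> 'a) measure)"
    by (intro borel_measurable_continuous_onI continuous_intros)+
  then show m: "fst \<in> borel_measurable \<sigma>" "(\<lambda>v. fst (snd v)) \<in> borel_measurable \<sigma>" "(\<lambda>v. snd (snd v)) \<in> borel_measurable \<sigma>"
    using s by (simp_all cong: measurable_cong_sets)
  have eta: "(\<lambda>(x, y, z). x) = (fst :: 'a \<times> 'a \<times> 'a \<Rightarrow> 'a)" "(\<lambda>(x, y, z). y) = (\<lambda>v :: 'a \<times> 'a \<times> 'a. fst (snd v))"
    "(\<lambda>(x, y, z). z) = (\<lambda>v :: 'a \<times> 'a \<times> 'a. snd (snd v))" by auto
  have *: "distr \<sigma> borel fst = \<mu>" "distr \<sigma> borel (\<lambda>v. fst (snd v)) = \<nu>"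
     "distr \<sigma> borel (\<lambda>v. snd (snd v)) \<in> finite_moment_prob 1"
    using assms unfolding martingale_triples_def eta by auto
  then show "distr \<sigma> borel fst = \<mu>" "distr \<sigma> borel (\<lambda>v. fst (snd v)) = \<nu>" by auto
  have "(\<lambda>x :: 'a. norm x powr 1) = norm" by auto
  then have "integrable (distr \<sigma> borel (\<lambda>v. snd (snd v))) norm"
    using *(3) by (simp add: finite_moment_prob_def)
  then have "integrable \<sigma> (\<lambda>v. norm (snd (snd v)))" using m(3) by (subst (asm) integrable_distr_eq) auto
  then show "integrable \<sigma> (\<lambda>v. snd (snd v))" using m(3) by (simp add: integrable_norm_iff)
  have b0: "bounded_borel (\<lambda>x :: 'a. 0)" by (simp add: bounded_borel_def)
  have "\<forall>g h. bounded_borel g \<and> bounded_borel h \<longrightarrow>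
    (\<integral>v. g (fst v) *\<^sub>R (snd (snd v) - fst v) \<partial>\<sigma>) = 0 \<and> (\<integral>v. h (fst (snd v)) *\<^sub>R (snd (snd v) - fst (snd v)) \<partial>\<sigma>) = 0"
    using assms unfolding martingale_triples_def case_prod_unfold by blast
  then show "\<And>g. bounded_borel g \<Longrightarrow> (\<integral>v. g (fst v) *\<^sub>R (snd (snd v) - fst v) \<partial>\<sigma>) = 0"
    "\<And>h. bounded_borel h \<Longrightarrow> (\<integral>v. h (fst (snd v)) *\<^sub>R (snd (snd v) - fst (snd v)) \<partial>\<sigma>) = 0"
    using b0 by blast+
qed

context orth_decomp
begin

text \<open>The part of the expected cost that is determined by the marginals.\<close>

definition base_cost :: "'a measure \<Rightarrow> 'a measure \<Rightarrow> real" where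
  "base_cost \<mu> \<nu> = (\<integral>x. ((norm (Q x))\<^sup>2 - (norm (P x))\<^sup>2) / 2 \<partial>\<mu>) + (\<integral>y. ((norm (P y))\<^sup>2 - (norm (Q y))\<^sup>2) / 2 \<partial>\<nu>)"

text \<open>The squared distance of \<open>(x, y, z)\<close> from the graph of the reconstruction map.\<close>

definition defect :: "'a \<times> 'a \<times> 'a \<Rightarrow> real" where
  "defect = (\<lambda>(x, y, z). (norm (P z - P y))\<^sup>2 + (norm (Q z - Q x))\<^sup>2)"

text \<open>The real-valued integrand of the cost of a triple.\<close>

definition half_cost :: "'a \<times> 'a \<times> 'a \<Rightarrow> real" where
  "half_cost = (\<lambda>(x, y, z). 1/2 * ((norm (x - z))\<^sup>2 + (norm (y - z))\<^sup>2))"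

lemma continuous_defect: "continuous_on UNIV defect"
  unfolding defect_def case_prod_unfold
  by (intro continuous_intros continuous_on_compose2[OF continuous_P[of UNIV]] continuous_on_compose2[OF continuous_Q[of UNIV]]) auto

lemma continuous_half_cost: "continuous_on UNIV half_cost"
  unfolding half_cost_def case_prod_unfold by (intro continuous_intros)

lemma defect_nonneg: "0 \<le> defect v" by (simp add: defect_def case_prod_unfold)

lemma half_cost_nonneg: "0 \<le> half_cost v" by (simp add: half_cost_def case_prod_unfold)

text \<open>The two inner products are martingale increments weighted by functions of \<open>x\<close> and of \<open>y\<close>.\<close>

lemma half_cost_eq:
  "half_cost (x, y, z) = defect (x, y, z) + ((norm (Q x))\<^sup>2 - (norm (P x))\<^sup>2) / 2 + ((norm (P y))\<^sup>2 - (norm (Q y))\<^sup>2) / 2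
    + (Q x - P x) \<bullet> (z - x) + (P y - Q y) \<bullet> (z - y)"
proof -
  have dec: "(norm (u - w))\<^sup>2 = (norm (P u - P w))\<^sup>2 + (norm (Q u - Q w))\<^sup>2" for u w
    by (subst norm_sq_decomp) (simp add: proj_linear_simps)
  have P: "P u \<bullet> (v - w) = P u \<bullet> (P v - P w)" for u v w
    using inner_P[of "v - w" u] by (simp add: proj_linear_simps inner_commute)
  have Q: "Q u \<bullet> (v - w) = Q u \<bullet> (Q v - Q w)" for u v w
    using inner_Q[of "v - w" u] by (simp add: proj_linear_simps inner_commute)
  have "half_cost (x, y, z) = 1/2 * ((norm (P x - P z))\<^sup>2 + (norm (Q x - Q z))\<^sup>2 + ((norm (P y - P z))\<^sup>2 + (norm (Q y - Q z))\<^sup>2))"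
    by (simp only: half_cost_def prod.case dec[of x z] dec[of y z])
  moreover have "(Q x - P x) \<bullet> (z - x) = Q x \<bullet> (Q z - Q x) - P x \<bullet> (P z - P x)"
    "(P y - Q y) \<bullet> (z - y) = P y \<bullet> (P z - P y) - Q y \<bullet> (Q z - Q y)"
    by (simp_all only: inner_diff_left Q[of x z x] P[of x z x] Q[of y z y] P[of y z y])
  moreover have "defect (x, y, z) = (norm (P z - P y))\<^sup>2 + (norm (Q z - Q x))\<^sup>2" by (simp add: defect_def)
  ultimately show ?thesis
    by (simp only: power2_norm_eq_inner inner_diff_left inner_diff_right)
      (simp add: inner_commute field_simps)
qed

lemma square_integrable_sum_product:
  fixes X Z :: "'w \<Rightarrow> 'a"
  assumes "prob_space M" and [measurable]: "X \<in> borel_measurable M" "Z \<in> borel_measurable M"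
    and "integrable M (\<lambda>\<omega>. (norm (X \<omega>))\<^sup>2)" "integrable M (\<lambda>\<omega>. (norm (Z \<omega>))\<^sup>2)"
  shows "integrable M (\<lambda>\<omega>. (norm (X \<omega> + Z \<omega>))\<^sup>2)" "integrable M (\<lambda>\<omega>. norm (X \<omega>) * norm (Z \<omega>))"
proof -
  have int: "integrable M (\<lambda>\<omega>. 2 * ((norm (X \<omega>))\<^sup>2 + (norm (Z \<omega>))\<^sup>2))" using assms(4,5) by simp
  have prod: "norm a * norm b \<le> 2 * ((norm a)\<^sup>2 + (norm b)\<^sup>2)" for a b :: 'a
    using sum_squares_bound[of "norm a" "norm b"] mult_nonneg_nonneg[OF norm_ge_zero[of a] norm_ge_zero[of b]]
      zero_le_power2[of "norm a"] zero_le_power2[of "norm b"]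
    unfolding mult.assoc distrib_left by linarith
  have sum: "(norm (a + b))\<^sup>2 \<le> 2 * ((norm a)\<^sup>2 + (norm b)\<^sup>2)" for a b :: 'a
  proof -
    have "(norm (a + b))\<^sup>2 \<le> (norm a + norm b)\<^sup>2" by (intro power_mono norm_triangle_ineq) simp
    also have "\<dots> \<le> 2 * ((norm a)\<^sup>2 + (norm b)\<^sup>2)"
      using sum_squares_bound[of "norm a" "norm b"] by (simp add: power2_sum)
    finally show ?thesis .
  qed
  show "integrable M (\<lambda>\<omega>. (norm (X \<omega> + Z \<omega>))\<^sup>2)"
  proof (rule Bochner_Integration.integrable_bound[OF int])
    have "norm ((norm (X \<omega> + Z \<omega>))\<^sup>2) \<le> norm (2 * ((norm (X \<omega>))\<^sup>2 + (norm (Z \<omega>))\<^sup>2))" for \<omega>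
      using sum[of "X \<omega>" "Z \<omega>"] by simp
    then show "AE \<omega> in M. norm ((norm (X \<omega> + Z \<omega>))\<^sup>2) \<le> norm (2 * ((norm (X \<omega>))\<^sup>2 + (norm (Z \<omega>))\<^sup>2))" by simp
  qed simp
  show "integrable M (\<lambda>\<omega>. norm (X \<omega>) * norm (Z \<omega>))"
  proof (rule Bochner_Integration.integrable_bound[OF int])
    have "norm (norm (X \<omega>) * norm (Z \<omega>)) \<le> norm (2 * ((norm (X \<omega>))\<^sup>2 + (norm (Z \<omega>))\<^sup>2))" for \<omega>
      using prod[of "X \<omega>" "Z \<omega>"] by simp
    then show "AE \<omega> in M. norm (norm (X \<omega>) * norm (Z \<omega>)) \<le> norm (2 * ((norm (X \<omega>))\<^sup>2 + (norm (Z \<omega>))\<^sup>2))" by simp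
  qed simp
qed

text \<open>The martingale increments in \<open>half_cost_eq\<close> integrate to 0, so that the cost of a triple with
  square integrable third component is the integral of its defect plus a constant depending on \<open>\<mu>\<close> and \<open>\<nu>\<close> only.\<close>

lemma triple_cost_decomposition:
  assumes \<mu>: "\<mu> \<in> finite_moment_prob 2" and \<nu>: "\<nu> \<in> finite_moment_prob 2"
    and \<sigma>: "\<sigma> \<in> martingale_triples \<mu> \<nu>" and Z2: "integrable \<sigma> (\<lambda>v. (norm (snd (snd v)))\<^sup>2)"
  shows "integrable \<sigma> half_cost" "integrable \<sigma> defect"
    "(\<integral>v. half_cost v \<partial>\<sigma>) = (\<integral>v. defect v \<partial>\<sigma>) + base_cost \<mu> \<nu>"
proof -
  note t = triplesD[OF \<sigma>]
  interpret prob_space \<sigma> by (rule t)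
  define X Y Z :: "'a \<times> 'a \<times> 'a \<Rightarrow> 'a" where "X = fst" and "Y = (\<lambda>v. fst (snd v))" and "Z = (\<lambda>v. snd (snd v))"
  have [measurable]: "X \<in> borel_measurable \<sigma>" "Y \<in> borel_measurable \<sigma>" "Z \<in> borel_measurable \<sigma>"
    using t by (auto simp: X_def Y_def Z_def)
  have X2: "integrable \<sigma> (\<lambda>v. (norm (X v))\<^sup>2)" unfolding X_def by (rule distr_L2[OF \<mu> t(3,6)])
  have Y2: "integrable \<sigma> (\<lambda>v. (norm (Y v))\<^sup>2)" unfolding Y_def by (rule distr_L2[OF \<nu> t(4,7)])
  have Z2: "integrable \<sigma> (\<lambda>v. (norm (Z v))\<^sup>2)" using Z2 by (simp add: Z_def)
  have diff2: "integrable \<sigma> (\<lambda>v. (norm (A v - B v))\<^sup>2)"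
    if "A \<in> borel_measurable \<sigma>" "B \<in> borel_measurable \<sigma>" "integrable \<sigma> (\<lambda>v. (norm (A v))\<^sup>2)" "integrable \<sigma> (\<lambda>v. (norm (B v))\<^sup>2)"
    for A B :: "'a \<times> 'a \<times> 'a \<Rightarrow> 'a"
    using square_integrable_sum_product(1)[of \<sigma> A "\<lambda>v. - B v"] that prob_space_axioms by simp
  have proj2: "integrable \<sigma> (\<lambda>v. (norm (P (A v)))\<^sup>2)" "integrable \<sigma> (\<lambda>v. (norm (Q (A v)))\<^sup>2)"
    if [measurable]: "A \<in> borel_measurable \<sigma>" and A: "integrable \<sigma> (\<lambda>v. (norm (A v))\<^sup>2)" for A :: "'a \<times> 'a \<times> 'a \<Rightarrow> 'a"
  proof -
    have "norm ((norm (P (A v)))\<^sup>2) \<le> norm ((norm (A v))\<^sup>2)" "norm ((norm (Q (A v)))\<^sup>2) \<le> norm ((norm (A v))\<^sup>2)" for v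
      using norm_sq_decomp[of "A v"] by simp_all
    then show "integrable \<sigma> (\<lambda>v. (norm (P (A v)))\<^sup>2)" "integrable \<sigma> (\<lambda>v. (norm (Q (A v)))\<^sup>2)"
      by (intro Bochner_Integration.integrable_bound[OF A]; simp)+
  qed
  have hc: "half_cost = (\<lambda>v. 1/2 * ((norm (X v - Z v))\<^sup>2 + (norm (Y v - Z v))\<^sup>2))"
    by (auto simp: half_cost_def X_def Y_def Z_def)
  show int_h: "integrable \<sigma> half_cost"
    unfolding hc by (intro integrable_mult_right Bochner_Integration.integrable_add diff2 X2 Y2 Z2) measurable
  have df: "defect = (\<lambda>v. (norm (P (Z v) - P (Y v)))\<^sup>2 + (norm (Q (Z v) - Q (X v)))\<^sup>2)"
    by (auto simp: defect_def X_def Y_def Z_def)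
  show int_d: "integrable \<sigma> defect"
    unfolding df by (intro Bochner_Integration.integrable_add diff2 proj2 X2 Y2 Z2) measurable
  define b1 where "b1 x = ((norm (Q x))\<^sup>2 - (norm (P x))\<^sup>2) / 2" for x
  define b2 where "b2 y = ((norm (P y))\<^sup>2 - (norm (Q y))\<^sup>2) / 2" for y
  have [measurable]: "b1 \<in> borel_measurable borel" "b2 \<in> borel_measurable borel"
    unfolding b1_def[abs_def] b2_def[abs_def] by measurable
  have int_b: "integrable \<sigma> (\<lambda>v. b1 (X v))" "integrable \<sigma> (\<lambda>v. b2 (Y v))"
    using proj2[OF _ X2] proj2[OF _ Y2] by (simp_all add: b1_def b2_def)
  have cross: "(\<integral>v. G (A v) \<bullet> (Z v - A v) \<partial>\<sigma>) = 0 \<and> integrable \<sigma> (\<lambda>v. G (A v) \<bullet> (Z v - A v))"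
    if [measurable]: "A \<in> borel_measurable \<sigma>" "G \<in> borel_measurable borel" and A2: "integrable \<sigma> (\<lambda>v. (norm (A v))\<^sup>2)"
      and G: "integrable \<sigma> (\<lambda>v. (norm (G (A v)))\<^sup>2)"
      and m: "\<And>g. bounded_borel g \<Longrightarrow> (\<integral>v. g (A v) *\<^sub>R (Z v - A v) \<partial>\<sigma>) = 0"
    for A :: "'a \<times> 'a \<times> 'a \<Rightarrow> 'a" and G :: "'a \<Rightarrow> 'a"
  proof
    have U: "integrable \<sigma> (\<lambda>v. Z v - A v)" using A2 Z2 by (simp add: integrable_of_square)
    have GU: "integrable \<sigma> (\<lambda>v. norm (G (A v)) * norm (Z v - A v))"
      by (rule square_integrable_sum_product(2)[OF prob_space_axioms _ _ G diff2[OF _ _ Z2 A2]]) measurable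
    show "(\<integral>v. G (A v) \<bullet> (Z v - A v) \<partial>\<sigma>) = 0"
      by (rule martingale_increment_orthogonal[where X = A and G = G, OF _ _ U m GU]) auto
    show "integrable \<sigma> (\<lambda>v. G (A v) \<bullet> (Z v - A v))"
      by (rule Bochner_Integration.integrable_bound[OF GU]) (auto simp: Cauchy_Schwarz_ineq2)
  qed
  have cX: "(\<integral>v. (Q (X v) - P (X v)) \<bullet> (Z v - X v) \<partial>\<sigma>) = 0 \<and> integrable \<sigma> (\<lambda>v. (Q (X v) - P (X v)) \<bullet> (Z v - X v))"
    by (rule cross[of X "\<lambda>x. Q x - P x"]) (use t(9) in \<open>auto simp: X_def[symmetric] Z_def[symmetric] intro!: X2 diff2 proj2\<close>, auto simp: X_def Z_def)
  have cY: "(\<integral>v. (P (Y v) - Q (Y v)) \<bullet> (Z v - Y v) \<partial>\<sigma>) = 0 \<and> integrable \<sigma> (\<lambda>v. (P (Y v) - Q (Y v)) \<bullet> (Z v - Y v))"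
    by (rule cross[of Y "\<lambda>x. P x - Q x"]) (use t(10) in \<open>auto intro!: Y2 diff2 proj2\<close>, auto simp: Y_def Z_def)
  have "half_cost v = defect v + b1 (X v) + b2 (Y v) + (Q (X v) - P (X v)) \<bullet> (Z v - X v) + (P (Y v) - Q (Y v)) \<bullet> (Z v - Y v)" for v
    using half_cost_eq[of "X v" "Y v" "Z v"] by (simp add: X_def Y_def Z_def b1_def b2_def)
  then have "(\<integral>v. half_cost v \<partial>\<sigma>) = (\<integral>v. defect v \<partial>\<sigma>) + (\<integral>v. b1 (X v) \<partial>\<sigma>) + (\<integral>v. b2 (Y v) \<partial>\<sigma>)"
    using int_d int_b cX cY by simp
  moreover have "(\<integral>v. b1 (X v) \<partial>\<sigma>) = (\<integral>x. b1 x \<partial>\<mu>)"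
    using integral_distr[of X \<sigma> borel b1] t(6) by (simp add: X_def[symmetric])
  moreover have "(\<integral>v. b2 (Y v) \<partial>\<sigma>) = (\<integral>y. b2 y \<partial>\<nu>)"
    using integral_distr[of Y \<sigma> borel b2] t(7) by (simp add: Y_def[symmetric])
  ultimately show "(\<integral>v. half_cost v \<partial>\<sigma>) = (\<integral>v. defect v \<partial>\<sigma>) + base_cost \<mu> \<nu>"
    by (simp add: base_cost_def b1_def b2_def)
qed

lemma triple_cost_half_cost: "triple_cost \<sigma> = (\<integral>\<^sup>+v. ennreal (half_cost v) \<partial>\<sigma>)"
  by (simp add: triple_cost_def half_cost_def case_prod_unfold)

lemma measurable_recon_map: "recon_map V W \<in> borel_measurable borel"
  unfolding recon_map_def case_prod_unfold
  by (intro borel_measurable_continuous_onI continuous_intros continuous_on_compose2[OF continuous_P[of UNIV]]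
      continuous_on_compose2[OF continuous_Q[of UNIV]]) auto

lemma recon_map_eq: "recon_map V W v = (fst v, snd v, Q (fst v) + P (snd v))"
  by (simp add: recon_map_def case_prod_unfold)

lemma recon_triple:
  assumes \<mu>: "\<mu> \<in> finite_moment_prob 2" and \<nu>: "\<nu> \<in> finite_moment_prob 2"
    and bm: "\<pi> \<in> bimartingale_couplings_wrt \<mu> \<nu> V W"
  defines "\<sigma> \<equiv> distr \<pi> borel (recon_map V W)"
  shows "\<sigma> \<in> martingale_triples \<mu> \<nu>" "triple_cost \<sigma> = ennreal (base_cost \<mu> \<nu>)" "0 \<le> base_cost \<mu> \<nu>"
proof -
  have \<pi>c: "\<pi> \<in> couplings \<mu> \<nu>"
    and m1: "\<And>g. bounded_borel g \<Longrightarrow> (\<integral>v. g (fst v) *\<^sub>R (P (snd v) - P (fst v)) \<partial>\<pi>) = 0"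
    and m2: "\<And>h. bounded_borel h \<Longrightarrow> (\<integral>v. h (snd v) *\<^sub>R (Q (fst v) - Q (snd v)) \<partial>\<pi>) = 0"
    using bm unfolding bimartingale_couplings_wrt_iff[OF \<mu> \<nu>] by auto
  note \<pi> = couplingsD[OF \<pi>c]
  interpret prob_space \<pi> by (rule \<pi>)
  have [measurable]: "recon_map V W \<in> borel_measurable \<pi>"
    using measurable_recon_map \<pi>(2) by (simp cong: measurable_cong_sets)
  note [measurable] = \<pi>(5,6)
  have L2: "integrable \<pi> (\<lambda>v. (norm (fst v))\<^sup>2)" "integrable \<pi> (\<lambda>v. (norm (snd v))\<^sup>2)"
    by (rule distr_L2[OF \<mu> \<pi>(5,3)] distr_L2[OF \<nu> \<pi>(6,4)])+
  have PQ2: "integrable \<pi> (\<lambda>v. (norm (P (snd v)))\<^sup>2)" "integrable \<pi> (\<lambda>v. (norm (Q (fst v)))\<^sup>2)"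
  proof -
    have "norm ((norm (P x))\<^sup>2) \<le> norm ((norm x)\<^sup>2)" "norm ((norm (Q x))\<^sup>2) \<le> norm ((norm x)\<^sup>2)" for x
      using norm_sq_decomp[of x] by simp_all
    then show "integrable \<pi> (\<lambda>v. (norm (P (snd v)))\<^sup>2)" "integrable \<pi> (\<lambda>v. (norm (Q (fst v)))\<^sup>2)"
      by (intro Bochner_Integration.integrable_bound[OF L2(2)] Bochner_Integration.integrable_bound[OF L2(1)]; simp)+
  qed
  have z2: "integrable \<pi> (\<lambda>v. (norm (Q (fst v) + P (snd v)))\<^sup>2)"
    by (rule square_integrable_sum_product(1)[OF prob_space_axioms _ _ PQ2(2,1)]) measurable
  have z1: "integrable \<pi> (\<lambda>v. Q (fst v) + P (snd v))"
    using z2 by (simp add: integrable_of_square)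
  have proj: "(\<lambda>(x, y, z). x) \<in> borel_measurable (borel :: ('a \<times> 'a \<times> 'a) measure)"
    "(\<lambda>(x, y, z). y) \<in> borel_measurable (borel :: ('a \<times> 'a \<times> 'a) measure)"
    "(\<lambda>(x, y, z). z) \<in> borel_measurable (borel :: ('a \<times> 'a \<times> 'a) measure)"
    unfolding case_prod_unfold by (intro borel_measurable_continuous_onI continuous_intros)+
  have d: "distr \<sigma> borel f = distr \<pi> borel (\<lambda>v. f (recon_map V W v))" if "f \<in> borel_measurable borel" for f :: "'a \<times> 'a \<times> 'a \<Rightarrow> 'a"
    unfolding \<sigma>_def using that by (subst distr_distr) (auto simp: comp_def)
  have s\<sigma>: "sets \<sigma> = sets borel" by (simp add: \<sigma>_def)
  have p\<sigma>: "prob_space \<sigma>" unfolding \<sigma>_def by (intro prob_space_distr) measurable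
  have int: "(\<integral>v. f v \<partial>\<sigma>) = (\<integral>v. f (recon_map V W v) \<partial>\<pi>)" if "f \<in> borel_measurable borel" for f :: "'a \<times> 'a \<times> 'a \<Rightarrow> 'b::{banach, second_countable_topology}"
    unfolding \<sigma>_def by (rule integral_distr) (use that in auto)
  have mart: "(\<integral>(x, y, z). g x *\<^sub>R (z - x) \<partial>\<sigma>) = 0" "(\<integral>(x, y, z). g y *\<^sub>R (z - y) \<partial>\<sigma>) = 0"
    if g: "bounded_borel g" for g
  proof -
    have [measurable]: "g \<in> borel_measurable borel" using g by (simp add: bounded_borel_def)
    have gm: "(\<lambda>v. g (fst v) *\<^sub>R (snd (snd v) - fst v)) \<in> borel_measurable (borel :: ('a \<times> 'a \<times> 'a) measure)"
      "(\<lambda>v. g (fst (snd v)) *\<^sub>R (snd (snd v) - fst (snd v))) \<in> borel_measurable (borel :: ('a \<times> 'a \<times> 'a) measure)"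
      using proj unfolding case_prod_unfold by measurable
    have x: "Q x + P y - x = P y - P x" and y: "Q x + P y - y = Q x - Q y" for x y
      using proj_sum[of x] proj_sum[of y] by (metis add.commute add_diff_cancel_left diff_add_eq_diff_diff_swap add_diff_add diff_self add.right_neutral add_diff_eq)+
    show "(\<integral>(x, y, z). g x *\<^sub>R (z - x) \<partial>\<sigma>) = 0"
      using m1[OF g] unfolding case_prod_unfold int[OF gm(1)] by (simp add: recon_map_eq x)
    show "(\<integral>(x, y, z). g y *\<^sub>R (z - y) \<partial>\<sigma>) = 0"
      using m2[OF g] unfolding case_prod_unfold int[OF gm(2)] by (simp add: recon_map_eq y)
  qed
  have "distr \<sigma> borel (\<lambda>(x, y, z). z) \<in> finite_moment_prob 1"
  proof -
    have "distr \<sigma> borel (\<lambda>(x, y, z). z) = distr \<pi> borel (\<lambda>v. Q (fst v) + P (snd v))"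
      unfolding d[OF proj(3)] by (simp add: recon_map_eq)
    moreover have "prob_space (distr \<pi> borel (\<lambda>v. Q (fst v) + P (snd v)))" by (intro prob_space_distr) measurable
    moreover have "integrable (distr \<pi> borel (\<lambda>v. Q (fst v) + P (snd v))) (\<lambda>x. norm x powr 1)"
      using z1 by (subst integrable_distr_eq) auto
    ultimately show ?thesis by (simp add: finite_moment_prob_def borel_prob_def)
  qed
  moreover have "distr \<sigma> borel (\<lambda>(x, y, z). x) = \<mu>" "distr \<sigma> borel (\<lambda>(x, y, z). y) = \<nu>"
    unfolding d[OF proj(1)] d[OF proj(2)] using \<pi>(3,4) by (simp_all add: recon_map_eq)
  ultimately show \<sigma>: "\<sigma> \<in> martingale_triples \<mu> \<nu>"
    using p\<sigma> s\<sigma> mart by (simp add: martingale_triples_def borel_prob_def)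
  have "integrable \<sigma> (\<lambda>v. (norm (snd (snd v)))\<^sup>2)"
    unfolding \<sigma>_def
    by (subst integrable_distr_eq) (use proj(3) z2 in \<open>auto simp: recon_map_eq case_prod_unfold\<close>)
  note c = triple_cost_decomposition[OF \<mu> \<nu> \<sigma> this]
  have "(\<integral>v. defect v \<partial>\<sigma>) = (\<integral>v. defect (recon_map V W v) \<partial>\<pi>)"
    by (intro int borel_measurable_continuous_onI continuous_defect)
  also have "\<dots> = 0" by (simp add: recon_map_eq defect_def proj_linear_simps)
  finally have eq: "(\<integral>v. half_cost v \<partial>\<sigma>) = base_cost \<mu> \<nu>" using c(3) by simp
  then show "triple_cost \<sigma> = ennreal (base_cost \<mu> \<nu>)"
    unfolding triple_cost_half_cost using c(1) by (subst nn_integral_eq_integral) (auto simp: half_cost_nonneg)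
  have "0 \<le> (\<integral>v. half_cost v \<partial>\<sigma>)" by (simp add: half_cost_nonneg)
  then show "0 \<le> base_cost \<mu> \<nu>" using eq by simp
qed

text \<open>The triple reconstructed from a bimartingale coupling has defect 0, so an optimal triple has as well.
  Finite cost gives the third marginal the second moment that the decomposition of the cost needs.\<close>

lemma optimal_triple_reconstruction:
  assumes \<mu>: "\<mu> \<in> finite_moment_prob 2" and \<nu>: "\<nu> \<in> finite_moment_prob 2"
    and opt: "optimal_triple \<mu> \<nu> \<sigma>" and bm: "\<pi> \<in> bimartingale_couplings_wrt \<mu> \<nu> V W"
  shows "AE v in \<sigma>. P (snd (snd v)) = P (fst (snd v)) \<and> Q (snd (snd v)) = Q (fst v)"
proof -
  have \<sigma>: "\<sigma> \<in> martingale_triples \<mu> \<nu>" using opt by (simp add: optimal_triple_def)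
  note t = triplesD[OF \<sigma>]
  interpret prob_space \<sigma> by (rule t)
  note [measurable] = t(3,4,5)
  have hm: "half_cost \<in> borel_measurable \<sigma>"
    using borel_measurable_continuous_onI[OF continuous_half_cost] t(2) by (simp cong: measurable_cong_sets)
  have le: "triple_cost \<sigma> \<le> ennreal (base_cost \<mu> \<nu>)"
    using opt recon_triple(1,2)[OF \<mu> \<nu> bm] unfolding optimal_triple_def triple_value_def
    by (metis INF_lower)
  have "integrable \<sigma> half_cost"
    using hm le by (intro integrableI_nonneg)
      (auto simp: half_cost_nonneg triple_cost_half_cost less_top[symmetric] top_unique)
  moreover have X2: "integrable \<sigma> (\<lambda>v. (norm (fst v))\<^sup>2)" by (rule distr_L2[OF \<mu> t(3,6)])
  ultimately have int: "integrable \<sigma> (\<lambda>v. 4 * half_cost v + 2 * (norm (fst v))\<^sup>2)" by simp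
  have "integrable \<sigma> (\<lambda>v. (norm (snd (snd v)))\<^sup>2)"
  proof (rule Bochner_Integration.integrable_bound[OF int])
    have "(norm z)\<^sup>2 \<le> 4 * half_cost (x, y, z) + 2 * (norm x)\<^sup>2" for x y z
    proof -
      have "norm z \<le> norm (x - z) + norm x" by (metis norm_minus_commute norm_triangle_sub add.commute)
      then have "(norm z)\<^sup>2 \<le> (norm (x - z) + norm x)\<^sup>2" by (intro power_mono) auto
      also have "\<dots> \<le> 2 * (norm (x - z))\<^sup>2 + 2 * (norm x)\<^sup>2"
        using sum_squares_bound[of "norm (x - z)" "norm x"] by (simp add: power2_sum)
      finally show ?thesis using zero_le_power2[of "norm (y - z)"] unfolding half_cost_def prod.case by argo
    qed
    then have "norm ((norm (snd (snd v)))\<^sup>2) \<le> norm (4 * half_cost v + 2 * (norm (fst v))\<^sup>2)" for v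
      by (cases v) (smt (verit) fst_conv snd_conv real_norm_def zero_le_power2)
    then show "AE v in \<sigma>. norm ((norm (snd (snd v)))\<^sup>2) \<le> norm (4 * half_cost v + 2 * (norm (fst v))\<^sup>2)" by simp
  qed measurable
  note c = triple_cost_decomposition[OF \<mu> \<nu> \<sigma> this]
  have "ennreal (\<integral>v. half_cost v \<partial>\<sigma>) \<le> ennreal (base_cost \<mu> \<nu>)"
    using le c(1) unfolding triple_cost_half_cost by (subst (asm) nn_integral_eq_integral) (auto simp: half_cost_nonneg)
  then have "(\<integral>v. defect v \<partial>\<sigma>) \<le> 0"
    using c(3) recon_triple(3)[OF \<mu> \<nu> bm] by (simp add: ennreal_le_iff)
  then have "(\<integral>v. defect v \<partial>\<sigma>) = 0" by (intro antisym) (simp_all add: defect_nonneg)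
  then have "AE v in \<sigma>. defect v = 0"
    using integral_nonneg_eq_0_iff_AE[OF c(2)] by (simp add: defect_nonneg)
  then show ?thesis
    by eventually_elim (auto simp: defect_def case_prod_unfold sum_power2_eq_zero_iff)
qed

theorem optimal_triple_bimartingale:
  assumes \<mu>: "\<mu> \<in> finite_moment_prob 2" and \<nu>: "\<nu> \<in> finite_moment_prob 2"
    and opt: "optimal_triple \<mu> \<nu> \<sigma>" and bm: "\<pi> \<in> bimartingale_couplings_wrt \<mu> \<nu> V W"
  shows "marginal12 \<sigma> \<in> bimartingale_couplings_wrt \<mu> \<nu> V W"
    and "\<sigma> = distr (marginal12 \<sigma>) borel (recon_map V W)"
proof -
  have \<sigma>: "\<sigma> \<in> martingale_triples \<mu> \<nu>" using opt by (simp add: optimal_triple_def)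
  note t = triplesD[OF \<sigma>]
  note AE = optimal_triple_reconstruction[OF assms]
  interpret prob_space \<sigma> by (rule t)
  note [measurable] = t(3,4,5)
  define p12 :: "'a \<times> 'a \<times> 'a \<Rightarrow> 'a \<times> 'a" where "p12 = (\<lambda>(x, y, z). (x, y))"
  have p12: "p12 v = (fst v, fst (snd v))" for v by (simp add: p12_def case_prod_unfold)
  have "p12 \<in> borel_measurable borel"
    unfolding p12_def case_prod_unfold by (intro borel_measurable_continuous_onI continuous_intros)
  then have pm [measurable]: "p12 \<in> borel_measurable \<sigma>" using t(2) by (simp cong: measurable_cong_sets)
  have m12: "marginal12 \<sigma> = distr \<sigma> borel p12" by (simp add: marginal12_def p12_def)
  have rm: "recon_map V W \<in> borel_measurable borel" by (rule measurable_recon_map)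
  have "distr (marginal12 \<sigma>) borel (recon_map V W) = distr \<sigma> borel (recon_map V W \<circ> p12)"
    unfolding m12 by (rule distr_distr[OF rm pm])
  also have "\<dots> = distr \<sigma> borel (\<lambda>v. v)"
  proof (rule distr_cong_AE)
    show "AE v in \<sigma>. (recon_map V W \<circ> p12) v = v"
      using AE
    proof eventually_elim
      case (elim v)
      have "Q (fst v) + P (fst (snd v)) = snd (snd v)"
        using elim proj_sum[of "snd (snd v)"] by (metis add.commute)
      then show ?case by (simp add: recon_map_eq p12)
    qed
    show "recon_map V W \<circ> p12 \<in> borel_measurable \<sigma>" by (rule measurable_comp[OF pm rm])
    show "(\<lambda>v. v) \<in> borel_measurable \<sigma>" using t(2) by (simp cong: measurable_cong_sets)
  qed simp_all
  also have "\<dots> = \<sigma>" using t(2) by (intro distr_id2) simp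
  finally show "\<sigma> = distr (marginal12 \<sigma>) borel (recon_map V W)" by simp
  have marg: "distr (marginal12 \<sigma>) borel fst = \<mu>" "distr (marginal12 \<sigma>) borel snd = \<nu>"
    unfolding m12 using borel_measurable_projections pm t(6,7)
    by (subst distr_distr; simp add: comp_def p12)+
  have c: "marginal12 \<sigma> \<in> couplings \<mu> \<nu>"
    using marg prob_space_distr[OF pm] by (simp add: couplings_def borel_prob_def m12)
  have int: "(\<integral>v. f v \<partial>marginal12 \<sigma>) = (\<integral>v. f (p12 v) \<partial>\<sigma>)" if "f \<in> borel_measurable borel" for f :: "'a \<times> 'a \<Rightarrow> 'a"
    unfolding m12 by (rule integral_distr[OF pm that])
  have fs[measurable]: "fst \<in> borel_measurable (borel :: ('a \<times> 'a) measure)" "snd \<in> borel_measurable (borel :: ('a \<times> 'a) measure)"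
    by (rule borel_measurable_projections)+
  have i: "integrable \<sigma> fst" "integrable \<sigma> (\<lambda>v. fst (snd v))"
    using distr_L2[OF \<mu> t(3,6)] distr_L2[OF \<nu> t(4,7)] by (simp_all add: integrable_of_square)
  have "(\<integral>v. g (fst v) *\<^sub>R (P (snd v) - P (fst v)) \<partial>marginal12 \<sigma>) = 0" if g: "bounded_borel g" for g
  proof -
    have [measurable]: "g \<in> borel_measurable borel" using g by (simp add: bounded_borel_def)
    have "(\<integral>v. g (fst v) *\<^sub>R (P (snd v) - P (fst v)) \<partial>marginal12 \<sigma>) = (\<integral>v. g (fst v) *\<^sub>R (P (fst (snd v)) - P (fst v)) \<partial>\<sigma>)"
      by (subst int) (measurable, simp add: p12)
    also have "\<dots> = (\<integral>v. P (g (fst v) *\<^sub>R (snd (snd v) - fst v)) \<partial>\<sigma>)"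
    proof (rule integral_cong_AE)
      show "AE v in \<sigma>. g (fst v) *\<^sub>R (P (fst (snd v)) - P (fst v)) = P (g (fst v) *\<^sub>R (snd (snd v) - fst v))"
        using AE by eventually_elim (simp add: proj_linear_simps)
    qed measurable
    also have "\<dots> = P (\<integral>v. g (fst v) *\<^sub>R (snd (snd v) - fst v) \<partial>\<sigma>)"
      by (intro integral_bounded_linear[OF bounded_linear_P] integrable_bounded_borel_scaleR[OF t(3) _ g]
          Bochner_Integration.integrable_diff i t(8))
    finally show ?thesis using t(9)[OF g] by (simp add: proj_linear_simps)
  qed
  moreover have "(\<integral>v. g (snd v) *\<^sub>R (Q (fst v) - Q (snd v)) \<partial>marginal12 \<sigma>) = 0" if g: "bounded_borel g" for g
  proof -
    have [measurable]: "g \<in> borel_measurable borel" using g by (simp add: bounded_borel_def)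
    have "(\<integral>v. g (snd v) *\<^sub>R (Q (fst v) - Q (snd v)) \<partial>marginal12 \<sigma>) = (\<integral>v. g (fst (snd v)) *\<^sub>R (Q (fst v) - Q (fst (snd v))) \<partial>\<sigma>)"
      by (subst int) (measurable, simp add: p12)
    also have "\<dots> = (\<integral>v. Q (g (fst (snd v)) *\<^sub>R (snd (snd v) - fst (snd v))) \<partial>\<sigma>)"
    proof (rule integral_cong_AE)
      show "AE v in \<sigma>. g (fst (snd v)) *\<^sub>R (Q (fst v) - Q (fst (snd v))) = Q (g (fst (snd v)) *\<^sub>R (snd (snd v) - fst (snd v)))"
        using AE by eventually_elim (simp add: proj_linear_simps)
    qed measurable
    also have "\<dots> = Q (\<integral>v. g (fst (snd v)) *\<^sub>R (snd (snd v) - fst (snd v)) \<partial>\<sigma>)"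
      by (intro integral_bounded_linear[OF bounded_linear_Q] integrable_bounded_borel_scaleR[OF t(4) _ g]
          Bochner_Integration.integrable_diff i t(8))
    finally show ?thesis using t(10)[OF g] by (simp add: proj_linear_simps)
  qed
  ultimately show "marginal12 \<sigma> \<in> bimartingale_couplings_wrt \<mu> \<nu> V W"
    using c by (simp add: bimartingale_couplings_wrt_iff[OF \<mu> \<nu>])
qed

end

theorem theorem3p13:
  fixes \<mu> \<nu> :: "(real ^ 'n) measure"
  assumes "\<mu> \<in> finite_moment_prob 2" and "\<nu> \<in> finite_moment_prob 2"
    and "barycentre \<mu> = barycentre \<nu>"
  shows "(cc_order \<mu> \<nu> \<longleftrightarrow> (\<exists>\<pi>. \<pi> \<in> bimartingale_couplings \<mu> \<nu>)) \<and>
    (\<forall>V\<^sub>1 V\<^sub>2. orthogonal_complementing V\<^sub>1 V\<^sub>2 \<longrightarrow>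
      ((\<exists>\<pi>. \<pi> \<in> bimartingale_couplings_wrt \<mu> \<nu> V\<^sub>1 V\<^sub>2) \<longleftrightarrow> cc_order_wrt V\<^sub>1 V\<^sub>2 \<mu> \<nu>) \<and>
      (\<forall>\<sigma>. optimal_triple \<mu> \<nu> \<sigma> \<and> cc_order_wrt V\<^sub>1 V\<^sub>2 \<mu> \<nu> \<longrightarrow>
        marginal12 \<sigma> \<in> bimartingale_couplings_wrt \<mu> \<nu> V\<^sub>1 V\<^sub>2 \<and>
        \<sigma> = distr (marginal12 \<sigma>) borel (recon_map V\<^sub>1 V\<^sub>2)))"
proof -
  have iff: "(\<exists>\<pi>. \<pi> \<in> bimartingale_couplings_wrt \<mu> \<nu> V W) \<longleftrightarrow> cc_order_wrt V W \<mu> \<nu>"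
    if "orthogonal_complementing V W" for V W
    using orth_decomp.bimartingale_imp_cc_order[OF orth_decomp.intro[OF that] assms(1,2)]
      orth_decomp.cc_order_imp_bimartingale[OF orth_decomp.intro[OF that] assms(1,2)] by blast
  have "cc_order \<mu> \<nu> \<longleftrightarrow> (\<exists>\<pi>. \<pi> \<in> bimartingale_couplings \<mu> \<nu>)"
    unfolding cc_order_def bimartingale_couplings_def using iff by blast
  moreover have "marginal12 \<sigma> \<in> bimartingale_couplings_wrt \<mu> \<nu> V W \<and> \<sigma> = distr (marginal12 \<sigma>) borel (recon_map V W)"
    if VW: "orthogonal_complementing V W" and "optimal_triple \<mu> \<nu> \<sigma>" "cc_order_wrt V W \<mu> \<nu>" for V W \<sigma>
    using orth_decomp.optimal_triple_bimartingale[OF orth_decomp.intro[OF VW] assms(1,2) that(2)] iff[OF VW] that(3)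
    by blast
  ultimately show ?thesis using iff by blast
qed

end
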